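(* Assume the setting of the context and that $g$ satisfies Assumption 1 with parameter $\nu>1/2$. Let $1\le p,q\le\infty$, $A>0$, $p'=\min(2,p)$, and let $s\ge1/p'$ satisfy $s\ge(2\nu+1)(1/p-1/2)$ and $s>2\nu+1$. Then there exists a constant $M_1>0$ depending only on $A,s,p,q$ such that for all sufficiently large $n$, $$\inf_{\hat f_n}\sup_{f\in B^s_{p,q}(A)}\mathbb E_f\|\hat f_n-f\|^2\ge M_1\,n^{-2s/(2s+2\nu+1)},$$ where the infimum is over all estimators $\hat f_n$, i.e. all measurable functions of $(Y_1,\dots,Y_n)$ with values in $L^2([0,1])$.
   Context: Model: $f:\mathbb R\to\mathbb R$ 1-periodic, $f\in L^2([0,1])$; $g$ a probability density on $\mathbb R$ with $\gamma_\ell=\int_{\mathbb R}e^{-2i\pi\ell x}g(x)dx$. For $n\ge1$ and fixed $\varepsilon>0$ one observes $dY_m(x)=f(x-\tau_m)dx+\varepsilon dW_m(x)$, $x\in[0,1]$, $m=1,\dots,n$, with $W_m$ independent standard Brownian motions and $\tau_m$ i.i.d. with density $g$ independent of the $W_m$. $\mathbb E_f$ denotes expectation when $f$ is the true shape. Assumption 1: there are $\nu>0$, $C_{\max}\ge C_{\min}>0$ with $C_{\min}|\ell|^{-\nu}\le|\gamma_\ell|\le C_{\max}|\ell|^{-\nu}$ for all $\ell\neq0$. Besov ball $B^s_{p,q}(A)$: with $\{\phi_{j,k},\psi_{j,k}\}$ the periodized Meyer wavelet basis of $L^2([0,1])$, $c_{0,0}=\int_0^1 f\phi_{0,0}$,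 $\beta_{j,k}=\int_0^1 f\psi_{j,k}$, it is the set of $f\in L^2([0,1])$ with $|c_{0,0}|+\big(\sum_{j\ge0}2^{j(s+1/2-1/p)q}(\sum_{k=0}^{2^j-1}|\beta_{j,k}|^p)^{q/p}\big)^{1/q}\le A$ (maxima replacing sums when $p$ or $q=\infty$).
   Formalization: M_1 may depend on the fixed model data g, ε, ν and the chosen Meyer wavelet, besides A,s,p,q (a constant independent of ε or g is impossible: the minimax constant tends to 0 as ε→0); the white-noise observations are represented by their Fourier coordinates. *)

theory Defs
  imports "HOL-Probability.Probability"
begin

definition meyer_aux :: "(real \<Rightarrow> real) \<Rightarrow> bool" where
  "meyer_aux vb \<longleftrightarrow>
     (\<forall>x. x \<le> 0 \<longrightarrow> vb x = 0) \<and> (\<forall>x. 1 \<le> x \<longrightarrow> vb x = 1) \<and>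
     (\<forall>x. vb x + vb (1 - x) = 1) \<and>
     (\<forall>k x. ((deriv ^^ k) vb) differentiable (at x))"

text \<open>Fourier transforms (convention: hat h(xi) = integral of h(x) exp(-i x xi) dx).\<close>
definition meyer_phi_hat :: "(real \<Rightarrow> real) \<Rightarrow> real \<Rightarrow> complex" where
  "meyer_phi_hat vb \<xi> =
     (if \<bar>\<xi>\<bar> \<le> 2*pi/3 then 1
      else if \<bar>\<xi>\<bar> \<le> 4*pi/3 then complex_of_real (cos (pi/2 * vb (3*\<bar>\<xi>\<bar>/(2*pi) - 1)))
      else 0)"

definition meyer_psi_hat :: "(real \<Rightarrow> real) \<Rightarrow> real \<Rightarrow> complex" where
  "meyer_psi_hat vb \<xi> =
     (if 2*pi/3 \<le> \<bar>\<xi>\<bar> \<and> \<bar>\<xi>\<bar> \<le> 4*pi/3 then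
        cis (\<xi>/2) * complex_of_real (sin (pi/2 * vb (3*\<bar>\<xi>\<bar>/(2*pi) - 1)))
      else if 4*pi/3 < \<bar>\<xi>\<bar> \<and> \<bar>\<xi>\<bar> \<le> 8*pi/3 then
        cis (\<xi>/2) * complex_of_real (cos (pi/2 * vb (3*\<bar>\<xi>\<bar>/(4*pi) - 1)))
      else 0)"

text \<open>Periodization of h_{j,k}(x) = 2^{j/2} h(2^j x - k): its l-th Fourier coefficient is
  2^{-j/2} exp(-2 i pi l k/2^j) hat h(2 pi l/2^j); the sums below are over ranges
  containing the (compact) Fourier supports, hence exact.\<close>
definition meyer_phi_per :: "(real \<Rightarrow> real) \<Rightarrow> nat \<Rightarrow> nat \<Rightarrow> real \<Rightarrow> real" where
  "meyer_phi_per vb j k x = Re (\<Sum>l\<in>{-(2^(j+1))..(2::int)^(j+1)}.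
      complex_of_real (2 powr (- real j / 2)) * meyer_phi_hat vb (2*pi * of_int l / 2^j)
      * cis (2*pi * of_int l*(x - real k / 2^j)))"

definition meyer_psi_per :: "(real \<Rightarrow> real) \<Rightarrow> nat \<Rightarrow> nat \<Rightarrow> real \<Rightarrow> real" where
  "meyer_psi_per vb j k x = Re (\<Sum>l\<in>{-(2^(j+2))..(2::int)^(j+2)}.
      complex_of_real (2 powr (- real j / 2)) * meyer_psi_hat vb (2*pi * of_int l / 2^j)
      * cis (2*pi * of_int l*(x - real k / 2^j)))"

definition scal_coef :: "(real \<Rightarrow> real) \<Rightarrow> (real \<Rightarrow> real) \<Rightarrow> real" where
  "scal_coef vb f = (LINT x:{0..1}|lborel. f x * meyer_phi_per vb 0 0 x)"

definition wav_coef :: "(real \<Rightarrow> real) \<Rightarrow> (real \<Rightarrow> real) \<Rightarrow> nat \<Rightarrow> nat \<Rightarrow> real" where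
  "wav_coef vb f j k = (LINT x:{0..1}|lborel. f x * meyer_psi_per vb j k x)"

definition inv_ex :: "ereal \<Rightarrow> real" where
  "inv_ex p = (if p = \<infinity> then 0 else 1 / real_of_ereal p)"

definition seq_pnorm :: "ereal \<Rightarrow> (nat \<Rightarrow> real) \<Rightarrow> nat \<Rightarrow> real" where
  "seq_pnorm p b N = (if p = \<infinity> then Max ((\<lambda>k. \<bar>b k\<bar>) ` {..<N})
      else (\<Sum>k<N. \<bar>b k\<bar> powr real_of_ereal p) powr (1 / real_of_ereal p))"

definition besov_level :: "(real \<Rightarrow> real) \<Rightarrow> real \<Rightarrow> ereal \<Rightarrow> (real \<Rightarrow> real) \<Rightarrow> nat \<Rightarrow> real" where
  "besov_level vb s p f j = 2 powr (real j * (s + 1/2 - inv_ex p)) * seq_pnorm p (wav_coef vb f j) (2^j)"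

definition besov_ball :: "(real \<Rightarrow> real) \<Rightarrow> real \<Rightarrow> ereal \<Rightarrow> ereal \<Rightarrow> real \<Rightarrow> (real \<Rightarrow> real) set" where
  "besov_ball vb s p q A = {f.
      f \<in> borel_measurable lborel \<and> (\<forall>x. f (x + 1) = f x) \<and>
      set_integrable lborel {0..1} (\<lambda>x. (f x)^2) \<and>
      (if q = \<infinity> then
         bdd_above (range (besov_level vb s p f)) \<and>
         \<bar>scal_coef vb f\<bar> + (SUP j. besov_level vb s p f j) \<le> A
       else
         summable (\<lambda>j. besov_level vb s p f j powr real_of_ereal q) \<and>
         \<bar>scal_coef vb f\<bar> + (\<Sum>j. besov_level vb s p f j powr real_of_ereal q) powr (1 / real_of_ereal q) \<le> A)}"

section \<open>Observation model (in Fourier coordinates of the white noise model)\<close>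

definition fourier_coef :: "(real \<Rightarrow> real) \<Rightarrow> int \<Rightarrow> complex" where
  "fourier_coef f l = (LINT x:{0..1}|lborel. complex_of_real (f x) * cis (- 2*pi * of_int l*x))"

definition gamma_coef :: "(real \<Rightarrow> real) \<Rightarrow> int \<Rightarrow> complex" where
  "gamma_coef g l = integral\<^sup>L lborel (\<lambda>x. complex_of_real (g x) * cis (- 2*pi * of_int l*x))"

text \<open>Coordinates of a standard (real) Brownian motion increment in the complex exponential
  basis e_l(x) = exp(2 i pi l x), built from i.i.d. N(0,1) variables z:
  z 0 = int dW, z l = int sqrt2 cos(2 pi l x) dW, z (-l) = int sqrt2 sin(2 pi l x) dW (l>0).\<close>
definition noise_coord :: "(int \<Rightarrow> real) \<Rightarrow> int \<Rightarrow> complex" where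
  "noise_coord z l =
     (if l = 0 then complex_of_real (z 0)
      else if l > 0 then (complex_of_real (z l) - \<i> * complex_of_real (z (- l))) / complex_of_real (sqrt 2)
      else (complex_of_real (z (- l)) + \<i> * complex_of_real (z l)) / complex_of_real (sqrt 2))"

definition std_gauss_seq :: "(int \<Rightarrow> real) measure" where
  "std_gauss_seq = PiM UNIV (\<lambda>_. density lborel (\<lambda>x. ennreal (std_normal_density x)))"

text \<open>Sample space of one observed curve Y_m: its coordinates int_0^1 e_{-l}(x) dY_m(x).\<close>
definition curve_space :: "(int \<Rightarrow> complex) measure" where
  "curve_space = PiM UNIV (\<lambda>_. borel)"

text \<open>Law of one curve: int_0^1 e^{-2 i pi l x} dY(x) = theta_l e^{-2 i pi l tau} + eps xi_l.\<close>
definition curve_law :: "(real \<Rightarrow> real) \<Rightarrow> real \<Rightarrow> (real \<Rightarrow> real) \<Rightarrow> (int \<Rightarrow> complex) measure" where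
  "curve_law g \<epsilon> f = distr (density lborel (\<lambda>x. ennreal (g x)) \<Otimes>\<^sub>M std_gauss_seq) curve_space
      (\<lambda>(t, z). \<lambda>l. fourier_coef f l * cis (- 2*pi * of_int l*t) + complex_of_real \<epsilon> * noise_coord z l)"

definition obs_law :: "(real \<Rightarrow> real) \<Rightarrow> real \<Rightarrow> nat \<Rightarrow> (real \<Rightarrow> real) \<Rightarrow> (nat \<Rightarrow> int \<Rightarrow> complex) measure" where
  "obs_law g \<epsilon> n f = PiM {..<n} (\<lambda>_. curve_law g \<epsilon> f)"

definition obs_space :: "nat \<Rightarrow> (nat \<Rightarrow> int \<Rightarrow> complex) measure" where
  "obs_space n = PiM {..<n} (\<lambda>_. curve_space)"

definition estimators :: "nat \<Rightarrow> ((nat \<Rightarrow> int \<Rightarrow> complex) \<Rightarrow> real \<Rightarrow> real) set" where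
  "estimators n = {fh. (\<lambda>(Y, x). fh Y x) \<in> borel_measurable (obs_space n \<Otimes>\<^sub>M lborel)}"

definition risk :: "(real \<Rightarrow> real) \<Rightarrow> real \<Rightarrow> nat \<Rightarrow> ((nat \<Rightarrow> int \<Rightarrow> complex) \<Rightarrow> real \<Rightarrow> real)
      \<Rightarrow> (real \<Rightarrow> real) \<Rightarrow> ennreal" where
  "risk g \<epsilon> n fh f = (\<integral>\<^sup>+ Y. (\<integral>\<^sup>+ x\<in>{0..1}. ennreal ((fh Y x - f x)^2) \<partial>lborel) \<partial>obs_law g \<epsilon> n f)"

definition prob_density :: "(real \<Rightarrow> real) \<Rightarrow> bool" where
  "prob_density g \<longleftrightarrow> g \<in> borel_measurable lborel \<and> (\<forall>x. 0 \<le> g x) \<and>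
      (\<integral>\<^sup>+ x. ennreal (g x) \<partial>lborel) = 1"

definition assumption1 :: "(real \<Rightarrow> real) \<Rightarrow> real \<Rightarrow> bool" where
  "assumption1 g \<nu> \<longleftrightarrow> \<nu> > 0 \<and> (\<exists>Cmin Cmax. 0 < Cmin \<and> Cmin \<le> Cmax \<and>
      (\<forall>l::int. l \<noteq> 0 \<longrightarrow>
         Cmin * real_of_int \<bar>l\<bar> powr (- \<nu>) \<le> cmod (gamma_coef g l) \<and>
         cmod (gamma_coef g l) \<le> Cmax * real_of_int \<bar>l\<bar> powr (- \<nu>)))"

end

theory Submission
  imports Defs
begin

text \<open>
  Assouad's lemma on the cube of functions \<open>a \<Sum>\<^sub>k \<plusminus> K(x - k/N) cos(4\<pi>Nx)\<close>, \<open>k < N = 2\<^sup>J\<close>, where \<open>K\<close> is the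
  Fejer kernel scaled so that \<open>\<Sum>\<^sub>k K(x - k/N) = 1\<close> and \<open>a\<close> is of order \<open>N powr (-s)\<close>. Such a function is
  bounded by \<open>a\<close> and has frequencies in \<open>(N, 3N)\<close>, so only four wavelet levels see it; since the
  periodized wavelets satisfy \<open>\<parallel>\<psi>\<^sub>j\<^sub>k\<parallel>\<^sub>1 \<le> C 2 powr (-j/2)\<close>, it lies in the Besov ball whatever \<open>p\<close> and \<open>q\<close> are.

  Changing one sign perturbs the function by \<open>h\<close> with \<open>\<parallel>h\<parallel>\<^sup>2 \<le> 4a\<^sup>2/N\<close>. The law of one curve is a mixture over the
  random shift of Gaussian laws, with likelihood ratio \<open>\<Lambda>\<close> against pure noise, and Jensen's inequality
  \<open>1/\<Lambda> \<le> \<integral> 1/L\<^sub>t dt\<close> turns the chi-square distance of two such mixtures into an explicit second difference of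
  exponentials. Its leading term is \<open>\<Sum>\<^sub>l |h\<^sub>l|\<^sup>2 |\<gamma>\<^sub>l|\<^sup>2/\<epsilon>\<^sup>2\<close>, of order \<open>\<parallel>h\<parallel>\<^sup>2 N powr (-2\<nu>)\<close>, and the rest is
  \<open>O(\<parallel>h\<parallel>\<^sup>2 a\<^sup>2)\<close>, which is smaller because \<open>s > \<nu>\<close>. With \<open>N powr (2s+2\<nu>+1) \<ge> n\<close> the \<open>n\<close>-sample chi-square distance
  stays bounded, and every sign costs a loss of order \<open>a\<^sup>2/N\<close> on its own cell.
\<close>

section \<open>Fourier series on the unit interval\<close>

text \<open>With known shifts the chi-square distance per curve would be of order |h|^2, and only
  the rate n^(-2s/(2s+1)) would follow. The gain N^(-2 nu) appears only after averaging over the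
  shift. The obstacle is that all unflipped signs remain in the reference law, so the denominator of
  the chi-square integral is itself a mixture. Jensen's inequality removes it at the price of a
  third independent shift; then every Gaussian integral is the exponential of a bilinear form. What
  is of first order in the perturbation enters only through a product of two such factors, and the
  bilinear term, averaged over two independent shifts, becomes the square of a mean.

  The bumps have to meet competing demands: an exactly finite spectrum, so that the likelihood is a
  finite Gaussian formula; a spectrum far from 0, where the gamma coefficients are small;
  concentration on cells, so that signs are lost independently; and a sup norm that does not depend
  on the signs. A modulated Fejer kernel meets them all with explicit estimates. The scale balances
  n a^2 N^(-1-2 nu) against 1 for a of order N^(-s).\<close>

lemma has_integral_cis:
  "((\<lambda>x. cis (2*pi * of_int l * x)) has_integral (if l = 0 then 1 else 0)) {0..1::real}"
proof (cases "l = 0")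
  case True
  then show ?thesis using has_integral_const_real[of "1::complex" 0 1] by simp
next
  case False
  define c where "c = 2 * pi * of_int l"
  have c: "c \<noteq> 0" using False by (simp add: c_def)
  have "((\<lambda>x. cis (c * x)) has_integral (cis (c * 1) / (\<i> * c) - cis (c * 0) / (\<i> * c))) {0..1}"
  proof (rule fundamental_theorem_of_calculus)
    fix x :: real
    have "((\<lambda>z. exp (\<i> * c * z) / (\<i> * c)) has_field_derivative exp (\<i> * c * of_real x)) (at (of_real x))"
      using c by (auto intro!: derivative_eq_intros)
    from has_vector_derivative_real_field[OF this]
    show "((\<lambda>x. cis (c * x) / (\<i> * c)) has_vector_derivative cis (c * x)) (at x within {0..1})"
      by (simp add: cis_conv_exp mult.assoc)
  qed simp
  moreover have "cis (c * 1) = 1" unfolding c_def using cis_multiple_2pi[of "of_int l"] by simp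
  ultimately show ?thesis using False by (simp add: c_def)
qed

text \<open>Parseval for trigonometric polynomials. The translation \<open>y\<close> is carried
  along because wavelets and Fejer kernels are used at shifted centres; it only turns each
  coefficient by a phase.\<close>

lemma has_integral_trig_poly_sq:
  assumes "finite S"
  shows "((\<lambda>x. (cmod (\<Sum>l\<in>S. b l * cis (2*pi * of_int l * (x - y))))\<^sup>2) has_integral (\<Sum>l\<in>S. (cmod (b l))\<^sup>2)) {0..1}"
proof -
  define d where "d l = b l * cis (- (2*pi * of_int l * y))" for l
  have bd: "b l * cis (2*pi * of_int l * (x - y)) = d l * cis (2*pi * of_int l * x)" for l x
    by (simp add: d_def mult.assoc cis_mult algebra_simps)
  have nd: "cmod (d l) = cmod (b l)" for l by (simp add: d_def norm_mult)
  have dd: "d l * cnj (d l) = complex_of_real ((cmod (b l))\<^sup>2)" for l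
    using complex_norm_square[of "d l"] nd by simp
  have "((\<lambda>x. \<Sum>l\<in>S. \<Sum>m\<in>S. (d l * cnj (d m)) * cis (2*pi * of_int (l - m) * x)) has_integral
     (\<Sum>l\<in>S. \<Sum>m\<in>S. (d l * cnj (d m)) * (if l - m = 0 then 1 else 0))) {0..1}"
    by (intro has_integral_sum assms has_integral_mult_right has_integral_cis)
  moreover have "(\<Sum>l\<in>S. \<Sum>m\<in>S. (d l * cnj (d m)) * (if l - m = 0 then 1 else 0)) = complex_of_real (\<Sum>l\<in>S. (cmod (b l))\<^sup>2)"
    using assms by (simp add: if_distrib[of "\<lambda>z. _ * z"] sum.delta dd cong: if_cong)
  moreover have "(\<Sum>l\<in>S. \<Sum>m\<in>S. (d l * cnj (d m)) * cis (2*pi * of_int (l - m) * x)) =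
     complex_of_real ((cmod (\<Sum>l\<in>S. b l * cis (2*pi * of_int l * (x - y))))\<^sup>2)" for x
    unfolding bd complex_norm_square cnj_sum sum_product
  proof (intro sum.cong refl)
    fix l m
    have "cis (2*pi * of_int (l - m) * x) = cis (2*pi * of_int l * x) * cnj (cis (2*pi * of_int m * x))"
      by (simp add: cis_cnj cis_mult algebra_simps)
    then show "d l * cnj (d m) * cis (2*pi * of_int (l - m) * x) = d l * cis (2*pi * of_int l * x) * cnj (d m * cis (2*pi * of_int m * x))"
      by (simp only: complex_cnj_mult mult_ac)
  qed
  ultimately have "((\<lambda>x. complex_of_real ((cmod (\<Sum>l\<in>S. b l * cis (2*pi * of_int l * (x - y))))\<^sup>2)) has_integral
    complex_of_real (\<Sum>l\<in>S. (cmod (b l))\<^sup>2)) {0..1}" by simp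
  from has_integral_linear[OF this bounded_linear_Re] show ?thesis by (simp add: o_def)
qed

lemma fourier_coef_has_integral:
  assumes "continuous_on UNIV f"
  shows "((\<lambda>x. complex_of_real (f x) * cis (- 2*pi * of_int l*x)) has_integral fourier_coef f l) {0..1}"
proof -
  have "continuous_on {0..1} (\<lambda>x. complex_of_real (f x) * cis (- 2*pi * of_int l*x))"
    by (intro continuous_intros continuous_on_subset[OF assms]) auto
  then have "set_integrable lborel {0..1} (\<lambda>x. complex_of_real (f x) * cis (- 2*pi * of_int l*x))"
    by (rule borel_integrable_atLeastAtMost')
  from set_borel_integral_eq_integral[OF this] show ?thesis
    unfolding fourier_coef_def by (simp only: integrable_integral)
qed

text \<open>Bessel's inequality. An upper bound suffices, because Fourier coefficients enter later
  only through bounds on the energy of a signal.\<close>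

lemma fourier_coef_bessel:
  assumes f: "continuous_on UNIV f" and S: "finite S"
  shows "(\<Sum>l\<in>S. (cmod (fourier_coef f l))\<^sup>2) \<le> integral {0..1} (\<lambda>x. (f x)\<^sup>2)"
proof -
  let ?\<theta> = "fourier_coef f"
  let ?g = "\<lambda>x. \<Sum>l\<in>S. ?\<theta> l * cis (2*pi * of_int l * x)"
  define B where "B = (\<Sum>l\<in>S. (cmod (?\<theta> l))\<^sup>2)"
  have fi: "((\<lambda>x. (f x)\<^sup>2) has_integral integral {0..1} (\<lambda>x. (f x)\<^sup>2)) {0..1}"
    by (intro integrable_integral integrable_continuous_interval continuous_intros continuous_on_subset[OF f]) auto
  have gi: "((\<lambda>x. (cmod (?g x))\<^sup>2) has_integral B) {0..1}"
    unfolding B_def using has_integral_trig_poly_sq[OF S, of ?\<theta> 0] by simp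
  have "((\<lambda>x. \<Sum>l\<in>S. cnj (?\<theta> l) * (complex_of_real (f x) * cis (- 2*pi * of_int l*x))) has_integral (\<Sum>l\<in>S. cnj (?\<theta> l) * ?\<theta> l)) {0..1}"
    by (intro has_integral_sum S has_integral_mult_right fourier_coef_has_integral f)
  from has_integral_linear[OF this bounded_linear_Re]
  have ci: "((\<lambda>x. Re (\<Sum>l\<in>S. cnj (?\<theta> l) * (complex_of_real (f x) * cis (- 2*pi * of_int l*x)))) has_integral Re (\<Sum>l\<in>S. cnj (?\<theta> l) * ?\<theta> l)) {0..1}"
    by (simp only: o_def)
  have "(\<Sum>l\<in>S. cnj (?\<theta> l) * ?\<theta> l) = complex_of_real B"
    unfolding B_def of_real_sum by (intro sum.cong refl) (simp add: complex_norm_square mult.commute flip: of_real_power)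
  then have RB: "Re (\<Sum>l\<in>S. cnj (?\<theta> l) * ?\<theta> l) = B" by simp
  \<comment> \<open>The integrand is |f - g|^2 with \<open>g\<close> the partial Fourier sum over
    \<open>S\<close>; the cross term integrates to \<open>B\<close>, like the square of the partial
    sum.\<close>
  have "((\<lambda>x. (f x)\<^sup>2 + (cmod (?g x))\<^sup>2 - 2 * Re (\<Sum>l\<in>S. cnj (?\<theta> l) * (complex_of_real (f x) * cis (- 2*pi * of_int l*x)))) has_integral
    (integral {0..1} (\<lambda>x. (f x)\<^sup>2) + B - 2 * B)) {0..1}"
    using ci unfolding RB by (intro has_integral_add has_integral_diff has_integral_mult_right fi gi)
  then have "0 \<le> integral {0..1} (\<lambda>x. (f x)\<^sup>2) + B - 2 * B"
  proof (rule has_integral_nonneg)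
    fix x :: real
    have cg: "(\<Sum>l\<in>S. cnj (?\<theta> l) * (complex_of_real (f x) * cis (- 2*pi * of_int l*x))) = complex_of_real (f x) * cnj (?g x)"
      by (simp add: sum_distrib_left cis_cnj mult_ac)
    have "0 \<le> (cmod (complex_of_real (f x) - ?g x))\<^sup>2" by simp
    also have "\<dots> = (f x)\<^sup>2 + (cmod (?g x))\<^sup>2 - 2 * Re (complex_of_real (f x) * cnj (?g x))"
      unfolding cmod_power2 by (simp add: power2_eq_square algebra_simps)
    finally show "0 \<le> (f x)\<^sup>2 + (cmod (?g x))\<^sup>2 - 2 * Re (\<Sum>l\<in>S. cnj (?\<theta> l) * (complex_of_real (f x) * cis (- 2*pi * of_int l*x)))"
      unfolding cg .
  qed
  then show ?thesis by (simp add: B_def)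
qed

section \<open>Wavelet coefficients of bounded functions\<close>

lemma abs_sin_diff_le: "\<bar>sin x - sin y\<bar> \<le> \<bar>x - y :: real\<bar>"
proof -
  have "norm (sin x - sin y) \<le> 1 * norm (x - y)"
    by (rule field_differentiable_bound[of UNIV sin cos]) (auto intro!: DERIV_sin)
  then show ?thesis by simp
qed

lemma abs_cos_diff_le: "\<bar>cos x - cos y\<bar> \<le> \<bar>x - y :: real\<bar>"
proof -
  have "norm (cos x - cos y) \<le> 1 * norm (x - y)"
    by (rule field_differentiable_bound[of UNIV cos "\<lambda>x. - sin x"]) (auto intro!: DERIV_cos)
  then show ?thesis by simp
qed

lemma cmod_cis_diff_le: "cmod (cis x - cis y) \<le> 2 * \<bar>x - y\<bar>"
  using cmod_le[of "cis x - cis y"] abs_sin_diff_le[of x y] abs_cos_diff_le[of x y] by simp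

text \<open>Makes products of Lipschitz functions bounded by 1 Lipschitz again, with constants
  adding up; used for the product formula of \<open>meyer_psi_hat\<close>.\<close>

lemma norm_mult_diff_le:
  fixes a b c d :: "'a :: real_normed_algebra"
  assumes "norm b \<le> 1" "norm c \<le> 1"
  shows "norm (a * b - c * d) \<le> norm (a - c) + norm (b - d)"
proof -
  have "a * b - c * d = (a - c) * b + c * (b - d)" by (simp add: algebra_simps)
  then have "norm (a * b - c * d) \<le> norm ((a - c) * b) + norm (c * (b - d))" by (simp add: norm_triangle_ineq)
  also have "\<dots> \<le> norm (a - c) * norm b + norm c * norm (b - d)" by (intro add_mono norm_mult_ineq)
  also have "\<dots> \<le> norm (a - c) * 1 + 1 * norm (b - d)" using assms by (intro add_mono mult_mono) auto
  finally show ?thesis by simp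
qed

lemma meyer_aux_lipschitz:
  assumes "meyer_aux vb"
  obtains K where "K \<ge> 0" "\<And>x y. \<bar>vb x - vb y\<bar> \<le> K * \<bar>x - y\<bar>"
proof -
  have vb0: "vb x = 0" if "x \<le> 0" for x using assms that by (simp add: meyer_aux_def)
  have vb1: "vb x = 1" if "1 \<le> x" for x using assms that by (simp add: meyer_aux_def)
  have diff: "((deriv ^^ k) vb) differentiable (at x)" for k x using assms by (simp add: meyer_aux_def)
  have D: "(vb has_field_derivative deriv vb x) (at x)" for x
    using diff[of 0 x] by (simp add: DERIV_deriv_iff_real_differentiable)
  have "continuous_on {0..1} (deriv vb)"
    using diff[of 1] by (auto intro!: continuous_at_imp_continuous_on differentiable_imp_continuous_within)
  then have "bounded (deriv vb ` {0..1})" by (intro compact_imp_bounded compact_continuous_image) auto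
  then obtain K where K: "\<And>x. x \<in> {0..1} \<Longrightarrow> norm (deriv vb x) \<le> K" unfolding bounded_iff by blast
  have K0: "K \<ge> 0" using K[of 0] norm_ge_zero[of "deriv vb 0"] by simp
  \<comment> \<open>\<open>vb\<close> is constant on either side of [0,1], so composing it with the
    clamp onto [0,1] changes nothing, and a derivative bound on this compact interval is
    enough.\<close>
  define cl where "cl x = max 0 (min 1 x)" for x :: real
  have cl: "vb x = vb (cl x)" for x using vb0[of x] vb1[of x] vb0[of 0] vb1[of 1] by (auto simp: cl_def max_def min_def)
  have lip: "\<bar>vb x - vb y\<bar> \<le> K * \<bar>x - y\<bar>" for x y
  proof -
    have "norm (vb (cl x) - vb (cl y)) \<le> K * norm (cl x - cl y)"
      by (rule field_differentiable_bound[of "{0..1}" vb "deriv vb"])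
        (use K in \<open>auto intro!: has_field_derivative_at_within[OF D] simp: cl_def\<close>)
    also have "\<dots> \<le> K * \<bar>x - y\<bar>" using K0 by (intro mult_left_mono) (auto simp: cl_def)
    finally show ?thesis using cl[of x] cl[of y] by simp
  qed
  from K0 lip show ?thesis by (rule that)
qed

text \<open>The factor not selected by the piecewise definition equals 1 (or kills the product outside the
  support), so a single product formula makes Lipschitz continuity immediate.\<close>

lemma meyer_psi_hat_eq:
  assumes "meyer_aux vb"
  shows "meyer_psi_hat vb \<xi> = cis (\<xi>/2) * complex_of_real
    (sin (pi/2 * vb (3*\<bar>\<xi>\<bar>/(2*pi) - 1)) * cos (pi/2 * vb (3*\<bar>\<xi>\<bar>/(4*pi) - 1)))"
proof -
  have vb0: "vb x = 0" if "x \<le> 0" for x using assms that by (simp add: meyer_aux_def)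
  have vb1: "vb x = 1" if "1 \<le> x" for x using assms that by (simp add: meyer_aux_def)
  consider "\<bar>\<xi>\<bar> < 2*pi/3" | "2*pi/3 \<le> \<bar>\<xi>\<bar>" "\<bar>\<xi>\<bar> \<le> 4*pi/3" | "4*pi/3 < \<bar>\<xi>\<bar>" "\<bar>\<xi>\<bar> \<le> 8*pi/3" | "8*pi/3 < \<bar>\<xi>\<bar>"
    by linarith
  then show ?thesis
  proof cases
    case 1
    then have "vb (3*\<bar>\<xi>\<bar>/(2*pi) - 1) = 0" by (intro vb0) (simp add: field_simps)
    then show ?thesis using 1 pi_gt_zero by (simp add: meyer_psi_hat_def)
  next
    case 2
    then have "vb (3*\<bar>\<xi>\<bar>/(4*pi) - 1) = 0" by (intro vb0) (simp add: field_simps)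
    then show ?thesis using 2 by (simp add: meyer_psi_hat_def)
  next
    case 3
    then have "vb (3*\<bar>\<xi>\<bar>/(2*pi) - 1) = 1" by (intro vb1) (simp add: field_simps)
    then show ?thesis using 3 by (simp add: meyer_psi_hat_def)
  next
    case 4
    then have "vb (3*\<bar>\<xi>\<bar>/(4*pi) - 1) = 1" by (intro vb1) (simp add: field_simps)
    then show ?thesis using 4 pi_gt_zero by (simp add: meyer_psi_hat_def)
  qed
qed

lemma meyer_psi_hat_bound: "meyer_aux vb \<Longrightarrow> cmod (meyer_psi_hat vb \<xi>) \<le> 1"
  by (simp add: meyer_psi_hat_eq norm_mult abs_mult mult_le_one)

lemma meyer_psi_hat_lipschitz:
  assumes "meyer_aux vb"
  obtains L where "L \<ge> 0" "\<And>x y. cmod (meyer_psi_hat vb x - meyer_psi_hat vb y) \<le> L * \<bar>x - y\<bar>"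
proof -
  obtain K where K: "K \<ge> 0" "\<And>x y. \<bar>vb x - vb y\<bar> \<le> K * \<bar>x - y\<bar>" using meyer_aux_lipschitz[OF assms] by blast
  have inner: "\<bar>pi/2 * vb (3*\<bar>x\<bar>/c - 1) - pi/2 * vb (3*\<bar>y\<bar>/c - 1)\<bar> \<le> (pi/2 * K * (3/c)) * \<bar>x - y\<bar>" if "c > 0" for c x y
  proof -
    have "\<bar>pi/2 * vb (3*\<bar>x\<bar>/c - 1) - pi/2 * vb (3*\<bar>y\<bar>/c - 1)\<bar> = pi/2 * \<bar>vb (3*\<bar>x\<bar>/c - 1) - vb (3*\<bar>y\<bar>/c - 1)\<bar>"
      unfolding right_diff_distrib[symmetric] abs_mult by simp
    also have "\<dots> \<le> pi/2 * (K * \<bar>(3*\<bar>x\<bar>/c - 1) - (3*\<bar>y\<bar>/c - 1)\<bar>)" by (intro mult_left_mono K) auto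
    also have "(3*\<bar>x\<bar>/c - 1) - (3*\<bar>y\<bar>/c - 1) = 3/c * (\<bar>x\<bar> - \<bar>y\<bar>)"
      using that by (simp add: field_simps)
    also have "\<bar>3/c * (\<bar>x\<bar> - \<bar>y\<bar>)\<bar> = 3/c * \<bar>\<bar>x\<bar> - \<bar>y\<bar>\<bar>"
      unfolding abs_mult using that by simp
    also have "pi/2 * (K * (3/c * \<bar>\<bar>x\<bar> - \<bar>y\<bar>\<bar>)) \<le> pi/2 * (K * (3/c * \<bar>x - y\<bar>))"
      using K that by (intro mult_left_mono) auto
    finally show ?thesis by (simp add: mult_ac)
  qed
  \<comment> \<open>One summand for each factor of the product formula: the phase, the sine and the
    cosine.\<close>
  define L where "L = 1 + pi/2 * K * (3/(2*pi)) + pi/2 * K * (3/(4*pi))"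
  have "cmod (meyer_psi_hat vb x - meyer_psi_hat vb y) \<le> L * \<bar>x - y\<bar>" for x y
  proof -
    let ?s = "\<lambda>x. sin (pi/2 * vb (3*\<bar>x\<bar>/(2*pi) - 1))" and ?c = "\<lambda>x. cos (pi/2 * vb (3*\<bar>x\<bar>/(4*pi) - 1))"
    have "cmod (meyer_psi_hat vb x - meyer_psi_hat vb y) \<le>
       cmod (cis (x/2) - cis (y/2)) + cmod (complex_of_real (?s x * ?c x) - complex_of_real (?s y * ?c y))"
      unfolding meyer_psi_hat_eq[OF assms]
      by (rule norm_mult_diff_le) (auto simp: norm_mult abs_mult mult_le_one)
    also have "cmod (complex_of_real (?s x * ?c x) - complex_of_real (?s y * ?c y)) = norm (?s x * ?c x - ?s y * ?c y)"
      by (simp only: of_real_diff[symmetric] norm_of_real real_norm_def)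
    also have "norm (?s x * ?c x - ?s y * ?c y) \<le> norm (?s x - ?s y) + norm (?c x - ?c y)"
      by (rule norm_mult_diff_le) auto
    also have "norm (?s x - ?s y) \<le> (pi/2 * K * (3/(2*pi))) * \<bar>x - y\<bar>"
      unfolding real_norm_def by (rule order_trans[OF abs_sin_diff_le inner]) auto
    also have "norm (?c x - ?c y) \<le> (pi/2 * K * (3/(4*pi))) * \<bar>x - y\<bar>"
      unfolding real_norm_def by (rule order_trans[OF abs_cos_diff_le inner]) auto
    \<comment> \<open>The factor 2 lost in \<open>cmod_cis_diff_le\<close> is recovered from the
      halved argument.\<close>
    also have "cmod (cis (x/2) - cis (y/2)) \<le> \<bar>x - y\<bar>"
      using cmod_cis_diff_le[of "x/2" "y/2"] by (simp flip: diff_divide_distrib)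
    finally show ?thesis by (simp add: L_def algebra_simps)
  qed
  moreover have "L \<ge> 0" using K by (simp add: L_def)
  ultimately show ?thesis by (intro that)
qed

lemma meyer_psi_hat_support:
  assumes "meyer_psi_hat vb \<xi> \<noteq> 0"
  shows "2*pi/3 \<le> \<bar>\<xi>\<bar>" "\<bar>\<xi>\<bar> \<le> 8*pi/3"
  using assms pi_gt_zero by (auto simp: meyer_psi_hat_def split: if_splits)

section \<open>A periodic weight and its domination by Cauchy kernels\<close>

lemma jordan_sin_sq:
  assumes "\<bar>v\<bar> \<le> 1/2"
  shows "(2 * v)\<^sup>2 \<le> (sin (pi * v))\<^sup>2"
proof -
  define w where "w = \<bar>v\<bar>"
  have w: "0 \<le> w" "w \<le> 1/2" using assms by (auto simp: w_def)
  have "convex_on {0..pi/2} (\<lambda>x. - sin x)"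
    by (rule f''_ge0_imp_convex[where f'="\<lambda>x. - cos x" and f''=sin])
      (auto intro!: derivative_eq_intros sin_ge_zero)
  \<comment> \<open>The chord of the concave sine over [0, pi/2], taken at the fraction
    \<open>2 * w\<close>.\<close>
  from convex_onD[OF this, of "2 * w" 0 "pi/2"] w have "- sin (2 * w * (pi/2)) \<le> - (2 * w)"
    by (simp add: algebra_simps)
  then have "2 * w \<le> sin (pi * w)" by (simp add: mult_ac)
  then have "(2 * w)\<^sup>2 \<le> (sin (pi * w))\<^sup>2" using w by (intro power_mono) auto
  then show ?thesis by (auto simp: w_def abs_if split: if_splits)
qed

lemma norm_one_minus_cis_sq: "(cmod (1 - cis (2 * pi * u)))\<^sup>2 = 4 * (sin (pi * u))\<^sup>2"
proof -
  have "(cmod (1 - cis (2 * pi * u)))\<^sup>2 = 1 - 2 * cos (2 * pi * u) + ((sin (2 * pi * u))\<^sup>2 + (cos (2 * pi * u))\<^sup>2)"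
    unfolding cmod_power2 by (simp add: power2_eq_square algebra_simps)
  also have "\<dots> = 2 - 2 * cos (2 * (pi * u))" by (simp add: mult.assoc)
  also have "\<dots> = 4 * (sin (pi * u))\<^sup>2" unfolding cos_double_sin by simp
  finally show ?thesis .
qed

text \<open>The weight is periodic in \<open>u\<close>, the Cauchy kernels are not. A point of
  [-1,1] lies within 1/2 of one of -1, 0, 1, and Jordan's inequality around that integer yields the
  corresponding kernel; the factor 4 is the square root of 4 * 2^2.\<close>

lemma inverse_weight_le:
  fixes B u :: real
  assumes "\<bar>u\<bar> \<le> 1"
  shows "1 / (1 + B\<^sup>2 * (cmod (1 - cis (2 * pi * u)))\<^sup>2) \<le>
    1 / (1 + (4 * B * (u - (-1)))\<^sup>2) + 1 / (1 + (4 * B * (u - 0))\<^sup>2) + 1 / (1 + (4 * B * (u - 1))\<^sup>2)"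
proof -
  have pos: "0 < 1 / (1 + x\<^sup>2)" for x :: real by (simp add: add_pos_nonneg)
  have key: "1 / (1 + B\<^sup>2 * (cmod (1 - cis (2 * pi * u)))\<^sup>2) \<le> 1 / (1 + (4 * B * v)\<^sup>2)"
    if v: "\<bar>v\<bar> \<le> 1/2" and s: "(sin (pi * u))\<^sup>2 = (sin (pi * v))\<^sup>2" for v
  proof (rule divide_left_mono)
    have "(4 * B * v)\<^sup>2 = B\<^sup>2 * (4 * (2 * v)\<^sup>2)" by (simp add: power_mult_distrib)
    also have "\<dots> \<le> B\<^sup>2 * (4 * (sin (pi * v))\<^sup>2)" by (intro mult_left_mono jordan_sin_sq v) auto
    finally show "1 + (4 * B * v)\<^sup>2 \<le> 1 + B\<^sup>2 * (cmod (1 - cis (2 * pi * u)))\<^sup>2"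
      unfolding norm_one_minus_cis_sq s by simp
  qed (auto intro!: mult_pos_pos add_pos_nonneg)
  consider "\<bar>u\<bar> \<le> 1/2" | "u > 1/2" | "u < -1/2" by linarith
  then show ?thesis
  proof cases
    case 1
    then show ?thesis using key[of "u - 0"] pos[of "4 * B * (u - (-1))"] pos[of "4 * B * (u - 1)"]
      unfolding diff_0_right by linarith
  next
    case 2
    have "(sin (pi * u))\<^sup>2 = (sin (pi * (u - 1)))\<^sup>2" by (simp add: right_diff_distrib sin_diff)
    moreover have "\<bar>u - 1\<bar> \<le> 1/2" using 2 assms by linarith
    ultimately show ?thesis using key[of "u - 1"] pos[of "4 * B * (u - (-1))"] pos[of "4 * B * (u - 0)"] by linarith
  next
    case 3
    have "(sin (pi * u))\<^sup>2 = (sin (pi * (u - (-1))))\<^sup>2" by (simp add: algebra_simps sin_add)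
    moreover have "\<bar>u - (-1)\<bar> \<le> 1/2" using 3 assms by linarith
    ultimately show ?thesis using key[of "u - (-1)"] pos[of "4 * B * (u - 1)"] pos[of "4 * B * (u - 0)"] by linarith
  qed
qed

lemma cauchy_kernel_integral:
  fixes B c :: real
  assumes "B > 0"
  obtains I where "((\<lambda>x. 1 / (1 + (B * (x - c))\<^sup>2)) has_integral I) {0..1}" "I \<le> pi / B"
proof -
  have "((\<lambda>x. 1 / (1 + (B * (x - c))\<^sup>2)) has_integral (arctan (B * (1 - c)) / B - arctan (B * (0 - c)) / B)) {0..1}"
  proof (rule fundamental_theorem_of_calculus)
    fix x :: real
    have "((\<lambda>x. arctan (B * (x - c)) / B) has_real_derivative 1 / (1 + (B * (x - c))\<^sup>2)) (at x within {0..1})"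
      using assms by (auto intro!: derivative_eq_intros simp: divide_inverse)
    then show "((\<lambda>x. arctan (B * (x - c)) / B) has_vector_derivative 1 / (1 + (B * (x - c))\<^sup>2)) (at x within {0..1})"
      by (simp add: has_real_derivative_iff_has_vector_derivative)
  qed simp
  moreover have "arctan (B * (1 - c)) / B - arctan (B * (0 - c)) / B \<le> pi / B"
    using assms arctan_ubound[of "B * (1 - c)"] arctan_lbound[of "B * (0 - c)"]
    by (simp add: divide_right_mono flip: diff_divide_distrib)
  ultimately show ?thesis by (rule that)
qed

section \<open>Wavelet and scaling coefficients\<close>

lemma continuous_meyer_psi_per: "continuous_on A (meyer_psi_per vb j k)"
  unfolding meyer_psi_per_def by (intro continuous_intros)

lemma wav_coef_integral:
  assumes "continuous_on UNIV f"
  shows "wav_coef vb f j k = integral {0..1} (\<lambda>x. f x * meyer_psi_per vb j k x)"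
proof -
  have "continuous_on {0..1} (\<lambda>x. f x * meyer_psi_per vb j k x)"
    by (intro continuous_intros continuous_meyer_psi_per continuous_on_subset[OF assms]) auto
  from set_borel_integral_eq_integral(2)[OF borel_integrable_atLeastAtMost'[OF this]]
  show ?thesis by (simp add: wav_coef_def)
qed

text \<open>The periodized wavelet is a trigonometric polynomial, so the coefficient is a finite
  combination of Fourier coefficients of \<open>f\<close>. The argument is \<open>- l\<close>
  because \<open>f\<close> is paired with the wavelet without conjugation.\<close>

lemma wav_coef_eq_0:
  assumes f: "continuous_on UNIV f"
    and supp: "\<And>l. meyer_psi_hat vb (2*pi * of_int l / 2^j) \<noteq> 0 \<Longrightarrow> fourier_coef f (- l) = 0"
  shows "wav_coef vb f j k = 0"
proof -
  let ?S = "{-(2^(j+2))..(2::int)^(j+2)}"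
  define b where "b l = complex_of_real (2 powr (- real j / 2)) * meyer_psi_hat vb (2*pi * of_int l / 2^j)" for l
  define d where "d l = b l * cis (- (2*pi * of_int l * (real k / 2^j)))" for l
  have bd: "b l * cis (2*pi * of_int l*(x - real k / 2^j)) = d l * cis (2*pi * of_int l * x)" for l x
    by (simp add: d_def mult.assoc cis_mult algebra_simps)
  have "((\<lambda>x. \<Sum>l\<in>?S. d l * (complex_of_real (f x) * cis (- 2*pi * of_int (- l)*x))) has_integral (\<Sum>l\<in>?S. d l * fourier_coef f (- l))) {0..1}"
    by (intro has_integral_sum has_integral_mult_right fourier_coef_has_integral f) auto
  moreover have "(\<Sum>l\<in>?S. d l * fourier_coef f (- l)) = 0"
  proof (rule sum.neutral, intro ballI)
    fix l
    show "d l * fourier_coef f (- l) = 0"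
      using supp[of l] by (cases "meyer_psi_hat vb (2*pi * of_int l / 2^j) = 0") (auto simp: d_def b_def)
  qed
  ultimately have "((\<lambda>x. \<Sum>l\<in>?S. d l * (complex_of_real (f x) * cis (- 2*pi * of_int (- l)*x))) has_integral 0) {0..1}" by simp
  from has_integral_linear[OF this bounded_linear_Re]
  have 0: "((\<lambda>x. Re (\<Sum>l\<in>?S. d l * (complex_of_real (f x) * cis (- 2*pi * of_int (- l)*x)))) has_integral 0) {0..1}"
    by (simp only: o_def zero_complex.sel)
  have "Re (\<Sum>l\<in>?S. d l * (complex_of_real (f x) * cis (- 2*pi * of_int (- l)*x))) = f x * meyer_psi_per vb j k x" for x
  proof -
    have "(\<Sum>l\<in>?S. d l * (complex_of_real (f x) * cis (- 2*pi * of_int (- l)*x))) =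
      complex_of_real (f x) * (\<Sum>l\<in>?S. b l * cis (2*pi * of_int l*(x - real k / 2^j)))"
      unfolding bd by (simp add: sum_distrib_left mult_ac)
    then show ?thesis unfolding meyer_psi_per_def b_def[symmetric]
      by (simp only: times_complex.sel Re_complex_of_real Im_complex_of_real mult_zero_left diff_zero)
  qed
  with 0 have "((\<lambda>x. f x * meyer_psi_per vb j k x) has_integral 0) {0..1}" by simp
  then show ?thesis by (simp add: wav_coef_integral[OF f] integral_unique)
qed

text \<open>At level 0 the periodized scaling function is the constant 1: the first nonzero
  frequency 2 pi already exceeds the support bound 4 pi/3.\<close>

lemma scal_coef_eq:
  assumes "continuous_on UNIV f"
  shows "scal_coef vb f = Re (fourier_coef f 0)"
proof -
  have "meyer_phi_per vb 0 0 x = 1" for x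
  proof -
    have "(\<Sum>l\<in>{-(2^(0+1))..(2::int)^(0+1)}.
      complex_of_real (2 powr (- real 0 / 2)) * meyer_phi_hat vb (2*pi * of_int l / 2^0) * cis (2*pi * of_int l*(x - real 0 / 2^0)))
      = (\<Sum>l\<in>{0}. complex_of_real (2 powr (- real 0 / 2)) * meyer_phi_hat vb (2*pi * of_int l / 2^0) * cis (2*pi * of_int l*(x - real 0 / 2^0)))"
    proof (rule sum.mono_neutral_right)
      show "\<forall>l\<in>{-(2^(0+1))..(2::int)^(0+1)} - {0}. complex_of_real (2 powr (- real 0 / 2)) * meyer_phi_hat vb (2*pi * of_int l / 2^0) * cis (2*pi * of_int l*(x - real 0 / 2^0)) = 0"
      proof
        fix l assume "l \<in> {-(2^(0+1))..(2::int)^(0+1)} - {0}"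
        then have "2*pi * 1 \<le> 2*pi * \<bar>real_of_int l\<bar>" by (intro mult_left_mono) auto
        then have "meyer_phi_hat vb (2*pi * of_int l / 2^0) = 0"
          using pi_gt_zero by (auto simp: meyer_phi_hat_def abs_mult)
        then show "complex_of_real (2 powr (- real 0 / 2)) * meyer_phi_hat vb (2*pi * of_int l / 2^0) * cis (2*pi * of_int l*(x - real 0 / 2^0)) = 0"
          by simp
      qed
    qed auto
    then show ?thesis unfolding meyer_phi_per_def by (simp add: meyer_phi_hat_def)
  qed
  then have "scal_coef vb f = integral {0..1} f"
    unfolding scal_coef_def
    using set_borel_integral_eq_integral(2)[OF borel_integrable_atLeastAtMost'[OF continuous_on_subset[OF assms subset_UNIV]], of 0 1] by simp
  moreover have "((\<lambda>x. Re (complex_of_real (f x) * cis (- 2*pi * of_int 0*x))) has_integral Re (fourier_coef f 0)) {0..1}"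
    using has_integral_linear[OF fourier_coef_has_integral[OF assms, of 0] bounded_linear_Re] by (simp only: o_def)
  ultimately show ?thesis by (simp add: integral_unique)
qed

text \<open>Multiplication by \<open>1 - cis (2\<pi>(x - y))\<close> takes first differences of the Fourier coefficients; this is how
  smoothness of the wavelet's Fourier transform yields localization.\<close>

lemma wavelet_weighted_sq:
  fixes b :: "int \<Rightarrow> complex" and m :: int
  assumes b: "\<And>l. \<bar>l\<bar> \<ge> m \<Longrightarrow> b l = 0" and m: "m \<ge> 1"
  shows "((\<lambda>x. (1 + B\<^sup>2 * (cmod (1 - cis (2*pi * (x - y))))\<^sup>2) * (cmod (\<Sum>l\<in>{-m..m}. b l * cis (2*pi * of_int l * (x - y))))\<^sup>2)
    has_integral ((\<Sum>l\<in>{-m..m}. (cmod (b l))\<^sup>2) + B\<^sup>2 * (\<Sum>l\<in>{-m..m}. (cmod (b l - b (l - 1)))\<^sup>2))) {0..1}"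
proof -
  have diff: "(1 - cis (2*pi * (x - y))) * (\<Sum>l\<in>{-m..m}. b l * cis (2*pi * of_int l * (x - y))) =
    (\<Sum>l\<in>{-m..m}. (b l - b (l - 1)) * cis (2*pi * of_int l * (x - y)))" for x
  proof -
    let ?c = "\<lambda>l. cis (2*pi * of_int l * (x - y))"
    have c1: "cis (2*pi * (x - y)) * ?c l = ?c (l + 1)" for l by (simp add: cis_mult algebra_simps)
    have "cis (2*pi * (x - y)) * (\<Sum>l\<in>{-m..m}. b l * ?c l) = (\<Sum>l\<in>{-m..m}. b l * ?c (l + 1))"
      unfolding sum_distrib_left c1[symmetric] by (intro sum.cong refl) (simp only: mult_ac)
    \<comment> \<open>The vanishing of \<open>b\<close> at \<open>m\<close> and at
      \<open>- m - 1\<close> keeps the shifted sum in the same range, so the summation by parts has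
      no boundary term.\<close>
    also have "\<dots> = (\<Sum>l\<in>{-m..m-1}. b l * ?c (l + 1))"
      using b m by (intro sum.mono_neutral_right) auto
    also have "\<dots> = (\<Sum>l\<in>{-m+1..m}. b (l - 1) * ?c l)"
      by (rule sum.reindex_bij_witness[of _ "\<lambda>l. l - 1" "\<lambda>l. l + 1"]) auto
    also have "\<dots> = (\<Sum>l\<in>{-m..m}. b (l - 1) * ?c l)"
      using b m by (intro sum.mono_neutral_left) auto
    finally show ?thesis by (simp add: left_diff_distrib sum_subtractf)
  qed
  have "((\<lambda>x. (cmod (\<Sum>l\<in>{-m..m}. b l * cis (2*pi * of_int l * (x - y))))\<^sup>2 +
      B\<^sup>2 * (cmod (\<Sum>l\<in>{-m..m}. (b l - b (l - 1)) * cis (2*pi * of_int l * (x - y))))\<^sup>2) has_integral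
     ((\<Sum>l\<in>{-m..m}. (cmod (b l))\<^sup>2) + B\<^sup>2 * (\<Sum>l\<in>{-m..m}. (cmod (b l - b (l - 1)))\<^sup>2))) {0..1}"
    by (intro has_integral_add has_integral_mult_right has_integral_trig_poly_sq) auto
  then show ?thesis
    unfolding diff[symmetric] norm_mult power_mult_distrib by (simp add: algebra_simps)
qed

text \<open>In substance an L1 bound on the wavelet. Unweighted Cauchy-Schwarz would lose the factor
  2^(-j/2). With a weight of size 1 + (2^j |x - y|)^2 the weighted energy of the wavelet stays
  bounded, since neighbouring coefficients differ by O(2^(-j)) relative to their size bound, while
  the inverse weight has integral O(2^(-j)).\<close>

lemma wav_coef_le:
  assumes mey: "meyer_aux vb"
  obtains C where "C > 0"
    "\<And>f a j k. continuous_on UNIV f \<Longrightarrow> (\<And>x. \<bar>f x\<bar> \<le> a) \<Longrightarrow> k < 2^j \<Longrightarrow> \<bar>wav_coef vb f j k\<bar> \<le> C * a * 2 powr (- real j / 2)"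
proof -
  obtain L where L: "L \<ge> 0" "\<And>x y. cmod (meyer_psi_hat vb x - meyer_psi_hat vb y) \<le> L * \<bar>x - y\<bar>"
    using meyer_psi_hat_lipschitz[OF mey] by blast
  \<comment> \<open>At most 9 * 2^j frequencies have coefficients of square at most 2^(-j), whence
    the first 9. The second term is the same count for the differences, with Lipschitz bound 2 pi L
    / 2^j before multiplication by the weight \<open>B\<close> = 2^j. In \<open>C\<close>, 3 pi/4
    stands for three Cauchy kernels of mass pi/(4 B).\<close>
  define W where "W = 9 + 9 * (2 * pi * L)\<^sup>2"
  define C where "C = (W + 3 * pi / 4) / 2"
  have W: "W > 0" by (simp add: W_def add_pos_nonneg)
  have "C > 0" using W pi_gt_zero by (simp add: C_def add_pos_pos)
  moreover have "\<bar>wav_coef vb f j k\<bar> \<le> C * a * 2 powr (- real j / 2)"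
    if f: "continuous_on UNIV f" and a: "\<And>x. \<bar>f x\<bar> \<le> a" and k: "k < 2^j" for f a j k
  proof -
    have a0: "a \<ge> 0" using a[of 0] by linarith
    define y where "y = real k / 2^j"
    have "real k \<le> real (2^j)" using k by linarith
    then have y: "0 \<le> y" "y \<le> 1" by (auto simp: y_def)
    define \<rho> where "\<rho> = 2 powr (- real j / 2)"
    have \<rho>: "\<rho> > 0" by (simp add: \<rho>_def)
    have \<rho>2: "\<rho>\<^sup>2 = 1 / 2^j"
      unfolding \<rho>_def power2_eq_square powr_add[symmetric]
      using powr_minus_divide[of 2 "real j"] by (simp add: powr_realpow)
    define b where "b l = complex_of_real \<rho> * meyer_psi_hat vb (2*pi * of_int l / 2^j)" for l
    define m :: int where "m = 2^(j+2)"
    have m1: "m \<ge> 1" unfolding m_def by (rule one_le_power) simp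
    have b0: "b l = 0" if "\<bar>l\<bar> \<ge> m" for l
    proof (rule ccontr)
      assume "b l \<noteq> 0"
      then have "meyer_psi_hat vb (2*pi * of_int l / 2^j) \<noteq> 0" by (auto simp: b_def)
      then have "\<bar>2*pi * of_int l / 2^j\<bar> \<le> 8*pi/3" by (rule meyer_psi_hat_support)
      then have "\<bar>of_int l\<bar> \<le> 4/3 * (2::real)^j" by (simp add: abs_mult field_simps)
      moreover have "real_of_int m \<le> \<bar>of_int l\<bar>" using that by linarith
      moreover have "real_of_int m = 4 * 2^j" by (simp add: m_def)
      moreover have "(0::real) < 2^j" by simp
      ultimately show False by linarith
    qed
    define H where "H x = (\<Sum>l\<in>{-m..m}. b l * cis (2*pi * of_int l * (x - y)))" for x
    have psi: "meyer_psi_per vb j k x = Re (H x)" for x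
      unfolding meyer_psi_per_def H_def b_def m_def \<rho>_def y_def ..
    define B :: real where "B = 2^j"
    have B: "B \<ge> 1" by (simp add: B_def)
    define w where "w x = 1 + B\<^sup>2 * (cmod (1 - cis (2*pi * (x - y))))\<^sup>2" for x
    have wpos: "w x > 0" for x by (simp add: w_def add_pos_nonneg)
    define E where "E = (\<Sum>l\<in>{-m..m}. (cmod (b l))\<^sup>2) + B\<^sup>2 * (\<Sum>l\<in>{-m..m}. (cmod (b l - b (l - 1)))\<^sup>2)"
    have HE: "((\<lambda>x. w x * (cmod (H x))\<^sup>2) has_integral E) {0..1}"
      unfolding w_def H_def E_def by (rule wavelet_weighted_sq[OF b0 m1])
    \<comment> \<open>The cardinality is 2 m + 1, that is 8 * 2^j + 1.\<close>
    have cardm: "real (card {-m..m}) \<le> 9 * B"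
      using B by (simp add: m_def B_def)
    have "E \<le> W"
    proof -
      have "(\<Sum>l\<in>{-m..m}. (cmod (b l))\<^sup>2) \<le> (\<Sum>l\<in>{-m..m}. \<rho>\<^sup>2)"
        using meyer_psi_hat_bound[OF mey] \<rho> by (intro sum_mono power_mono) (auto simp: b_def norm_mult)
      also have "\<dots> \<le> 9 * B * \<rho>\<^sup>2" using cardm by (simp add: mult_right_mono)
      also have "\<dots> = 9" by (simp add: \<rho>2 B_def)
      finally have 1: "(\<Sum>l\<in>{-m..m}. (cmod (b l))\<^sup>2) \<le> 9" .
      have bb: "cmod (b l - b (l - 1)) \<le> \<rho> * (L * (2 * pi / B))" for l
      proof -
        have "cmod (b l - b (l - 1)) = \<rho> * cmod (meyer_psi_hat vb (2*pi * of_int l / 2^j) - meyer_psi_hat vb (2*pi * of_int (l - 1) / 2^j))"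
          unfolding b_def right_diff_distrib[symmetric] norm_mult using \<rho> by simp
        also have "\<dots> \<le> \<rho> * (L * \<bar>2*pi * of_int l / 2^j - 2*pi * of_int (l - 1) / 2^j\<bar>)"
          using \<rho> by (intro mult_left_mono L) auto
        also have "\<bar>2*pi * of_int l / 2^j - 2*pi * of_int (l - 1) / 2^j\<bar> = 2 * pi / B"
          unfolding diff_divide_distrib[symmetric] B_def by (simp add: algebra_simps)
        finally show ?thesis .
      qed
      have "B\<^sup>2 * (\<Sum>l\<in>{-m..m}. (cmod (b l - b (l - 1)))\<^sup>2) \<le> B\<^sup>2 * (\<Sum>l\<in>{-m..m}. (\<rho> * (L * (2 * pi / B)))\<^sup>2)"
        by (intro mult_left_mono sum_mono power_mono bb) auto
      also have "\<dots> \<le> B\<^sup>2 * (9 * B * (\<rho> * (L * (2 * pi / B)))\<^sup>2)"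
        unfolding sum_constant using cardm by (intro mult_left_mono mult_right_mono) auto
      also have "\<dots> = 9 * (2 * pi * L)\<^sup>2"
        unfolding power_mult_distrib \<rho>2 using B by (simp add: B_def power_divide power2_eq_square field_simps)
      finally show ?thesis using 1 by (simp add: E_def W_def)
    qed
    obtain I1 where I1: "((\<lambda>x. 1 / (1 + (4 * B * (x - (y - 1)))\<^sup>2)) has_integral I1) {0..1}" "I1 \<le> pi / (4 * B)"
      using cauchy_kernel_integral[of "4 * B"] B by (metis mult_pos_pos zero_less_numeral less_le_trans zero_less_one)
    obtain I2 where I2: "((\<lambda>x. 1 / (1 + (4 * B * (x - y))\<^sup>2)) has_integral I2) {0..1}" "I2 \<le> pi / (4 * B)"
      using cauchy_kernel_integral[of "4 * B"] B by (metis mult_pos_pos zero_less_numeral less_le_trans zero_less_one)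
    obtain I3 where I3: "((\<lambda>x. 1 / (1 + (4 * B * (x - (y + 1)))\<^sup>2)) has_integral I3) {0..1}" "I3 \<le> pi / (4 * B)"
      using cauchy_kernel_integral[of "4 * B"] B by (metis mult_pos_pos zero_less_numeral less_le_trans zero_less_one)
    \<comment> \<open>Majorant of \<open>a * cmod (H x)\<close>: splitting with the parameter
      \<open>\<rho>\<close> = 2^(-j/2) makes both halves integrate to order 2^(-j/2).\<close>
    define G where "G x = a * (1/2 * (\<rho> * (w x * (cmod (H x))\<^sup>2) + 1/\<rho> * (1 / (1 + (4 * B * (x - (y - 1)))\<^sup>2)
       + 1 / (1 + (4 * B * (x - y))\<^sup>2) + 1 / (1 + (4 * B * (x - (y + 1)))\<^sup>2))))" for x
    have GI: "(G has_integral a * (1/2 * (\<rho> * E + 1/\<rho> * (I1 + I2 + I3)))) {0..1}"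
      unfolding G_def by (intro has_integral_mult_right has_integral_add HE I1 I2 I3)
    have "norm (integral {0..1} (\<lambda>x. f x * meyer_psi_per vb j k x)) \<le> integral {0..1} G"
    proof (rule integral_norm_bound_integral)
      show "(\<lambda>x. f x * meyer_psi_per vb j k x) integrable_on {0..1}"
        by (intro integrable_continuous_interval continuous_intros continuous_meyer_psi_per continuous_on_subset[OF f]) auto
      show "G integrable_on {0..1}" using GI by blast
      fix x :: real assume x: "x \<in> {0..1}"
      let ?S = "1 / (1 + (4 * B * (x - (y - 1)))\<^sup>2) + 1 / (1 + (4 * B * (x - y))\<^sup>2) + 1 / (1 + (4 * B * (x - (y + 1)))\<^sup>2)"
      have "\<bar>x - y\<bar> \<le> 1" using x y by auto
      from inverse_weight_le[OF this, of B] have wS: "1 / w x \<le> ?S"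
        unfolding w_def by (simp add: algebra_simps)
      \<comment> \<open>AM-GM in place of Cauchy-Schwarz with the weight \<open>w\<close>\<close>
      have "cmod (H x) \<le> 1/2 * (\<rho> * (w x * (cmod (H x))\<^sup>2) + 1/\<rho> * (1 / w x))"
      proof -
        define p where "p = \<rho> * w x"
        have p: "p > 0" using \<rho> wpos by (simp add: p_def)
        have "0 \<le> (p * cmod (H x) - 1)\<^sup>2 / p" using p by simp
        also have "\<dots> = p * (cmod (H x))\<^sup>2 + 1 / p - 2 * cmod (H x)"
          using p by (simp add: power2_eq_square field_simps)
        finally show ?thesis by (simp add: p_def mult.assoc)
      qed
      also have "\<dots> \<le> 1/2 * (\<rho> * (w x * (cmod (H x))\<^sup>2) + 1/\<rho> * ?S)"
        using \<rho> by (intro mult_left_mono add_left_mono wS) auto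
      finally have "a * cmod (H x) \<le> G x" unfolding G_def using a0 by (rule mult_left_mono)
      moreover have "norm (f x * meyer_psi_per vb j k x) \<le> a * cmod (H x)"
        unfolding psi real_norm_def abs_mult using a abs_Re_le_cmod a0 by (intro mult_mono) auto
      ultimately show "norm (f x * meyer_psi_per vb j k x) \<le> G x" by linarith
    qed
    also have "\<dots> = a * (1/2 * (\<rho> * E + 1/\<rho> * (I1 + I2 + I3)))" using GI by (rule integral_unique)
    also have "\<dots> \<le> a * (1/2 * (\<rho> * W + 1/\<rho> * (3 * (pi / (4 * B)))))"
      using a0 \<rho> \<open>E \<le> W\<close> I1 I2 I3 by (intro mult_left_mono add_mono) auto
    also have "1/\<rho> * (3 * (pi / (4 * B))) = \<rho> * (3 * pi / 4)"
    proof -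
      have "1 / B = \<rho> * \<rho>" using \<rho>2 by (simp add: B_def power2_eq_square)
      moreover have "1/\<rho> * (3 * (pi / (4 * B))) = 1/\<rho> * (3 * pi / 4 * (1 / B))" by simp
      ultimately have "1/\<rho> * (3 * (pi / (4 * B))) = 1/\<rho> * (3 * pi / 4 * (\<rho> * \<rho>))" by simp
      then show ?thesis using \<rho> by simp
    qed
    also have "a * (1/2 * (\<rho> * W + \<rho> * (3 * pi / 4))) = C * a * \<rho>" by (simp add: C_def field_simps)
    finally show ?thesis by (simp add: wav_coef_integral[OF f] \<rho>_def)
  qed
  ultimately show ?thesis by (rule that)
qed

section \<open>The cube of test functions\<close>

text \<open>The one-sided frequency range is harmless: only the modulus is used, and its square has
  frequencies strictly between -N and N.\<close>

definition dirichlet :: "nat \<Rightarrow> real \<Rightarrow> complex" where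
  "dirichlet N u = (\<Sum>l\<in>{0..<int N}. cis (2*pi * of_int l * u))"

definition fejer :: "nat \<Rightarrow> real \<Rightarrow> real" where
  "fejer N u = (cmod (dirichlet N u))\<^sup>2 / (real N)\<^sup>2"

text \<open>The carrier of frequency 2N moves the band |l| < N of the kernel to N < |l| < 3N. It
  equals 1 at every grid point k/N, so the peak of the kernel survives.\<close>

definition bump :: "nat \<Rightarrow> nat \<Rightarrow> real \<Rightarrow> real" where
  "bump N k x = fejer N (x - real k / real N) * cos (4*pi * real N * x)"

text \<open>A vertex of the cube is the set \<open>W\<close> of indices with sign +1: flipping a
  coordinate is then a set operation, and averaging over vertices is a sum over a power set.\<close>

definition cube_fun :: "real \<Rightarrow> nat \<Rightarrow> nat set \<Rightarrow> real \<Rightarrow> real" where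
  "cube_fun a N W x = a * (\<Sum>k<N. (if k \<in> W then 1 else -1) * bump N k x)"

lemma norm_dirichlet_le: "cmod (dirichlet N u) \<le> real N"
proof -
  have "cmod (dirichlet N u) \<le> (\<Sum>l\<in>{0..<int N}. cmod (cis (2*pi * of_int l * u)))"
    unfolding dirichlet_def by (rule norm_sum)
  then show ?thesis by simp
qed

lemma fejer_nonneg: "0 \<le> fejer N u"
  by (simp add: fejer_def)

lemma fejer_le_1: "fejer N u \<le> 1"
  using power_mono[OF norm_dirichlet_le[of N u] norm_ge_zero, of 2]
  by (cases "N = 0") (simp_all add: fejer_def)

lemma continuous_on_dirichlet: "continuous_on A (\<lambda>x. dirichlet N (x - y))"
  unfolding dirichlet_def by (intro continuous_intros)

lemma continuous_on_fejer: "continuous_on A (\<lambda>x. fejer N (x - y))"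
  unfolding fejer_def divide_inverse by (intro continuous_intros continuous_on_dirichlet)

lemma continuous_on_bump: "continuous_on A (bump N k)"
  unfolding bump_def by (intro continuous_intros continuous_on_fejer)

lemma continuous_on_cube_fun: "continuous_on A (cube_fun a N W)"
  unfolding cube_fun_def by (intro continuous_intros continuous_on_bump)

lemma has_integral_fejer:
  assumes "N > 0"
  shows "((\<lambda>x. fejer N (x - y)) has_integral 1 / real N) {0..1}"
proof -
  have "((\<lambda>x. 1 / (real N)\<^sup>2 * (cmod (\<Sum>l\<in>{0..<int N}. 1 * cis (2*pi * of_int l * (x - y))))\<^sup>2) has_integral
    1 / (real N)\<^sup>2 * (\<Sum>l\<in>{0..<int N}. (cmod (1::complex))\<^sup>2)) {0..1}"
    by (intro has_integral_mult_right has_integral_trig_poly_sq) auto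
  then show ?thesis using assms by (simp add: fejer_def dirichlet_def power2_eq_square)
qed

lemma fejer_expand:
  "complex_of_real (fejer N u) = (\<Sum>l\<in>{0..<int N}. \<Sum>m\<in>{0..<int N}. cis (2*pi * of_int (l - m) * u)) / (real N)\<^sup>2"
proof -
  have c: "cis (2*pi * of_int l * u) * cnj (cis (2*pi * of_int m * u)) = cis (2*pi * of_int (l - m) * u)" for l m
    by (simp add: cis_cnj cis_mult algebra_simps)
  have "complex_of_real ((cmod (dirichlet N u))\<^sup>2) = (\<Sum>l\<in>{0..<int N}. \<Sum>m\<in>{0..<int N}. cis (2*pi * of_int (l - m) * u))"
    unfolding complex_norm_square dirichlet_def cnj_sum sum_product c ..
  then show ?thesis by (simp add: fejer_def)
qed

text \<open>Discrete orthogonality: the terms form a geometric progression whose ratio is an N-th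
  root of unity. The bound on \<open>r\<close> excludes aliasing, that is, nonzero multiples of
  N.\<close>

lemma sum_cis_roots:
  assumes N: "N > 0" and r: "\<bar>r\<bar> < int N"
  shows "(\<Sum>k<N. cis (2*pi * of_int r * (x - real k / real N))) = (if r = 0 then of_nat N else 0)"
proof (cases "r = 0")
  case False
  define z where "z = cis (- (2*pi * of_int r / real N))"
  have "cis (2*pi * of_int r * (x - real k / real N)) = cis (2*pi * of_int r * x) * z ^ k" for k
  proof -
    have "z ^ k = cis (real k * (- (2*pi * of_int r / real N)))" unfolding z_def by (rule Complex.DeMoivre)
    then show ?thesis by (simp add: cis_mult algebra_simps)
  qed
  then have "(\<Sum>k<N. cis (2*pi * of_int r * (x - real k / real N))) = cis (2*pi * of_int r * x) * (\<Sum>k<N. z ^ k)"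
    by (simp add: sum_distrib_left)
  moreover have "(\<Sum>k<N. z ^ k) = 0"
  proof -
    have "z ^ N = cis (2*pi * of_int (- r))" unfolding z_def Complex.DeMoivre using N by (simp add: field_simps)
    then have zN: "z ^ N = 1" by (simp only: cis_multiple_2pi Ints_of_int)
    have "z \<noteq> 1"
    proof
      assume "z = 1"
      then have "cos (2*pi * of_int r / real N) = 1" by (simp add: z_def complex_eq_iff)
      then obtain n :: int where n: "2*pi * of_int r / real N = of_int n * (2 * pi)"
        by (subst (asm) cos_one_2pi_int) (auto simp: mult_ac)
      then have "real_of_int r = of_int n * real N" using N by (simp add: field_simps)
      then have "real_of_int r = real_of_int (n * int N)" by simp
      then have rn: "r = n * int N" by (rule of_int_eq_iff[THEN iffD1])
      then have "n \<noteq> 0" using False by auto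
      then have "1 * int N \<le> \<bar>n\<bar> * int N" by (intro mult_right_mono) auto
      then show False using rn r by (simp add: abs_mult)
    qed
    then show ?thesis using zN by (simp add: geometric_sum)
  qed
  ultimately show ?thesis using False by simp
qed simp

text \<open>Summing over the N translates kills every frequency of the kernel except 0, and the N
  diagonal pairs with N translates each cancel the normalization N^2. This partition of unity bounds
  a cube function uniformly in its signs.\<close>

lemma sum_fejer:
  assumes N: "N > 0"
  shows "(\<Sum>k<N. fejer N (x - real k / real N)) = 1"
proof -
  have "complex_of_real (\<Sum>k<N. fejer N (x - real k / real N)) =
    (\<Sum>l\<in>{0..<int N}. \<Sum>m\<in>{0..<int N}. \<Sum>k<N. cis (2*pi * of_int (l - m) * (x - real k / real N))) / (real N)\<^sup>2"
    unfolding of_real_sum fejer_expand sum_divide_distrib[symmetric]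
    by (subst sum.swap, intro arg_cong2[where f="(/)"] sum.cong refl, rule sum.swap)
  also have "\<dots> = (\<Sum>l\<in>{0..<int N}. \<Sum>m\<in>{0..<int N}. (if m = l then of_nat N else 0 :: complex)) / complex_of_real ((real N)\<^sup>2)"
    using N by (intro arg_cong2[where f="(/)"] sum.cong refl, subst sum_cis_roots) auto
  also have "\<dots> = 1" using N by (simp add: power2_eq_square)
  finally show ?thesis by (simp only: of_real_eq_1_iff)
qed

lemma abs_bump_le: "\<bar>bump N k x\<bar> \<le> fejer N (x - real k / real N)"
  unfolding bump_def abs_mult using fejer_nonneg[of N] by (simp add: mult_left_le)

lemma abs_cube_fun_le:
  assumes "N > 0" "a \<ge> 0"
  shows "\<bar>cube_fun a N W x\<bar> \<le> a"
proof -
  have "\<bar>\<Sum>k<N. (if k \<in> W then 1 else -1) * bump N k x\<bar> \<le> (\<Sum>k<N. \<bar>(if k \<in> W then 1 else -1) * bump N k x\<bar>)" by (rule sum_abs)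
  also have "\<dots> \<le> (\<Sum>k<N. fejer N (x - real k / real N))"
    by (intro sum_mono) (auto simp: abs_mult intro: abs_bump_le)
  finally show ?thesis unfolding cube_fun_def abs_mult using assms
    by (simp add: sum_fejer mult_left_le)
qed

text \<open>The kernel takes values in [0,1], so the square of a bump is at most the kernel itself,
  whose mass is 1/N.\<close>

lemma bump_sq_integral_le:
  assumes "N > 0"
  shows "integral {0..1} (\<lambda>x. (bump N k x)\<^sup>2) \<le> 1 / real N"
proof -
  have "integral {0..1} (\<lambda>x. (bump N k x)\<^sup>2) \<le> integral {0..1} (\<lambda>x. fejer N (x - real k / real N))"
  proof (rule integral_le)
    show "(\<lambda>x. (bump N k x)\<^sup>2) integrable_on {0..1}"
      by (intro integrable_continuous_interval continuous_intros continuous_on_bump)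
    show "(\<lambda>x. fejer N (x - real k / real N)) integrable_on {0..1}"
      by (intro integrable_continuous_interval continuous_on_fejer)
    fix x :: real
    have "(bump N k x)\<^sup>2 = \<bar>bump N k x\<bar> * \<bar>bump N k x\<bar>" by (simp add: power2_eq_square)
    also have "\<dots> \<le> fejer N (x - real k / real N) * 1"
      using abs_bump_le[of N k x] fejer_le_1[of N "x - real k / real N"] fejer_nonneg[of N "x - real k / real N"]
      by (intro mult_mono) linarith+
    finally show "(bump N k x)\<^sup>2 \<le> fejer N (x - real k / real N)" by simp
  qed
  also have "\<dots> = 1 / real N" by (rule integral_unique[OF has_integral_fejer[OF assms]])
  finally show ?thesis .
qed

text \<open>The cell width 1/(16 N) keeps the phase of the carrier below pi/4 and all phases in the
  Dirichlet sum below pi/8. Hence no cancellation occurs, and both the kernel and the carrier are at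
  least 1/2.\<close>

lemma bump_lower_bound:
  assumes N: "N > 0" and x: "real k / real N \<le> x" "x \<le> real k / real N + 1 / (16 * real N)"
  shows "1/4 \<le> bump N k x"
proof -
  define u where "u = x - real k / real N"
  have u: "0 \<le> u" "u \<le> 1 / (16 * real N)" using x by (auto simp: u_def)
  have Nu: "real N * u \<le> 1/16" using u N by (simp add: field_simps)
  have c4: "sqrt 2 / 2 \<le> cos t" if "0 \<le> t" "t \<le> pi/4" for t
    using cos_monotone_0_pi_le[of t "pi/4"] that cos_45 by simp
  have "real N * (sqrt 2 / 2) = (\<Sum>l\<in>{0..<int N}. sqrt 2 / 2)" by simp
  also have "\<dots> \<le> (\<Sum>l\<in>{0..<int N}. cos (2*pi * of_int l * u))"
  proof (intro sum_mono c4)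
    fix l assume l: "l \<in> {0..<int N}"
    then have "0 \<le> real_of_int l" "real_of_int l \<le> real N" by auto
    then have "real_of_int l * u \<le> real N * u" "0 \<le> real_of_int l * u" using u by (auto intro: mult_right_mono)
    then have "2 * pi * (real_of_int l * u) \<le> 2 * pi * (1/16)" "0 \<le> 2 * pi * (real_of_int l * u)"
      using Nu by (auto intro!: mult_left_mono)
    then show "0 \<le> 2*pi * of_int l * u" "2*pi * of_int l * u \<le> pi/4" using pi_gt_zero by (simp_all add: mult.assoc)
  qed
  also have "\<dots> = Re (dirichlet N u)" by (simp add: dirichlet_def)
  also have "\<dots> \<le> cmod (dirichlet N u)" by (rule complex_Re_le_cmod)
  finally have "(real N * (sqrt 2 / 2))\<^sup>2 \<le> (cmod (dirichlet N u))\<^sup>2" by (intro power_mono) auto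
  then have F: "1/2 \<le> fejer N u" using N by (simp add: fejer_def power_mult_distrib power_divide field_simps)
  \<comment> \<open>Moving the origin to k/N changes the phase by 4 pi k, a multiple of the
    period.\<close>
  have "cos (4*pi * real N * x) = cos (4*pi * real N * u + 2 * pi * of_int (2 * int k))"
    unfolding u_def using N by (intro arg_cong[where f=cos]) (simp add: field_simps)
  also have "\<dots> = cos (4*pi * real N * u)"
    by (simp only: cos_add cos_int_2pin sin_int_2pin mult_1_right mult_zero_right diff_zero)
  also have "\<dots> \<ge> sqrt 2 / 2"
  proof (rule c4)
    have "4 * pi * (real N * u) \<le> 4 * pi * (1/16)" using Nu by (intro mult_left_mono) auto
    then show "4*pi * real N * u \<le> pi/4" by (simp add: mult.assoc)
  qed (use u in auto)
  finally have "sqrt 2 / 2 \<le> cos (4*pi * real N * x)" .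
  moreover have "1 \<le> sqrt 2" by simp
  ultimately have "1/2 \<le> cos (4*pi * real N * x)" by linarith
  with F have "1/2 * (1/2) \<le> fejer N u * cos (4*pi * real N * x)" by (intro mult_mono) auto
  then show ?thesis by (simp add: bump_def u_def)
qed

lemma bump_periodic: "bump N k (x + 1) = bump N k x"
proof -
  have "dirichlet N (x + 1 - y) = dirichlet N (x - y)" for y
    unfolding dirichlet_def
  proof (intro sum.cong refl)
    fix l
    have "cis (2*pi * of_int l * (x + 1 - y)) = cis (2*pi * of_int l * (x - y)) * cis (2 * pi * of_int l)"
      unfolding cis_mult by (simp add: algebra_simps)
    then show "cis (2*pi * of_int l * (x + 1 - y)) = cis (2*pi * of_int l * (x - y))"
      by (simp only: cis_multiple_2pi Ints_of_int mult_1_right)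
  qed
  moreover have "cos (4*pi * real N * (x + 1)) = cos (4*pi * real N * x + 2 * pi * of_int (2 * int N))"
    by (intro arg_cong[where f=cos]) (simp add: algebra_simps)
  then have "cos (4*pi * real N * (x + 1)) = cos (4*pi * real N * x)"
    by (simp only: cos_add cos_int_2pin sin_int_2pin mult_1_right mult_zero_right diff_zero)
  ultimately show ?thesis by (simp add: bump_def fejer_def)
qed

lemma cube_fun_periodic: "cube_fun a N W (x + 1) = cube_fun a N W x"
  by (simp add: cube_fun_def bump_periodic)

section \<open>Frequency band of the cube functions\<close>

lemma fourier_coef_bump_eq_0:
  assumes q: "\<bar>q\<bar> \<le> int N \<or> 3 * int N \<le> \<bar>q\<bar>"
  shows "fourier_coef (bump N k) q = 0"
proof -
  define y where "y = real k / real N"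
  let ?I = "{0..<int N}"
  let ?e = "\<lambda>r x. cis (2*pi * of_int r * x)"
  \<comment> \<open>Expanding the kernel and the cosine leaves frequencies l - m + 2N and l - m - 2N
    with |l - m| at most N - 1, so the endpoints N and 3N are excluded too.\<close>
  have "((\<lambda>x. \<Sum>l\<in>?I. \<Sum>m\<in>?I. ?e (m - l) y / (real N)\<^sup>2 / 2 * (?e (l - m + 2 * int N - q) x + ?e (l - m - 2 * int N - q) x)) has_integral
    (\<Sum>l\<in>?I. \<Sum>m\<in>?I. ?e (m - l) y / (real N)\<^sup>2 / 2 * ((if l - m + 2 * int N - q = 0 then 1 else 0) + (if l - m - 2 * int N - q = 0 then 1 else 0)))) {0..1}"
    by (intro has_integral_sum has_integral_mult_right has_integral_add has_integral_cis) auto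
  also have "(\<Sum>l\<in>?I. \<Sum>m\<in>?I. ?e (m - l) y / (real N)\<^sup>2 / 2 * ((if l - m + 2 * int N - q = 0 then 1 else 0) + (if l - m - 2 * int N - q = 0 then 1 else 0))) = 0"
    using q by (intro sum.neutral ballI) auto
  finally have 0: "((\<lambda>x. \<Sum>l\<in>?I. \<Sum>m\<in>?I. ?e (m - l) y / (real N)\<^sup>2 / 2 * (?e (l - m + 2 * int N - q) x + ?e (l - m - 2 * int N - q) x)) has_integral 0) {0..1}" .
  have "(\<Sum>l\<in>?I. \<Sum>m\<in>?I. ?e (m - l) y / (real N)\<^sup>2 / 2 * (?e (l - m + 2 * int N - q) x + ?e (l - m - 2 * int N - q) x))
     = complex_of_real (bump N k x) * cis (- 2*pi * of_int q*x)" for x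
  proof -
    have c: "complex_of_real (cos (4*pi * real N * x)) = (cis (4*pi * real N * x) + cis (- (4*pi * real N * x))) / 2"
      by (simp add: complex_eq_iff)
    have t: "?e (m - l) y / (real N)\<^sup>2 / 2 * (?e (l - m + 2 * int N - q) x + ?e (l - m - 2 * int N - q) x) =
      ?e (l - m) (x - y) * ((cis (4*pi * real N * x) + cis (- (4*pi * real N * x))) / 2 * cis (- 2*pi * of_int q*x) / (real N)\<^sup>2)" for l m
    proof -
      have 1: "?e (m - l) y * ?e (l - m + 2 * int N - q) x = ?e (l - m) (x - y) * (cis (4*pi * real N * x) * cis (- 2*pi * of_int q*x))"
        unfolding cis_mult by (intro arg_cong[where f=cis]) (simp add: algebra_simps)
      have 2: "?e (m - l) y * ?e (l - m - 2 * int N - q) x = ?e (l - m) (x - y) * (cis (- (4*pi * real N * x)) * cis (- 2*pi * of_int q*x))"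
        unfolding cis_mult by (intro arg_cong[where f=cis]) (simp add: algebra_simps)
      have "?e (m - l) y / (real N)\<^sup>2 / 2 * (?e (l - m + 2 * int N - q) x + ?e (l - m - 2 * int N - q) x) =
        (?e (m - l) y * ?e (l - m + 2 * int N - q) x + ?e (m - l) y * ?e (l - m - 2 * int N - q) x) / 2 / (real N)\<^sup>2"
        by (simp add: field_simps)
      also have "\<dots> = ?e (l - m) (x - y) * ((cis (4*pi * real N * x) + cis (- (4*pi * real N * x))) / 2 * cis (- 2*pi * of_int q*x) / (real N)\<^sup>2)"
        unfolding 1 2 by (simp only: ring_distribs times_divide_eq_right times_divide_eq_left add_divide_distrib mult_ac)
      finally show ?thesis .
    qed
    show ?thesis
      unfolding t sum_distrib_right[symmetric] bump_def of_real_mult fejer_expand c y_def[symmetric]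
      by (simp only: times_divide_eq_right times_divide_eq_left divide_divide_eq_left mult_ac)
  qed
  with 0 have "((\<lambda>x. complex_of_real (bump N k x) * cis (- 2*pi * of_int q*x)) has_integral 0) {0..1}" by simp
  then show ?thesis
    by (rule has_integral_unique[OF fourier_coef_has_integral[OF continuous_on_bump]])
qed

lemma fourier_coef_cube_fun:
  "fourier_coef (cube_fun a N W) q = (\<Sum>k<N. complex_of_real (a * (if k \<in> W then 1 else -1)) * fourier_coef (bump N k) q)"
proof -
  have "((\<lambda>x. \<Sum>k<N. complex_of_real (a * (if k \<in> W then 1 else -1)) * (complex_of_real (bump N k x) * cis (- 2*pi * of_int q*x))) has_integral
    (\<Sum>k<N. complex_of_real (a * (if k \<in> W then 1 else -1)) * fourier_coef (bump N k) q)) {0..1}"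
    by (intro has_integral_sum has_integral_mult_right fourier_coef_has_integral continuous_on_bump) auto
  moreover have "(\<Sum>k<N. complex_of_real (a * (if k \<in> W then 1 else -1)) * (complex_of_real (bump N k x) * cis (- 2*pi * of_int q*x)))
    = complex_of_real (cube_fun a N W x) * cis (- 2*pi * of_int q*x)" for x
    unfolding cube_fun_def of_real_mult of_real_sum sum_distrib_left sum_distrib_right
    by (intro sum.cong refl) (simp only: mult.assoc)
  ultimately show ?thesis
    using fourier_coef_has_integral[OF continuous_on_cube_fun, of a N W q] by (simp add: has_integral_unique)
qed

lemma fourier_coef_cube_fun_eq_0:
  "\<bar>q\<bar> \<le> int N \<or> 3 * int N \<le> \<bar>q\<bar> \<Longrightarrow> fourier_coef (cube_fun a N W) q = 0"
  by (simp add: fourier_coef_cube_fun fourier_coef_bump_eq_0)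

section \<open>Besov norms of the cube functions\<close>

lemma seq_pnorm_nonneg: "N > 0 \<Longrightarrow> 0 \<le> seq_pnorm p b N"
  by (auto simp: seq_pnorm_def intro!: Max_ge_iff[THEN iffD2])

text \<open>With 2^j coefficients the loss is 2^(j/p), exactly what the term
  \<open>- inv_ex p\<close> in \<open>besov_level\<close> takes back; this is why no integrability
  index matters for functions spread over all positions.\<close>

lemma seq_pnorm_le:
  assumes p: "1 \<le> p" and N: "N > 0" and b: "\<And>k. k < N \<Longrightarrow> \<bar>b k\<bar> \<le> \<beta>"
  shows "seq_pnorm p b N \<le> real N powr inv_ex p * \<beta>"
proof -
  have \<beta>: "0 \<le> \<beta>" using b[OF N] by linarith
  show ?thesis
  proof (cases p)
    case PInf
    then show ?thesis using N b by (auto simp: seq_pnorm_def inv_ex_def intro!: Max.boundedI)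
  next
    case (real r)
    then have r: "r \<ge> 1" using p by (simp add: one_ereal_def)
    have "(\<Sum>k<N. \<bar>b k\<bar> powr r) \<le> (\<Sum>k<N. \<beta> powr r)"
      using b r by (intro sum_mono powr_mono2) auto
    then have "(\<Sum>k<N. \<bar>b k\<bar> powr r) powr (1 / r) \<le> (real N * \<beta> powr r) powr (1 / r)"
      using r by (intro powr_mono2) (auto intro!: sum_nonneg)
    also have "\<dots> = real N powr (1 / r) * \<beta>"
      using r \<beta> by (simp add: powr_mult powr_powr)
    finally show ?thesis using real by (simp add: seq_pnorm_def inv_ex_def)
  qed (use p in auto)
qed

lemma cube_fun_in_besov_ball:
  assumes mey: "meyer_aux vb" and p: "1 \<le> p" and q: "1 \<le> q" and A: "A > 0" and s: "s > 0"
  obtains c0 where "c0 > 0" "\<And>c J W. 0 < c \<Longrightarrow> c \<le> c0 \<Longrightarrow>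
    cube_fun (c * 2 powr (- (real J * s))) (2^J) W \<in> besov_ball vb s p q A"
proof -
  obtain C where C: "C > 0"
    "\<And>f a j k. continuous_on UNIV f \<Longrightarrow> (\<And>x. \<bar>f x\<bar> \<le> a) \<Longrightarrow> k < 2^j \<Longrightarrow> \<bar>wav_coef vb f j k\<bar> \<le> C * a * 2 powr (- real j / 2)"
    using wav_coef_le[OF mey] by blast
  \<comment> \<open>The factor \<open>2 powr (3 * s)\<close> pays for the highest active level J +
    3.\<close>
  define K where "K = C * 2 powr (3 * s)"
  have K: "K > 0" using C by (simp add: K_def)
  \<comment> \<open>Four levels are active, each at most \<open>K * c\<close>. For every q their l^q
    norm is at most 4 powr (1/q) times that, hence at most \<open>4 * (K * c)\<close>.\<close>
  have "A / (4 * K) > 0" using A K by simp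
  moreover have "cube_fun (c * 2 powr (- (real J * s))) (2^J) W \<in> besov_ball vb s p q A"
    if c: "0 < c" "c \<le> A / (4 * K)" for c J W
  proof -
    define a where "a = c * 2 powr (- (real J * s))"
    define f where "f = cube_fun a (2^J) W"
    have a: "a \<ge> 0" using c by (simp add: a_def)
    have cont: "continuous_on B f" for B unfolding f_def by (rule continuous_on_cube_fun)
    have fb: "\<bar>f x\<bar> \<le> a" for x unfolding f_def by (rule abs_cube_fun_le) (use a in auto)
    let ?L = "besov_level vb s p f"
    have L0: "0 \<le> ?L j" for j by (simp add: besov_level_def seq_pnorm_nonneg)
    have zero: "?L j = 0" if j: "j \<notin> {J..J+3}" for j
    proof -
      have "wav_coef vb f j k = 0" for k
      proof (rule wav_coef_eq_0[OF cont])
        fix l :: int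
        assume nz: "meyer_psi_hat vb (2*pi * of_int l / 2^j) \<noteq> 0"
        \<comment> \<open>Level j sees 2^j/3 <= |l| <= 4/3 * 2^j. Below J the upper end is at most
          2/3 * 2^J, and above J + 3 the lower end is at least 16/3 * 2^J; both miss the band from
          2^J to 3 * 2^J.\<close>
        have l1: "2^j \<le> 3 * real_of_int \<bar>l\<bar>" "3 * real_of_int \<bar>l\<bar> \<le> 4 * 2^j"
          using meyer_psi_hat_support[OF nz] by (simp_all add: abs_mult field_simps)
        have "\<bar>- l\<bar> \<le> int (2^J) \<or> 3 * int (2^J) \<le> \<bar>- l\<bar>"
        proof (rule ccontr)
          assume "\<not> ?thesis"
          then have "int (2^J) < \<bar>l\<bar>" "\<bar>l\<bar> < 3 * int (2^J)" by auto
          then have "real_of_int (int (2^J)) < real_of_int \<bar>l\<bar>" "real_of_int \<bar>l\<bar> < real_of_int (3 * int (2^J))"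
            by (simp_all only: of_int_less_iff)
          then have l2: "2^J < real_of_int \<bar>l\<bar>" "real_of_int \<bar>l\<bar> < 3 * 2^J" by simp_all
          have pos: "(0::real) < 2^J" by simp
          show False
          proof (cases "j < J")
            case True
            then have "(2::real)^(Suc j) \<le> 2^J" by (intro power_increasing) auto
            then have "2 * (2::real)^j \<le> 2^J" by simp
            then show False using l1 l2 pos by linarith
          next
            case False
            then have "(2::real)^(J + 4) \<le> 2^j" using j by (intro power_increasing) auto
            then have "16 * (2::real)^J \<le> 2^j" by (simp add: power_add)
            then show False using l1 l2 pos by linarith
          qed
        qed
        then show "fourier_coef f (- l) = 0" unfolding f_def by (rule fourier_coef_cube_fun_eq_0)
      qed
      then have "seq_pnorm p (wav_coef vb f j) (2^j) \<le> real (2^j) powr inv_ex p * 0"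
        by (intro seq_pnorm_le p) auto
      then have "seq_pnorm p (wav_coef vb f j) (2^j) = 0"
        using seq_pnorm_nonneg[of "2^j" p "wav_coef vb f j"] by simp
      then show ?thesis by (simp add: besov_level_def)
    qed
    have le: "?L j \<le> K * c" for j
    proof (cases "j \<in> {J..J+3}")
      case True
      have "seq_pnorm p (wav_coef vb f j) (2^j) \<le> real (2^j) powr inv_ex p * (C * a * 2 powr (- real j / 2))"
        by (intro seq_pnorm_le p C(2) cont fb) auto
      also have "real (2^j) powr inv_ex p = 2 powr (real j * inv_ex p)"
        by (simp add: powr_powr flip: powr_realpow)
      finally have "?L j \<le> 2 powr (real j * (s + 1/2 - inv_ex p)) * (2 powr (real j * inv_ex p) * (C * a * 2 powr (- real j / 2)))"
        unfolding besov_level_def by (intro mult_left_mono) auto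
      also have "\<dots> = C * c * (2 powr (real j * (s + 1/2 - inv_ex p)) * 2 powr (real j * inv_ex p) * 2 powr (- real j / 2) * 2 powr (- (real J * s)))"
        unfolding a_def by (simp only: mult_ac)
      also have "\<dots> = C * c * 2 powr ((real j - real J) * s)"
        unfolding powr_add[symmetric] by (simp add: algebra_simps)
      also have "\<dots> \<le> C * c * 2 powr (3 * s)"
        using True C c s by (intro mult_left_mono powr_mono mult_right_mono) auto
      finally show ?thesis by (simp add: K_def mult_ac)
    next
      case False
      then show ?thesis using zero K c by simp
    qed
    have Kc: "4 * (K * c) \<le> A" using c K by (simp add: field_simps)
    have Kc0: "0 \<le> K * c" using K c by simp
    have scal: "scal_coef vb f = 0"
      unfolding scal_coef_eq[OF cont] unfolding f_def by (subst fourier_coef_cube_fun_eq_0) auto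
    have "f \<in> besov_ball vb s p q A"
      unfolding besov_ball_def
    proof (intro CollectI conjI)
      show "f \<in> borel_measurable lborel" using borel_measurable_continuous_onI[OF cont] by simp
      show "\<forall>x. f (x + 1) = f x" by (simp add: f_def cube_fun_periodic)
      show "set_integrable lborel {0..1} (\<lambda>x. (f x)^2)"
        by (intro borel_integrable_atLeastAtMost' continuous_intros cont)
      show "if q = \<infinity> then bdd_above (range ?L) \<and> \<bar>scal_coef vb f\<bar> + (SUP j. ?L j) \<le> A
         else summable (\<lambda>j. ?L j powr real_of_ereal q) \<and>
         \<bar>scal_coef vb f\<bar> + (\<Sum>j. ?L j powr real_of_ereal q) powr (1 / real_of_ereal q) \<le> A"
      proof (cases "q = \<infinity>")
        case True
        have "(SUP j. ?L j) \<le> K * c" by (intro cSUP_least le) auto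
        then show ?thesis using True Kc Kc0 scal by (auto intro!: bdd_aboveI2[where M="K * c"] le)
      next
        case False
        then obtain r where r: "q = ereal r" "r \<ge> 1" using q by (cases q) (auto simp: one_ereal_def)
        have out: "?L j powr r = 0" if "j \<notin> {J..J+3}" for j using zero[OF that] by simp
        have "(\<Sum>j. ?L j powr r) = (\<Sum>j\<in>{J..J+3}. ?L j powr r)" by (rule suminf_finite) (use out in auto)
        also have "\<dots> \<le> (\<Sum>j\<in>{J..J+3}. (K * c) powr r)" using r by (intro sum_mono powr_mono2 L0 le) auto
        also have "\<dots> = 4 * (K * c) powr r" by simp
        finally have "(\<Sum>j. ?L j powr r) powr (1 / r) \<le> (4 * (K * c) powr r) powr (1 / r)"
          using r by (intro powr_mono2 suminf_nonneg summable_finite[of "{J..J+3}"]) (use out in auto)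
        also have "\<dots> = 4 powr (1 / r) * (K * c)" using r K c by (simp add: powr_mult powr_powr)
        also have "\<dots> \<le> 4 powr 1 * (K * c)" using r Kc0 by (intro mult_right_mono powr_mono) (auto simp: field_simps)
        also have "\<dots> \<le> A" using Kc by simp
        finally have "(\<Sum>j. ?L j powr r) powr (1 / r) \<le> A" .
        moreover have "summable (\<lambda>j. ?L j powr r)" by (rule summable_finite[of "{J..J+3}"]) (use out in auto)
        ultimately show ?thesis using r scal by simp
      qed
    qed
    then show ?thesis by (simp add: f_def a_def)
  qed
  ultimately show ?thesis by (rule that)
qed

section \<open>Two-point bound for product measures\<close>

text \<open>Rectangles determine a finite product measure, and on a rectangle the integral of the
  product density factorizes.\<close>

lemma PiM_density_prod:
  assumes I: "finite I" and P: "prob_space P" and Q: "prob_space (density P r)"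
    and r: "r \<in> borel_measurable P"
  shows "PiM I (\<lambda>_. density P r) = density (PiM I (\<lambda>_. P)) (\<lambda>y. \<Prod>i\<in>I. r (y i))"
proof -
  interpret P: product_prob_space "\<lambda>_. P" I by (intro product_prob_spaceI P)
  interpret Q: product_prob_space "\<lambda>_. density P r" I by (intro product_prob_spaceI Q)
  have rm: "(\<lambda>y. \<Prod>i\<in>I. r (y i)) \<in> borel_measurable (PiM I (\<lambda>_. P))"
    using r by (auto intro!: borel_measurable_prod_ennreal measurable_compose[OF measurable_component_singleton])
  show ?thesis
  proof (rule Q.PiM_eqI[OF I, symmetric])
    show "sets (density (PiM I (\<lambda>_. P)) (\<lambda>y. \<Prod>i\<in>I. r (y i))) = sets (PiM I (\<lambda>_. density P r))"
      by (simp, intro sets_PiM_cong) auto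
    fix A assume "\<And>i. i \<in> I \<Longrightarrow> A i \<in> sets (density P r)"
    then have A: "\<And>i. i \<in> I \<Longrightarrow> A i \<in> sets P" by simp
    have "emeasure (density (PiM I (\<lambda>_. P)) (\<lambda>y. \<Prod>i\<in>I. r (y i))) (Pi\<^sub>E I A) =
      (\<integral>\<^sup>+ y. (\<Prod>i\<in>I. r (y i)) * indicator (Pi\<^sub>E I A) y \<partial>PiM I (\<lambda>_. P))"
      using rm A I by (intro emeasure_density) (auto intro!: sets_PiM_I_finite)
    also have "\<dots> = (\<integral>\<^sup>+ y. (\<Prod>i\<in>I. r (y i) * indicator (A i) (y i)) \<partial>PiM I (\<lambda>_. P))"
    proof (rule nn_integral_cong)
      fix y assume y: "y \<in> space (PiM I (\<lambda>_. P))"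
      show "(\<Prod>i\<in>I. r (y i)) * indicator (Pi\<^sub>E I A) y = (\<Prod>i\<in>I. r (y i) * indicator (A i) (y i))"
      proof (cases "y \<in> Pi\<^sub>E I A")
        case True
        then show ?thesis by (auto intro!: prod.cong simp: PiE_iff)
      next
        case False
        with y obtain i where "i \<in> I" "y i \<notin> A i" by (auto simp: space_PiM PiE_iff)
        then have "(\<Prod>i\<in>I. r (y i) * indicator (A i) (y i)) = 0"
          using I by (intro prod_zero bexI[of _ i]) auto
        then show ?thesis using False by simp
      qed
    qed
    also have "\<dots> = (\<Prod>i\<in>I. \<integral>\<^sup>+ x. r x * indicator (A i) x \<partial>P)"
      using A r by (intro P.product_nn_integral_prod I) auto
    also have "\<dots> = (\<Prod>i\<in>I. emeasure (density P r) (A i))"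
      using A r by (intro prod.cong refl) (simp add: emeasure_density)
    finally show "emeasure (density (PiM I (\<lambda>_. P)) (\<lambda>y. \<Prod>i\<in>I. r (y i))) (Pi\<^sub>E I A) =
       (\<Prod>i\<in>I. emeasure (density P r) (A i))" .
  qed
qed

text \<open>Le Cam's two-point method: \<open>A\<close> and \<open>B\<close> are losses under the
  two hypotheses that cannot both be small. The second moment of the likelihood ratio is
  multiplicative over the sample, so it is at most exp (1/2), hence at most 2, and the two product
  laws share at least half of their mass.\<close>

lemma two_point_lower_bound:
  fixes r :: "'a \<Rightarrow> real" and x :: real
  assumes P: "prob_space P" and Q: "prob_space (density P r)"
    and r: "r \<in> borel_measurable P" and r0: "\<And>y. 0 \<le> r y"
    and x: "0 \<le> x" "real n * x \<le> 1/2" and chi: "(\<integral>\<^sup>+ y. ennreal ((r y)\<^sup>2) \<partial>P) \<le> ennreal (1 + x)"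
    and A: "A \<in> borel_measurable (PiM {..<n} (\<lambda>_. P))" and B: "B \<in> borel_measurable (PiM {..<n} (\<lambda>_. P))"
    and d: "0 \<le> d" "\<And>y. y \<in> space (PiM {..<n} (\<lambda>_. P)) \<Longrightarrow> ennreal d \<le> A y + B y"
  shows "ennreal (d / 2) \<le> (\<integral>\<^sup>+ y. A y \<partial>PiM {..<n} (\<lambda>_. P)) + (\<integral>\<^sup>+ y. B y \<partial>PiM {..<n} (\<lambda>_. density P r))"
proof -
  interpret P: product_prob_space "\<lambda>_. P" "{..<n}" by (intro product_prob_spaceI P)
  let ?P = "PiM {..<n} (\<lambda>_. P)"
  define R where "R y = (\<Prod>i<n. r (y i))" for y
  have R0: "0 \<le> R y" for y unfolding R_def by (intro prod_nonneg) (auto simp: r0)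
  have Rm [measurable]: "R \<in> borel_measurable ?P"
    unfolding R_def using r by (auto intro!: borel_measurable_prod measurable_compose[OF measurable_component_singleton])
  have Re: "ennreal (R y) = (\<Prod>i<n. ennreal (r (y i)))" for y
    unfolding R_def by (simp add: prod_ennreal r0)
  note [measurable] = A B
  have dens: "PiM {..<n} (\<lambda>_. density P r) = density ?P (\<lambda>y. ennreal (R y))"
    unfolding Re using r by (intro PiM_density_prod P Q) auto
  have "(\<integral>\<^sup>+ y. 1 \<partial>density P r) = 1"
    using prob_space.emeasure_space_1[OF Q] by simp
  then have r1: "(\<integral>\<^sup>+ y. ennreal (r y) \<partial>P) = 1"
    using r by (subst (asm) nn_integral_density) auto
  have R1: "(\<integral>\<^sup>+ y. ennreal (R y) \<partial>?P) = 1"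
    unfolding Re using r by (subst P.product_nn_integral_prod) (auto simp: r1)
  have "(\<integral>\<^sup>+ y. ennreal ((R y)\<^sup>2) \<partial>?P) = (\<integral>\<^sup>+ y. (\<Prod>i<n. ennreal ((r (y i))\<^sup>2)) \<partial>?P)"
    unfolding R_def by (intro nn_integral_cong) (simp add: prod_ennreal prod_power_distrib)
  also have "\<dots> = (\<integral>\<^sup>+ y. ennreal ((r y)\<^sup>2) \<partial>P) ^ n"
    using r by (subst P.product_nn_integral_prod) auto
  also have "\<dots> \<le> ennreal (1 + x) ^ n" using chi by (intro power_mono) auto
  also have "\<dots> = ennreal ((1 + x) ^ n)" using x by (intro ennreal_power) auto
  also have "\<dots> \<le> ennreal 2"
  proof (rule ennreal_leI)
    have "(1 + x) ^ n \<le> exp x ^ n" using x by (intro power_mono exp_ge_add_one_self) auto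
    also have "\<dots> = exp (real n * x)" by (simp add: exp_of_nat_mult)
    also have "\<dots> \<le> exp (1/2)" using x by simp
    also have "\<dots> \<le> 2"
    proof (rule power2_le_imp_le)
      have "(exp (1/2) :: real)\<^sup>2 = exp 1" by (simp add: power2_eq_square flip: exp_add)
      then show "(exp (1/2) :: real)\<^sup>2 \<le> 2\<^sup>2" using exp_le by simp
    qed simp
    finally show "(1 + x) ^ n \<le> 2" .
  qed
  finally have R2: "(\<integral>\<^sup>+ y. ennreal ((R y)\<^sup>2) \<partial>?P) \<le> ennreal 2" .
  define m where "m = (\<integral>\<^sup>+ y. ennreal (min 1 (R y)) \<partial>?P)"
  have "1 = (\<integral>\<^sup>+ y. ennreal (R y) \<partial>?P)" using R1 by simp
  also have "\<dots> \<le> (\<integral>\<^sup>+ y. ennreal (min 1 (R y)) + ennreal (1/4) * ennreal ((R y)\<^sup>2) \<partial>?P)"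
  proof (rule nn_integral_mono)
    fix y
    \<comment> \<open>This square gives R <= 1 + R^2/4. Integrated with second moment at most 2, it
      leaves at least 1/2 for the integral of min(1, R).\<close>
    have "0 \<le> (1 - R y / 2)\<^sup>2" by simp
    then have "R y \<le> min 1 (R y) + 1/4 * (R y)\<^sup>2" by (auto simp: min_def power2_eq_square algebra_simps)
    then have "ennreal (R y) \<le> ennreal (min 1 (R y) + 1/4 * (R y)\<^sup>2)" by (rule ennreal_leI)
    also have "\<dots> = ennreal (min 1 (R y)) + ennreal (1/4) * ennreal ((R y)\<^sup>2)"
      using R0[of y] by (subst ennreal_plus) (auto simp flip: ennreal_mult)
    finally show "ennreal (R y) \<le> ennreal (min 1 (R y)) + ennreal (1/4) * ennreal ((R y)\<^sup>2)" .
  qed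
  also have "\<dots> = m + ennreal (1/4) * (\<integral>\<^sup>+ y. ennreal ((R y)\<^sup>2) \<partial>?P)"
    unfolding m_def by (subst nn_integral_add) (auto simp: nn_integral_cmult)
  also have "\<dots> \<le> m + ennreal (1/4) * ennreal 2" by (intro add_left_mono mult_left_mono R2) auto
  also have "ennreal (1/4) * ennreal 2 = ennreal (1/2)" by (subst ennreal_mult[symmetric]) auto
  finally have m: "1 \<le> m + ennreal (1/2)" .
  have m2: "ennreal (1/2) \<le> m"
  proof (cases m)
    case (real m')
    then have "ennreal 1 \<le> ennreal (m' + 1/2)" using m by (subst ennreal_plus) auto
    then have "1 \<le> m' + 1/2" using real(1) by (subst (asm) ennreal_le_iff) auto
    then have "ennreal (1/2) \<le> ennreal m'" by (intro ennreal_leI) linarith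
    then show ?thesis using real by metis
  qed auto
  have "ennreal (d / 2) = ennreal d * ennreal (1/2)" using d(1) by (subst ennreal_mult[symmetric]) auto
  also have "\<dots> \<le> ennreal d * m" by (intro mult_left_mono m2) auto
  also have "\<dots> = (\<integral>\<^sup>+ y. ennreal d * ennreal (min 1 (R y)) \<partial>?P)"
    unfolding m_def by (simp add: nn_integral_cmult)
  \<comment> \<open>The minimum serves both laws: it is at most 1, the density of the first, and at
    most R, the density of the second.\<close>
  also have "\<dots> \<le> (\<integral>\<^sup>+ y. A y + ennreal (R y) * B y \<partial>?P)"
  proof (rule nn_integral_mono)
    fix y assume "y \<in> space ?P"
    then have "ennreal d * ennreal (min 1 (R y)) \<le> (A y + B y) * ennreal (min 1 (R y))"
      by (intro mult_right_mono d) auto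
    also have "\<dots> = ennreal (min 1 (R y)) * A y + ennreal (min 1 (R y)) * B y"
      by (simp add: algebra_simps)
    also have "\<dots> \<le> 1 * A y + ennreal (R y) * B y"
      by (intro add_mono mult_right_mono ennreal_leI) (auto simp: ennreal_leI simp flip: ennreal_1)
    finally show "ennreal d * ennreal (min 1 (R y)) \<le> A y + ennreal (R y) * B y" by simp
  qed
  also have "\<dots> = (\<integral>\<^sup>+ y. A y \<partial>?P) + (\<integral>\<^sup>+ y. B y \<partial>PiM {..<n} (\<lambda>_. density P r))"
    unfolding dens by (subst nn_integral_add) (auto simp: nn_integral_density)
  finally show ?thesis .
qed

section \<open>Gaussian sequences and their shift mixtures\<close>

abbreviation std_gauss :: "real measure" where
  "std_gauss \<equiv> density lborel (\<lambda>x. ennreal (std_normal_density x))"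

lemma prob_space_std_gauss: "prob_space std_gauss"
  using prob_space_normal_density[of 1 0] by simp

lemma product_prob_space_std_gauss: "product_prob_space (\<lambda>_::int. std_gauss)"
  by (intro product_prob_spaceI prob_space_std_gauss)

lemma sets_std_gauss_seq: "sets std_gauss_seq = sets (PiM UNIV (\<lambda>_. borel))"
  unfolding std_gauss_seq_def by (intro sets_PiM_cong) auto

lemma space_std_gauss_seq: "space std_gauss_seq = UNIV"
  by (simp add: std_gauss_seq_def space_PiM)

lemma prob_space_std_gauss_seq: "prob_space std_gauss_seq"
  unfolding std_gauss_seq_def by (intro prob_space_PiM prob_space_std_gauss)

lemma measurable_std_gauss_seq_cong: "measurable std_gauss_seq M = measurable (PiM UNIV (\<lambda>_. borel)) M"
  by (intro measurable_cong_sets sets_std_gauss_seq refl)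

lemma coord_measurable_std_gauss_seq [measurable]: "(\<lambda>z. z l) \<in> borel_measurable std_gauss_seq"
  unfolding measurable_std_gauss_seq_cong by simp

text \<open>One-dimensional Cameron-Martin formula, by translation invariance and completing the
  square.\<close>

lemma nn_integral_std_gauss_shift:
  assumes [measurable]: "F \<in> borel_measurable borel"
  shows "(\<integral>\<^sup>+ x. F (x + c) \<partial>std_gauss) = (\<integral>\<^sup>+ x. ennreal (exp (c * x - c\<^sup>2/2)) * F x \<partial>std_gauss)"
proof -
  have "(\<integral>\<^sup>+ x. F (x + c) \<partial>std_gauss) = (\<integral>\<^sup>+ x. ennreal (std_normal_density x) * F (x + c) \<partial>lborel)"
    by (subst nn_integral_density) auto
  also have "\<dots> = (\<integral>\<^sup>+ x. ennreal (std_normal_density (x - c)) * F x \<partial>lborel)"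
    by (subst nn_integral_real_affine[where c=1 and t="-c"]) auto
  also have "\<dots> = (\<integral>\<^sup>+ x. ennreal (std_normal_density x) * (ennreal (exp (c * x - c\<^sup>2/2)) * F x) \<partial>lborel)"
  proof (intro nn_integral_cong)
    fix x
    have "std_normal_density (x - c) = std_normal_density x * exp (c * x - c\<^sup>2/2)"
      unfolding std_normal_density_def mult.assoc exp_add[symmetric]
      by (simp add: power2_eq_square algebra_simps diff_divide_distrib add_divide_distrib)
    then show "ennreal (std_normal_density (x - c)) * F x = ennreal (std_normal_density x) * (ennreal (exp (c * x - c\<^sup>2/2)) * F x)"
      by (simp add: ennreal_mult mult.assoc)
  qed
  also have "\<dots> = (\<integral>\<^sup>+ x. ennreal (exp (c * x - c\<^sup>2/2)) * F x \<partial>std_gauss)"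
    by (subst nn_integral_density) auto
  finally show ?thesis .
qed

lemma nn_integral_std_gauss_seq_prod:
  assumes K: "finite K" and [measurable]: "\<And>l. \<phi> l \<in> borel_measurable borel"
  shows "(\<integral>\<^sup>+ z. (\<Prod>l\<in>K. \<phi> l (z l)) \<partial>std_gauss_seq) = (\<Prod>l\<in>K. (\<integral>\<^sup>+ x. \<phi> l x \<partial>std_gauss))"
proof -
  interpret product_prob_space "\<lambda>_::int. std_gauss" UNIV by (rule product_prob_space_std_gauss)
  have "(\<Prod>l\<in>K. (\<integral>\<^sup>+ x. \<phi> l x \<partial>std_gauss)) = (\<integral>\<^sup>+ z. (\<Prod>l\<in>K. \<phi> l (z l)) \<partial>PiM K (\<lambda>_. std_gauss))"
    by (subst product_nn_integral_prod[OF K]) (auto simp: measurable_lborel1 measurable_lborel2)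
  also have "\<dots> = (\<integral>\<^sup>+ z. (\<Prod>l\<in>K. \<phi> l (restrict z K l)) \<partial>std_gauss_seq)"
    unfolding std_gauss_seq_def
    by (subst distr_PiM_restrict_finite[OF K subset_UNIV, symmetric], subst nn_integral_distr)
      (auto intro!: borel_measurable_prod_ennreal measurable_compose[OF measurable_component_singleton])
  also have "\<dots> = (\<integral>\<^sup>+ z. (\<Prod>l\<in>K. \<phi> l (z l)) \<partial>std_gauss_seq)"
    by (intro nn_integral_cong prod.cong) auto
  finally show ?thesis ..
qed

text \<open>Cameron-Martin formula for a shift in finitely many coordinates. Both sides agree with
  the product of the shifted marginals on cylinders; finiteness of \<open>S\<close> makes the
  density a finite product.\<close>

lemma distr_std_gauss_seq_shift:
  assumes S: "finite S" and c: "\<And>l. l \<notin> S \<Longrightarrow> c l = 0"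
  shows "distr std_gauss_seq (PiM UNIV (\<lambda>_. borel)) (\<lambda>z l. z l + c l) =
    density std_gauss_seq (\<lambda>z. ennreal (exp (\<Sum>l\<in>S. c l * z l - (c l)\<^sup>2 / 2)))" (is "?L = ?R")
proof -
  define M where "M l = distr std_gauss borel (\<lambda>x. x + c l)" for l :: int
  have M: "prob_space (M l)" for l
    unfolding M_def by (intro prob_space.prob_space_distr prob_space_std_gauss) simp
  interpret product_prob_space M UNIV by (intro product_prob_spaceI M)
  interpret G: product_prob_space "\<lambda>_::int. std_gauss" UNIV by (rule product_prob_space_std_gauss)
  have setsM: "sets (PiM UNIV M) = sets (PiM UNIV (\<lambda>_::int. borel :: real measure))"
    by (intro sets_PiM_cong) (auto simp: M_def)
  have meas: "(\<lambda>z l. z l + c l) \<in> measurable std_gauss_seq (PiM UNIV (\<lambda>_. borel))"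
    by (intro measurable_PiM_single') auto
  have emM: "emeasure (M l) F = (\<integral>\<^sup>+ x. ennreal (exp (c l * x - (c l)\<^sup>2/2)) * indicator F x \<partial>std_gauss)"
    if F: "F \<in> sets borel" for l F
  proof -
    have "emeasure (M l) F = (\<integral>\<^sup>+ x. indicator F x \<partial>M l)"
      using F by (simp add: M_def)
    also have "\<dots> = (\<integral>\<^sup>+ x. indicator F (x + c l) \<partial>std_gauss)"
      using F unfolding M_def by (subst nn_integral_distr) auto
    finally show ?thesis using F by (subst (asm) nn_integral_std_gauss_shift) auto
  qed
  have emb: "prod_emb UNIV M J (Pi\<^sub>E J F) = {z. \<forall>l\<in>J. z l \<in> F l}" for J F
    by (auto simp: prod_emb_def M_def PiE_iff)
  have "?L = PiM UNIV M"
  proof (rule PiM_eq)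
    show "sets ?L = sets (PiM UNIV M)" using setsM by simp
    fix J F assume J: "finite J" "J \<subseteq> (UNIV::int set)" and F: "\<And>j. j \<in> J \<Longrightarrow> F j \<in> sets (M j)"
    have F': "F j \<in> sets borel" if "j \<in> J" for j using F[OF that] by (simp add: M_def)
    have sF: "(\<lambda>x. x + c j) -` F j \<in> sets borel" if "j \<in> J" for j
      using measurable_sets[OF _ F'[OF that], of "\<lambda>x. x + c j" borel] by simp
    have cyl: "{z. \<forall>l\<in>J. z l \<in> F l} \<in> sets (PiM UNIV (\<lambda>_::int. borel :: real measure))"
      using sets_PiM_I[OF J, of F M] F unfolding emb setsM by auto
    have "emeasure ?L (prod_emb UNIV M J (Pi\<^sub>E J F)) = emeasure std_gauss_seq (prod_emb UNIV (\<lambda>_. std_gauss) J (Pi\<^sub>E J (\<lambda>l. (\<lambda>x. x + c l) -` F l)))"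
      unfolding emb using cyl meas
      by (subst emeasure_distr) (auto simp: prod_emb_def space_std_gauss_seq PiE_iff intro!: arg_cong[where f="emeasure std_gauss_seq"])
    also have "\<dots> = (\<Prod>l\<in>J. emeasure std_gauss ((\<lambda>x. x + c l) -` F l))"
      unfolding std_gauss_seq_def using J sF by (intro G.emeasure_PiM_emb) auto
    also have "\<dots> = (\<Prod>l\<in>J. emeasure (M l) (F l))"
      using F' by (intro prod.cong refl) (simp add: M_def emeasure_distr)
    finally show "emeasure ?L (prod_emb UNIV M J (Pi\<^sub>E J F)) = (\<Prod>l\<in>J. emeasure (M l) (F l))" .
  qed
  moreover have "?R = PiM UNIV M"
  proof (rule PiM_eq)
    show "sets ?R = sets (PiM UNIV M)" using setsM sets_std_gauss_seq by simp
    fix J F assume J: "finite J" "J \<subseteq> (UNIV::int set)" and F: "\<And>j. j \<in> J \<Longrightarrow> F j \<in> sets (M j)"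
    have F': "F j \<in> sets borel" if "j \<in> J" for j using F[OF that] by (simp add: M_def)
    have cyl: "{z. \<forall>l\<in>J. z l \<in> F l} \<in> sets (PiM UNIV (\<lambda>_::int. borel :: real measure))"
      using sets_PiM_I[OF J, of F M] F unfolding emb setsM by auto
    \<comment> \<open>Padding the sides of the cylinder with \<open>UNIV\<close> lets the indicator
      and the density be products over one index set; the padded factors have mass 1.\<close>
    define F1 where "F1 l = (if l \<in> J then F l else UNIV)" for l
    have F1 [measurable]: "F1 l \<in> sets borel" for l using F' by (auto simp: F1_def)
    define K where "K = S \<union> J"
    have K: "finite K" using S J by (simp add: K_def)
    have ind: "indicator {z. \<forall>l\<in>J. z l \<in> F l} z = (\<Prod>l\<in>K. indicator (F1 l) (z l) :: ennreal)" for z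
    proof (cases "\<forall>l\<in>J. z l \<in> F l")
      case True
      then have "(\<Prod>l\<in>K. indicator (F1 l) (z l) :: ennreal) = (\<Prod>l\<in>K. 1)"
        by (intro prod.cong) (auto simp: F1_def)
      then show ?thesis using True by simp
    next
      case False
      then obtain l where "l \<in> J" "z l \<notin> F l" by auto
      then have "(\<Prod>l\<in>K. indicator (F1 l) (z l) :: ennreal) = 0"
        using K by (intro prod_zero bexI[of _ l]) (auto simp: F1_def K_def)
      then show ?thesis using False by simp
    qed
    have ex: "ennreal (exp (\<Sum>l\<in>S. c l * z l - (c l)\<^sup>2 / 2)) = (\<Prod>l\<in>K. ennreal (exp (c l * z l - (c l)\<^sup>2 / 2)))" for z
    proof -
      have "(\<Sum>l\<in>S. c l * z l - (c l)\<^sup>2 / 2) = (\<Sum>l\<in>K. c l * z l - (c l)\<^sup>2 / 2)"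
        using K c by (intro sum.mono_neutral_left) (auto simp: K_def)
      then show ?thesis using K by (simp add: exp_sum prod_ennreal)
    qed
    have "emeasure ?R (prod_emb UNIV M J (Pi\<^sub>E J F)) =
      (\<integral>\<^sup>+ z. ennreal (exp (\<Sum>l\<in>S. c l * z l - (c l)\<^sup>2 / 2)) * indicator {z. \<forall>l\<in>J. z l \<in> F l} z \<partial>std_gauss_seq)"
      unfolding emb using cyl sets_std_gauss_seq by (intro emeasure_density) auto
    also have "\<dots> = (\<integral>\<^sup>+ z. (\<Prod>l\<in>K. ennreal (exp (c l * z l - (c l)\<^sup>2 / 2)) * indicator (F1 l) (z l)) \<partial>std_gauss_seq)"
      unfolding ex ind by (simp add: prod.distrib)
    also have "\<dots> = (\<Prod>l\<in>K. emeasure (M l) (F1 l))"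
      using K F1 by (subst nn_integral_std_gauss_seq_prod) (auto simp: emM)
    also have "\<dots> = (\<Prod>l\<in>J. emeasure (M l) (F1 l))"
    proof (rule prod.mono_neutral_right)
      show "\<forall>i\<in>K - J. emeasure (M i) (F1 i) = 1"
        using prob_space.emeasure_space_1[OF M] by (auto simp: F1_def M_def)
    qed (use K in \<open>auto simp: K_def\<close>)
    also have "\<dots> = (\<Prod>l\<in>J. emeasure (M l) (F l))"
      by (intro prod.cong) (auto simp: F1_def)
    finally show "emeasure ?R (prod_emb UNIV M J (Pi\<^sub>E J F)) = (\<Prod>l\<in>J. emeasure (M l) (F l))" .
  qed
  ultimately show ?thesis by simp
qed

lemma nn_integral_std_gauss_seq_shift:
  assumes S: "finite S" and c: "\<And>l. l \<notin> S \<Longrightarrow> c l = 0"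
    and F: "F \<in> borel_measurable (PiM UNIV (\<lambda>_. borel))"
  shows "(\<integral>\<^sup>+ z. F (\<lambda>l. z l + c l) \<partial>std_gauss_seq) =
    (\<integral>\<^sup>+ z. ennreal (exp (\<Sum>l\<in>S. c l * z l - (c l)\<^sup>2 / 2)) * F z \<partial>std_gauss_seq)"
proof -
  have meas: "(\<lambda>z l. z l + c l) \<in> measurable std_gauss_seq (PiM UNIV (\<lambda>_. borel))"
    by (intro measurable_PiM_single') auto
  have "(\<integral>\<^sup>+ z. F (\<lambda>l. z l + c l) \<partial>std_gauss_seq) = (\<integral>\<^sup>+ z. F z \<partial>distr std_gauss_seq (PiM UNIV (\<lambda>_. borel)) (\<lambda>z l. z l + c l))"
    using meas F by (subst nn_integral_distr) auto
  also have "\<dots> = (\<integral>\<^sup>+ z. ennreal (exp (\<Sum>l\<in>S. c l * z l - (c l)\<^sup>2 / 2)) * F z \<partial>std_gauss_seq)"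
    using F by (subst distr_std_gauss_seq_shift[OF S c], simp, subst nn_integral_density) (auto simp: measurable_std_gauss_seq_cong)
  finally show ?thesis .
qed

text \<open>Gaussian Laplace transform: up to its normalization the integrand is a Cameron-Martin
  density, which has total mass 1.\<close>

lemma nn_integral_std_gauss_seq_exp:
  assumes S: "finite S"
  shows "(\<integral>\<^sup>+ z. ennreal (exp (\<Sum>l\<in>S. c l * z l)) \<partial>std_gauss_seq) = ennreal (exp ((\<Sum>l\<in>S. (c l)\<^sup>2) / 2))"
proof -
  interpret prob_space std_gauss_seq by (rule prob_space_std_gauss_seq)
  define c' where "c' l = (if l \<in> S then c l else 0)" for l
  have "(\<integral>\<^sup>+ z. ennreal (exp (\<Sum>l\<in>S. c l * z l)) \<partial>std_gauss_seq) =
    (\<integral>\<^sup>+ z. ennreal (exp ((\<Sum>l\<in>S. (c l)\<^sup>2) / 2)) * (ennreal (exp (\<Sum>l\<in>S. c' l * z l - (c' l)\<^sup>2 / 2)) * 1) \<partial>std_gauss_seq)"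
    by (intro nn_integral_cong)
      (simp add: ennreal_mult[symmetric] exp_add[symmetric] sum_subtractf sum_divide_distrib c'_def)
  also have "\<dots> = ennreal (exp ((\<Sum>l\<in>S. (c l)\<^sup>2) / 2)) * (\<integral>\<^sup>+ z. 1 \<partial>std_gauss_seq)"
    using nn_integral_std_gauss_seq_shift[OF S, of c' "\<lambda>_. 1"]
    by (subst nn_integral_cmult) (auto simp: c'_def)
  finally show ?thesis by (simp add: emeasure_space_1)
qed

section \<open>Second differences of exponentials\<close>

lemma abs_exp_minus_one_le: "\<bar>exp x - 1\<bar> \<le> \<bar>x\<bar> * exp \<bar>x :: real\<bar>"
proof (cases "x \<ge> 0")
  case True
  have "1 - x \<le> exp (- x)" using exp_ge_add_one_self[of "-x"] by simp
  then have "exp x * (1 - x) \<le> exp x * exp (- x)" by (intro mult_left_mono) auto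
  then have "exp x - 1 \<le> x * exp x" by (simp add: algebra_simps flip: exp_add)
  then show ?thesis using True by simp
next
  case False
  then have "1 - exp x \<le> \<bar>x\<bar> * 1" using exp_ge_add_one_self[of x] by linarith
  also have "\<dots> \<le> \<bar>x\<bar> * exp \<bar>x\<bar>" by (intro mult_left_mono) auto
  finally show ?thesis using False by simp
qed

text \<open>The left-hand side is \<open>e\<^sup>q (e\<^sup>a - 1) (e\<^sup>b - 1) + e\<^bsup>q+a+b\<^esup> (e\<^sup>d - 1)\<close>.\<close>

lemma exp_second_difference_le:
  fixes q a b d U \<eta> :: real
  assumes U: "0 \<le> U" "U \<le> 1" and \<eta>: "0 \<le> \<eta>" "\<eta> \<le> 1"
    and q: "\<bar>q\<bar> \<le> 4 * U\<^sup>2" and a: "\<bar>a\<bar> \<le> 2 * U * \<eta>" and b: "\<bar>b\<bar> \<le> 2 * U * \<eta>" and d: "\<bar>d\<bar> \<le> \<eta>\<^sup>2"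
  shows "exp (q + a + b + d) - exp (q + a) - exp (q + b) + exp q \<le> d + 10 * exp 9 * \<eta>\<^sup>2 * (U\<^sup>2 + \<eta>\<^sup>2)"
proof -
  have U2: "U\<^sup>2 \<le> 1" using U by (simp add: power_le_one)
  have E2: "\<eta>\<^sup>2 \<le> 1" using \<eta> by (simp add: power_le_one)
  have UE: "U * \<eta> \<le> 1" using U \<eta> by (simp add: mult_le_one)
  have a2: "\<bar>exp a - 1\<bar> \<le> 2 * U * \<eta> * exp 2"
    using a UE U \<eta> by (intro order_trans[OF abs_exp_minus_one_le] mult_mono) auto
  have b2: "\<bar>exp b - 1\<bar> \<le> 2 * U * \<eta> * exp 2"
    using b UE U \<eta> by (intro order_trans[OF abs_exp_minus_one_le] mult_mono) auto
  have d2: "\<bar>exp d - 1\<bar> \<le> \<eta>\<^sup>2 * exp 1"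
    using d E2 by (intro order_trans[OF abs_exp_minus_one_le] mult_mono) auto
  \<comment> \<open>Since \<open>U\<close> and \<open>\<eta>\<close> are at most 1, |y| is at most
    8; with |d| <= 1 this is the origin of exp 9.\<close>
  define y where "y = q + a + b"
  have y: "\<bar>y\<bar> \<le> 4 * U\<^sup>2 + 4 * U * \<eta>" using q a b unfolding y_def by linarith
  have y2: "\<bar>exp y - 1\<bar> \<le> (4 * U\<^sup>2 + 4 * U * \<eta>) * exp 8"
    using y UE U2 U \<eta> by (intro order_trans[OF abs_exp_minus_one_le] mult_mono) auto
  have t1: "exp q * ((exp a - 1) * (exp b - 1)) \<le> 4 * exp 8 * (U\<^sup>2 * \<eta>\<^sup>2)"
  proof -
    have "exp q * ((exp a - 1) * (exp b - 1)) \<le> \<bar>exp q * ((exp a - 1) * (exp b - 1))\<bar>" by simp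
    also have "\<dots> = exp q * (\<bar>exp a - 1\<bar> * \<bar>exp b - 1\<bar>)" by (simp add: abs_mult)
    also have "\<dots> \<le> exp 4 * ((2 * U * \<eta> * exp 2) * (2 * U * \<eta> * exp 2))"
      using q U2 U \<eta> a2 b2 by (intro mult_mono) auto
    also have "\<dots> = 4 * (exp 4 * exp 2 * exp 2) * (U\<^sup>2 * \<eta>\<^sup>2)" by (simp add: power2_eq_square)
    also have "exp 4 * exp 2 * exp 2 = (exp 8 :: real)" by (simp flip: exp_add)
    finally show ?thesis by simp
  qed
  have t2: "(exp y - 1) * (exp d - 1) \<le> exp 9 * (\<eta>\<^sup>2 * (6 * U\<^sup>2 + 2 * \<eta>\<^sup>2))"
  proof -
    have "(exp y - 1) * (exp d - 1) \<le> \<bar>exp y - 1\<bar> * \<bar>exp d - 1\<bar>" by (simp flip: abs_mult)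
    also have "\<dots> \<le> ((4 * U\<^sup>2 + 4 * U * \<eta>) * exp 8) * (\<eta>\<^sup>2 * exp 1)"
      using y2 d2 U \<eta> by (intro mult_mono) auto
    also have "\<dots> = (exp 8 * exp 1) * (\<eta>\<^sup>2 * (4 * U\<^sup>2 + 4 * U * \<eta>))" by (simp add: mult_ac)
    also have "exp 8 * exp 1 = (exp 9 :: real)" by (simp flip: exp_add)
    also have "exp 9 * (\<eta>\<^sup>2 * (4 * U\<^sup>2 + 4 * U * \<eta>)) \<le> exp 9 * (\<eta>\<^sup>2 * (6 * U\<^sup>2 + 2 * \<eta>\<^sup>2))"
    proof (intro mult_left_mono)
      have "0 \<le> (U - \<eta>)\<^sup>2" by simp
      then show "4 * U\<^sup>2 + 4 * U * \<eta> \<le> 6 * U\<^sup>2 + 2 * \<eta>\<^sup>2" by (simp add: power2_eq_square algebra_simps)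
    qed auto
    finally show ?thesis .
  qed
  \<comment> \<open>From exp (- d) >= 1 - d the Taylor remainder is at most d (exp d - 1), which is
    of order \<open>\<eta>\<close>^4.\<close>
  have t3: "exp d - 1 - d \<le> exp 9 * (\<eta>\<^sup>2 * \<eta>\<^sup>2)"
  proof -
    have "1 - d \<le> exp (- d)" using exp_ge_add_one_self[of "-d"] by simp
    then have "exp d * (1 - d) \<le> exp d * exp (- d)" by (intro mult_left_mono) auto
    then have "exp d - 1 - d \<le> d * (exp d - 1)" by (simp add: algebra_simps flip: exp_add)
    also have "\<dots> \<le> \<bar>d\<bar> * \<bar>exp d - 1\<bar>" by (simp flip: abs_mult)
    also have "\<dots> \<le> \<eta>\<^sup>2 * (\<eta>\<^sup>2 * exp 1)" using d d2 by (intro mult_mono) auto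
    also have "\<dots> \<le> \<eta>\<^sup>2 * (\<eta>\<^sup>2 * exp 9)" by (intro mult_left_mono) auto
    finally show ?thesis by (simp add: mult_ac)
  qed
  have t4: "4 * exp 8 * (U\<^sup>2 * \<eta>\<^sup>2) \<le> 4 * exp 9 * (U\<^sup>2 * \<eta>\<^sup>2)"
    by (intro mult_right_mono) auto
  \<comment> \<open>The factor 10 collects 4 from the product of first-order terms and 6 from the
    correction to the bilinear term.\<close>
  have "exp (q + a + b + d) - exp (q + a) - exp (q + b) + exp q
    = exp q * ((exp a - 1) * (exp b - 1)) + (exp y - 1) * (exp d - 1) + (exp d - 1 - d) + d"
    unfolding y_def by (simp add: exp_add algebra_simps)
  also have "\<dots> \<le> 4 * exp 9 * (U\<^sup>2 * \<eta>\<^sup>2) + exp 9 * (\<eta>\<^sup>2 * (6 * U\<^sup>2 + 2 * \<eta>\<^sup>2)) + exp 9 * (\<eta>\<^sup>2 * \<eta>\<^sup>2) + d"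
    using t1 t2 t3 t4 by linarith
  also have "\<dots> = d + exp 9 * \<eta>\<^sup>2 * (10 * U\<^sup>2 + 3 * \<eta>\<^sup>2)" by (simp add: algebra_simps)
  also have "\<dots> \<le> d + exp 9 * \<eta>\<^sup>2 * (10 * U\<^sup>2 + 10 * \<eta>\<^sup>2)"
    by (intro add_left_mono mult_left_mono) auto
  finally show ?thesis by (simp add: algebra_simps)
qed

lemma abs_sum_mult_le:
  fixes a b :: "'i \<Rightarrow> real"
  assumes "(\<Sum>l\<in>S. (a l)\<^sup>2) \<le> A\<^sup>2" "(\<Sum>l\<in>S. (b l)\<^sup>2) \<le> B\<^sup>2" "0 \<le> A" "0 \<le> B"
  shows "\<bar>\<Sum>l\<in>S. a l * b l\<bar> \<le> A * B"
proof (rule power2_le_imp_le)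
  have "(\<bar>\<Sum>l\<in>S. a l * b l\<bar>)\<^sup>2 \<le> (\<Sum>l\<in>S. (a l)\<^sup>2) * (\<Sum>l\<in>S. (b l)\<^sup>2)"
    using Cauchy_Schwarz_ineq_sum[of a b S] by simp
  also have "\<dots> \<le> A\<^sup>2 * B\<^sup>2" using assms by (intro mult_mono) (auto intro!: sum_nonneg)
  finally show "(\<bar>\<Sum>l\<in>S. a l * b l\<bar>)\<^sup>2 \<le> (A * B)\<^sup>2" by (simp add: power_mult_distrib)
qed (use assms in auto)

section \<open>Likelihood ratios of shift mixtures against pure noise\<close>

definition gauss_lik :: "int set \<Rightarrow> (int \<Rightarrow> real) \<Rightarrow> (int \<Rightarrow> real) \<Rightarrow> real" where
  "gauss_lik S c z = exp (\<Sum>l\<in>S. c l * z l - (c l)\<^sup>2 / 2)"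

definition mix_lik :: "'t measure \<Rightarrow> int set \<Rightarrow> ('t \<Rightarrow> int \<Rightarrow> real) \<Rightarrow> (int \<Rightarrow> real) \<Rightarrow> real" where
  "mix_lik M S u z = (\<integral>t. gauss_lik S (u t) z \<partial>M)"

lemma gauss_lik_pos: "0 < gauss_lik S c z"
  by (simp add: gauss_lik_def)

lemma gauss_lik_measurable:
  assumes "\<And>l. (\<lambda>t. u t l) \<in> borel_measurable M"
  shows "(\<lambda>(t, z). gauss_lik S (u t) z) \<in> borel_measurable (M \<Otimes>\<^sub>M std_gauss_seq)"
proof -
  have 1: "(\<lambda>p. u (fst p) l) \<in> borel_measurable (M \<Otimes>\<^sub>M std_gauss_seq)" for l
    using assms by (intro measurable_compose[OF measurable_fst])
  have 2: "(\<lambda>p. snd p l) \<in> borel_measurable (M \<Otimes>\<^sub>M std_gauss_seq)" for l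
    by (intro measurable_compose[OF measurable_snd] coord_measurable_std_gauss_seq)
  show ?thesis unfolding gauss_lik_def split_def using 1 2 by measurable
qed

text \<open>Cauchy-Schwarz bounds that depend on the signal only through \<open>U\<close>. They are
  uniform over the shift, so for fixed noise both the likelihood and its inverse are integrable in
  the shift.\<close>

lemma gauss_lik_exp_bound:
  assumes "finite S" "(\<Sum>l\<in>S. (u l)\<^sup>2) \<le> U\<^sup>2" "0 \<le> U"
  shows "gauss_lik S u z \<le> exp (U * sqrt (\<Sum>l\<in>S. (z l)\<^sup>2))"
    "1 / gauss_lik S u z \<le> exp (U * sqrt (\<Sum>l\<in>S. (z l)\<^sup>2) + U\<^sup>2 / 2)"
proof -
  have *: "\<bar>\<Sum>l\<in>S. u l * z l\<bar> \<le> U * sqrt (\<Sum>l\<in>S. (z l)\<^sup>2)"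
    using assms by (intro abs_sum_mult_le) (auto simp: sum_nonneg)
  have "(\<Sum>l\<in>S. u l * z l - (u l)\<^sup>2 / 2) = (\<Sum>l\<in>S. u l * z l) - (\<Sum>l\<in>S. (u l)\<^sup>2) / 2"
    by (simp add: sum_subtractf sum_divide_distrib)
  moreover have "0 \<le> (\<Sum>l\<in>S. (u l)\<^sup>2)" by (simp add: sum_nonneg)
  moreover have "1 / exp y = exp (- y)" for y :: real by (simp add: exp_minus divide_inverse)
  ultimately show "gauss_lik S u z \<le> exp (U * sqrt (\<Sum>l\<in>S. (z l)\<^sup>2))"
    "1 / gauss_lik S u z \<le> exp (U * sqrt (\<Sum>l\<in>S. (z l)\<^sup>2) + U\<^sup>2 / 2)"
    using * assms(2) unfolding gauss_lik_def by (simp_all add: abs_le_iff)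
qed

text \<open>\<open>M\<close> is the law of the random shift and \<open>u t\<close> the signal
  shifted by \<open>t\<close> in real coordinates. One bound \<open>U\<close> can serve all
  \<open>t\<close> because a shift changes only phases.\<close>

locale gauss_mixture = prob_space M for M :: "'t measure" +
  fixes S :: "int set" and u :: "'t \<Rightarrow> int \<Rightarrow> real" and U :: real
  assumes fin: "finite S" and meas: "\<And>l. (\<lambda>t. u t l) \<in> borel_measurable M"
    and U0: "0 \<le> U" and bound: "\<And>t. (\<Sum>l\<in>S. (u t l)\<^sup>2) \<le> U\<^sup>2"
begin

lemma lik_measurable [measurable]: "(\<lambda>t. gauss_lik S (u t) z) \<in> borel_measurable M"
  using meas unfolding gauss_lik_def by measurable

lemma integrable_lik: "integrable M (\<lambda>t. gauss_lik S (u t) z)"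
  using gauss_lik_exp_bound(1)[OF fin bound U0] gauss_lik_pos[THEN less_imp_le]
  by (intro integrable_const_bound[where B="exp (U * sqrt (\<Sum>l\<in>S. (z l)\<^sup>2))"]) auto

lemma integrable_inverse_lik: "integrable M (\<lambda>t. 1 / gauss_lik S (u t) z)"
  using gauss_lik_exp_bound(2)[OF fin bound U0] gauss_lik_pos[THEN less_imp_le]
  by (intro integrable_const_bound[where B="exp (U * sqrt (\<Sum>l\<in>S. (z l)\<^sup>2) + U\<^sup>2 / 2)"]) auto

lemma mix_lik_pos: "0 < mix_lik M S u z"
proof -
  let ?b = "exp (U * sqrt (\<Sum>l\<in>S. (z l)\<^sup>2) + U\<^sup>2 / 2)"
  have "1 / ?b \<le> gauss_lik S (u t) z" for t
    using gauss_lik_exp_bound(2)[OF fin bound U0, of t z] gauss_lik_pos[of S "u t" z]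
    by (simp add: field_simps)
  then have "(\<integral>t. 1 / ?b \<partial>M) \<le> mix_lik M S u z"
    unfolding mix_lik_def by (intro integral_mono integrable_lik) auto
  moreover have "0 < (\<integral>t. 1 / ?b \<partial>M)" by (simp add: prob_space)
  ultimately show ?thesis by linarith
qed

lemma ennreal_mix_lik: "ennreal (mix_lik M S u z) = (\<integral>\<^sup>+ t. ennreal (gauss_lik S (u t) z) \<partial>M)"
  unfolding mix_lik_def using gauss_lik_pos[THEN less_imp_le]
  by (intro nn_integral_eq_integral[symmetric] integrable_lik) auto

lemma pair_measurable:
  "(\<lambda>(t, z). gauss_lik S (u t) z) \<in> borel_measurable (M \<Otimes>\<^sub>M std_gauss_seq)"
  by (rule gauss_lik_measurable[OF meas])

lemma mix_lik_measurable [measurable]: "mix_lik M S u \<in> borel_measurable std_gauss_seq"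
  unfolding mix_lik_def
  by (rule borel_measurable_lebesgue_integral)
    (use measurable_pair_swap[OF pair_measurable] in \<open>simp add: split_def\<close>)

lemma inverse_mix_lik_measurable [measurable]:
  "(\<lambda>z. \<integral>t. 1 / gauss_lik S (u t) z \<partial>M) \<in> borel_measurable std_gauss_seq"
proof (rule borel_measurable_lebesgue_integral)
  have "(\<lambda>p. gauss_lik S (u (snd p)) (fst p)) \<in> borel_measurable (std_gauss_seq \<Otimes>\<^sub>M M)"
    using measurable_pair_swap[OF pair_measurable] by (simp add: split_def)
  then show "(\<lambda>(z, t). 1 / gauss_lik S (u t) z) \<in> borel_measurable (std_gauss_seq \<Otimes>\<^sub>M M)"
    unfolding split_def by measurable
qed

lemma inverse_mix_lik_le: "1 / mix_lik M S u z \<le> (\<integral>t. 1 / gauss_lik S (u t) z \<partial>M)"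
proof -
  define c where "c = mix_lik M S u z"
  have c: "c > 0" using mix_lik_pos by (simp add: c_def)
  \<comment> \<open>tangent line of \<open>1/x\<close> at \<open>c\<close>\<close>
  have pw: "2 / c - x / c\<^sup>2 \<le> 1 / x" if "x > 0" for x
  proof -
    have "0 \<le> (c - x)\<^sup>2 / (x * c\<^sup>2)" using that by simp
    also have "\<dots> = 1 / x - (2 / c - x / c\<^sup>2)" using that c by (simp add: field_simps power2_eq_square)
    finally show ?thesis by simp
  qed
  \<comment> \<open>Averaging the tangent line gives 2/c - c/c^2, because \<open>c\<close> is the
    mean of the likelihood.\<close>
  have "1 / c = (\<integral>t. 2 / c - gauss_lik S (u t) z / c\<^sup>2 \<partial>M)"
    using c by (subst Bochner_Integration.integral_diff)
      (auto simp: integrable_lik prob_space mix_lik_def[symmetric] c_def[symmetric] power2_eq_square field_simps)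
  also have "\<dots> \<le> (\<integral>t. 1 / gauss_lik S (u t) z \<partial>M)"
    by (intro integral_mono integrable_inverse_lik pw gauss_lik_pos Bochner_Integration.integrable_diff
          integrable_divide_zero integrable_lik) auto
  finally show ?thesis by (simp add: c_def)
qed

lemma nn_integral_mix_lik: "(\<integral>\<^sup>+ z. ennreal (mix_lik M S u z) \<partial>std_gauss_seq) = 1"
proof -
  interpret G: prob_space std_gauss_seq by (rule prob_space_std_gauss_seq)
  interpret pair_sigma_finite M std_gauss_seq ..
  have lik1: "(\<integral>\<^sup>+ z. ennreal (gauss_lik S (u t) z) \<partial>std_gauss_seq) = 1" for t
  proof -
    define c where "c l = (if l \<in> S then u t l else 0)" for l
    have "(\<integral>\<^sup>+ z. ennreal (gauss_lik S (u t) z) \<partial>std_gauss_seq) =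
      (\<integral>\<^sup>+ z. ennreal (exp (\<Sum>l\<in>S. c l * z l - (c l)\<^sup>2 / 2)) * 1 \<partial>std_gauss_seq)"
      unfolding gauss_lik_def c_def by (intro nn_integral_cong) auto
    also have "\<dots> = 1"
      using nn_integral_std_gauss_seq_shift[OF fin, of c "\<lambda>_. 1"] by (simp add: c_def G.emeasure_space_1)
    finally show ?thesis .
  qed
  have "(\<integral>\<^sup>+ z. ennreal (mix_lik M S u z) \<partial>std_gauss_seq) =
     (\<integral>\<^sup>+ z. (\<integral>\<^sup>+ t. ennreal (gauss_lik S (u t) z) \<partial>M) \<partial>std_gauss_seq)"
    by (simp add: ennreal_mix_lik)
  also have "\<dots> = (\<integral>\<^sup>+ t. (\<integral>\<^sup>+ z. ennreal (gauss_lik S (u t) z) \<partial>std_gauss_seq) \<partial>M)"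
    using pair_measurable by (intro Fubini') (simp add: split_def)
  finally show ?thesis by (simp add: lik1 emeasure_space_1)
qed

end

section \<open>Averages over three independent shifts\<close>

lemma nn_integral_triple_prod:
  assumes M: "prob_space M" and [measurable]: "a \<in> borel_measurable M" "b \<in> borel_measurable M" "c \<in> borel_measurable M"
  shows "(\<integral>\<^sup>+ (t1, t2, t3). a t1 * b t2 * c t3 \<partial>(M \<Otimes>\<^sub>M M \<Otimes>\<^sub>M M)) =
    (\<integral>\<^sup>+ t. a t \<partial>M) * (\<integral>\<^sup>+ t. b t \<partial>M) * (\<integral>\<^sup>+ t. c t \<partial>M :: ennreal)"
proof -
  interpret M: prob_space M by fact
  interpret MM: pair_prob_space M M ..
  have "(\<integral>\<^sup>+ (t1, t2, t3). a t1 * b t2 * c t3 \<partial>(M \<Otimes>\<^sub>M M \<Otimes>\<^sub>M M)) =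
    (\<integral>\<^sup>+ t1. (\<integral>\<^sup>+ t2. (\<integral>\<^sup>+ t3. a t1 * b t2 * c t3 \<partial>M) \<partial>M) \<partial>M)"
    using MM.P.nn_integral_fst[of "\<lambda>(t1, t2, t3). a t1 * b t2 * c t3" M]
      M.nn_integral_fst[of "\<lambda>(t2, t3). a t1 * b t2 * c t3" M for t1] by simp
  also have "\<dots> = (\<integral>\<^sup>+ t. a t \<partial>M) * (\<integral>\<^sup>+ t. b t \<partial>M) * (\<integral>\<^sup>+ t. c t \<partial>M)"
    by (simp add: nn_integral_cmult nn_integral_multc mult.assoc)
  finally show ?thesis .
qed

text \<open>The leading bilinear term involves only the two shifts coming from the likelihoods; the
  third, coming from the inverse, integrates out.\<close>

lemma integral_triple_prod:
  fixes a b :: "'t \<Rightarrow> real"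
  assumes M: "prob_space M" and [measurable]: "a \<in> borel_measurable M" "b \<in> borel_measurable M"
    and bd: "\<And>t. \<bar>a t\<bar> \<le> A" "\<And>t. \<bar>b t\<bar> \<le> B"
  shows "integrable (M \<Otimes>\<^sub>M M \<Otimes>\<^sub>M M) (\<lambda>(t1, t2, t3). a t1 * b t2)"
    "(\<integral>(t1, t2, t3). a t1 * b t2 \<partial>(M \<Otimes>\<^sub>M M \<Otimes>\<^sub>M M)) = (\<integral>t. a t \<partial>M) * (\<integral>t. b t \<partial>M)"
proof -
  interpret M: prob_space M by fact
  interpret MM: pair_prob_space M M ..
  interpret MMM: pair_prob_space M "M \<Otimes>\<^sub>M M" ..
  have A: "0 \<le> A" using bd(1)[of undefined] by linarith
  show i: "integrable (M \<Otimes>\<^sub>M M \<Otimes>\<^sub>M M) (\<lambda>(t1, t2, t3). a t1 * b t2)"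
    using bd A by (intro MMM.P.integrable_const_bound[where B="A * B"])
      (auto simp: abs_mult split_def intro!: mult_mono)
  have b: "integrable (M \<Otimes>\<^sub>M M) (\<lambda>(t2, t3). b t2)"
    using bd by (intro MM.P.integrable_const_bound[where B=B]) (auto simp: split_def)
  have b1: "(\<integral>(t2, t3). b t2 \<partial>(M \<Otimes>\<^sub>M M)) = (\<integral>t. b t \<partial>M)"
    using MM.integral_fst'[OF b] by (simp add: M.prob_space)
  have "(\<integral>(t1, t2, t3). a t1 * b t2 \<partial>(M \<Otimes>\<^sub>M M \<Otimes>\<^sub>M M)) = (\<integral>t1. a t1 * (\<integral>(t2, t3). b t2 \<partial>(M \<Otimes>\<^sub>M M)) \<partial>M)"
    using MMM.integral_fst'[OF i] by (simp add: split_def)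
  then show "(\<integral>(t1, t2, t3). a t1 * b t2 \<partial>(M \<Otimes>\<^sub>M M \<Otimes>\<^sub>M M)) = (\<integral>t. a t \<partial>M) * (\<integral>t. b t \<partial>M)"
    by (simp add: b1)
qed

text \<open>The inner product of \<open>a - c\<close> and \<open>b - c\<close> over
  \<open>S\<close>. The expanded form is affine in \<open>a\<close> and in \<open>b\<close>
  separately, so perturbing each argument produces a second difference of exponentials.\<close>

definition gauss_cross :: "int set \<Rightarrow> (int \<Rightarrow> real) \<Rightarrow> (int \<Rightarrow> real) \<Rightarrow> (int \<Rightarrow> real) \<Rightarrow> real" where
  "gauss_cross S a b c = (\<Sum>l\<in>S. a l * b l) - (\<Sum>l\<in>S. a l * c l) - (\<Sum>l\<in>S. b l * c l) + (\<Sum>l\<in>S. c l * c l)"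

lemma nn_integral_gauss_lik_triple:
  assumes S: "finite S"
  shows "(\<integral>\<^sup>+ z. ennreal (gauss_lik S a z) * ennreal (gauss_lik S b z) * ennreal (1 / gauss_lik S c z) \<partial>std_gauss_seq)
    = ennreal (exp (gauss_cross S a b c))"
proof -
  \<comment> \<open>The quadratic normalizations of the three likelihoods; the Laplace transform at
    a + b - c supplies the remaining half of the squares.\<close>
  define k where "k = ((\<Sum>l\<in>S. (c l)\<^sup>2) - (\<Sum>l\<in>S. (a l)\<^sup>2) - (\<Sum>l\<in>S. (b l)\<^sup>2)) / 2"
  have "1 / exp y = exp (- y)" for y :: real by (simp add: exp_minus divide_inverse)
  then have "gauss_lik S a z * gauss_lik S b z * (1 / gauss_lik S c z) = exp k * exp (\<Sum>l\<in>S. (a l + b l - c l) * z l)" for z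
    unfolding gauss_lik_def k_def
    by (simp only: exp_add[symmetric])
       (simp add: sum_subtractf sum.distrib sum_divide_distrib[symmetric] algebra_simps diff_divide_distrib)
  then have "(\<integral>\<^sup>+ z. ennreal (gauss_lik S a z) * ennreal (gauss_lik S b z) * ennreal (1 / gauss_lik S c z) \<partial>std_gauss_seq)
    = (\<integral>\<^sup>+ z. ennreal (exp k) * ennreal (exp (\<Sum>l\<in>S. (a l + b l - c l) * z l)) \<partial>std_gauss_seq)"
    by (intro nn_integral_cong) (simp add: gauss_lik_pos less_imp_le flip: ennreal_mult)
  also have "\<dots> = ennreal (exp k * exp ((\<Sum>l\<in>S. (a l + b l - c l)\<^sup>2) / 2))"
    by (subst nn_integral_cmult) (auto simp: nn_integral_std_gauss_seq_exp[OF S] ennreal_mult)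
  also have "exp k * exp ((\<Sum>l\<in>S. (a l + b l - c l)\<^sup>2) / 2) = exp (gauss_cross S a b c)"
    unfolding exp_add[symmetric] gauss_cross_def k_def
    by (simp add: power2_eq_square sum_subtractf sum.distrib sum_divide_distrib algebra_simps diff_divide_distrib add_divide_distrib flip: sum.distrib sum_subtractf)
  finally show ?thesis .
qed

text \<open>By Tonelli the noise is integrated out first, for three fixed independent shifts, where
  the integral is explicit. The uniform bounds on the signals make the resulting exponent bounded,
  so the average over shifts is finite.\<close>

lemma mix_lik_cross:
  assumes "gauss_mixture M S w1 W1" "gauss_mixture M S w2 W2" "gauss_mixture M S u U"
  shows "integrable (M \<Otimes>\<^sub>M M \<Otimes>\<^sub>M M) (\<lambda>(t1, t2, t3). exp (gauss_cross S (w1 t1) (w2 t2) (u t3)))"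
    and "has_bochner_integral std_gauss_seq
      (\<lambda>z. mix_lik M S w1 z * mix_lik M S w2 z * (\<integral>t. 1 / gauss_lik S (u t) z \<partial>M))
      (\<integral>(t1, t2, t3). exp (gauss_cross S (w1 t1) (w2 t2) (u t3)) \<partial>(M \<Otimes>\<^sub>M M \<Otimes>\<^sub>M M))"
proof -
  interpret w1: gauss_mixture M S w1 W1 by fact
  interpret w2: gauss_mixture M S w2 W2 by fact
  interpret u: gauss_mixture M S u U by fact
  interpret MM: pair_prob_space M M ..
  interpret MMM: pair_prob_space M "M \<Otimes>\<^sub>M M" ..
  interpret G: prob_space std_gauss_seq by (rule prob_space_std_gauss_seq)
  interpret F: pair_sigma_finite "M \<Otimes>\<^sub>M M \<Otimes>\<^sub>M M" std_gauss_seq ..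
  let ?T = "M \<Otimes>\<^sub>M M \<Otimes>\<^sub>M M"
  let ?K = "\<lambda>p. exp (gauss_cross S (w1 (fst p)) (w2 (fst (snd p))) (u (snd (snd p))))"
  have m [measurable]: "(\<lambda>p. w1 (fst p) l) \<in> borel_measurable ?T" "(\<lambda>p. w2 (fst (snd p)) l) \<in> borel_measurable ?T"
    "(\<lambda>p. u (snd (snd p)) l) \<in> borel_measurable ?T" for l
    using w1.meas[of l] w2.meas[of l] u.meas[of l] by measurable
  have Km: "?K \<in> borel_measurable ?T"
    unfolding gauss_cross_def by measurable
  have Kb: "\<bar>gauss_cross S (w1 t1) (w2 t2) (u t3)\<bar> \<le> W1 * W2 + W1 * U + W2 * U + U * U" for t1 t2 t3
    using abs_sum_mult_le[OF w1.bound[of t1] w2.bound[of t2] w1.U0 w2.U0] abs_sum_mult_le[OF w1.bound[of t1] u.bound[of t3] w1.U0 u.U0]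
      abs_sum_mult_le[OF w2.bound[of t2] u.bound[of t3] w2.U0 u.U0] abs_sum_mult_le[OF u.bound[of t3] u.bound[of t3] u.U0 u.U0]
    unfolding gauss_cross_def by linarith
  have Ki: "integrable ?T ?K"
    using Kb Km by (intro MMM.P.integrable_const_bound[where B="exp (W1 * W2 + W1 * U + W2 * U + U * U)"])
      (auto simp: abs_le_iff)
  then show "integrable ?T (\<lambda>(t1, t2, t3). exp (gauss_cross S (w1 t1) (w2 t2) (u t3)))"
    by (simp add: split_def)
  have [simp]: "0 \<le> gauss_lik S c z" for c z using gauss_lik_pos less_imp_le by blast
  have inv0: "0 \<le> (\<integral>t. 1 / gauss_lik S (u t) z \<partial>M)" for z by simp
  have einv: "ennreal (\<integral>t. 1 / gauss_lik S (u t) z \<partial>M) = (\<integral>\<^sup>+ t. ennreal (1 / gauss_lik S (u t) z) \<partial>M)" for z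
    by (intro nn_integral_eq_integral[symmetric] u.integrable_inverse_lik) auto
  have lm: "(\<lambda>p. gauss_lik S (w1 (fst (fst p))) (snd p)) \<in> borel_measurable (?T \<Otimes>\<^sub>M std_gauss_seq)"
    "(\<lambda>p. gauss_lik S (w2 (fst (snd (fst p)))) (snd p)) \<in> borel_measurable (?T \<Otimes>\<^sub>M std_gauss_seq)"
    "(\<lambda>p. gauss_lik S (u (snd (snd (fst p)))) (snd p)) \<in> borel_measurable (?T \<Otimes>\<^sub>M std_gauss_seq)"
    using gauss_lik_measurable[OF m(1), of S] gauss_lik_measurable[OF m(2), of S] gauss_lik_measurable[OF m(3), of S]
    by (simp_all add: split_def)
  have "(\<integral>\<^sup>+ z. ennreal (mix_lik M S w1 z * mix_lik M S w2 z * (\<integral>t. 1 / gauss_lik S (u t) z \<partial>M)) \<partial>std_gauss_seq)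
    = (\<integral>\<^sup>+ z. (\<integral>\<^sup>+ (t1, t2, t3). ennreal (gauss_lik S (w1 t1) z) * ennreal (gauss_lik S (w2 t2) z)
         * ennreal (1 / gauss_lik S (u t3) z) \<partial>?T) \<partial>std_gauss_seq)"
    by (intro nn_integral_cong, subst nn_integral_triple_prod)
      (auto simp: ennreal_mult w1.mix_lik_pos w2.mix_lik_pos less_imp_le w1.ennreal_mix_lik w2.ennreal_mix_lik einv inv0
        intro: gauss_mixture.axioms(1)[OF assms(3)])
  also have "\<dots> = (\<integral>\<^sup>+ p. (\<integral>\<^sup>+ z. ennreal (gauss_lik S (w1 (fst p)) z) * ennreal (gauss_lik S (w2 (fst (snd p))) z)
         * ennreal (1 / gauss_lik S (u (snd (snd p))) z) \<partial>std_gauss_seq) \<partial>?T)"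
    unfolding split_def using lm by (intro F.Fubini') (simp add: split_def)
  also have "\<dots> = (\<integral>\<^sup>+ p. ennreal (?K p) \<partial>?T)"
    by (simp add: nn_integral_gauss_lik_triple[OF w1.fin])
  also have "\<dots> = ennreal (\<integral>p. ?K p \<partial>?T)"
    by (intro nn_integral_eq_integral Ki) auto
  finally show "has_bochner_integral std_gauss_seq
      (\<lambda>z. mix_lik M S w1 z * mix_lik M S w2 z * (\<integral>t. 1 / gauss_lik S (u t) z \<partial>M))
      (\<integral>(t1, t2, t3). exp (gauss_cross S (w1 t1) (w2 t2) (u t3)) \<partial>?T)"
    by (intro has_bochner_integral_nn_integral)
      (auto simp: split_def w1.mix_lik_pos w2.mix_lik_pos less_imp_le inv0)
qed

text \<open>After Jensen, (Lv - Lu)^2 / Lu is bounded by four terms of the form treated in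
  \<open>mix_lik_cross\<close>, combined with signs +, -, -, +. Only the numerator is perturbed, so
  the third shift always carries \<open>u\<close>.\<close>

lemma mix_lik_chi_square_le:
  assumes mu: "gauss_mixture M S u U" and mv: "gauss_mixture M S v V" and U1: "U \<le> 1"
    and \<eta>: "0 \<le> \<eta>" "\<eta> \<le> 1" and h: "\<And>t. (\<Sum>l\<in>S. (v t l - u t l)\<^sup>2) \<le> \<eta>\<^sup>2"
  shows "(\<integral>\<^sup>+ z. ennreal ((mix_lik M S v z)\<^sup>2 / mix_lik M S u z) \<partial>std_gauss_seq) \<le>
    ennreal (1 + ((\<Sum>l\<in>S. (\<integral>t. v t l - u t l \<partial>M)\<^sup>2) + 10 * exp 9 * \<eta>\<^sup>2 * (U\<^sup>2 + \<eta>\<^sup>2)))"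
proof -
  interpret u: gauss_mixture M S u U by fact
  interpret v: gauss_mixture M S v V by fact
  interpret MM: pair_prob_space M M ..
  interpret MMM: pair_prob_space M "M \<Otimes>\<^sub>M M" ..
  let ?T = "M \<Otimes>\<^sub>M M \<Otimes>\<^sub>M M"
  let ?i = "\<lambda>z. \<integral>t. 1 / gauss_lik S (u t) z \<partial>M"
  let ?Lu = "mix_lik M S u" and ?Lv = "mix_lik M S v"
  let ?K = "\<lambda>w1 w2. \<lambda>(t1, t2, t3). exp (gauss_cross S (w1 t1) (w2 t2) (u t3))"
  note Kvv = mix_lik_cross[OF mv mv mu] and Kvu = mix_lik_cross[OF mv mu mu]
    and Kuv = mix_lik_cross[OF mu mv mu] and Kuu = mix_lik_cross[OF mu mu mu]
  have has1: "has_bochner_integral std_gauss_seq ?Lu 1"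
    using u.nn_integral_mix_lik by (intro has_bochner_integral_nn_integral) (auto simp: u.mix_lik_pos less_imp_le)
  have has2: "has_bochner_integral std_gauss_seq ?Lv 1"
    using v.nn_integral_mix_lik by (intro has_bochner_integral_nn_integral) (auto simp: v.mix_lik_pos less_imp_le)
  define C where "C = 10 * exp 9 * \<eta>\<^sup>2 * (U\<^sup>2 + \<eta>\<^sup>2)"
  define D where "D = integral\<^sup>L ?T (?K v v) - integral\<^sup>L ?T (?K v u) - integral\<^sup>L ?T (?K u v) + integral\<^sup>L ?T (?K u u)"
  have has3: "has_bochner_integral std_gauss_seq (\<lambda>z. ?Lv z * ?Lv z * ?i z - ?Lv z * ?Lu z * ?i z - ?Lu z * ?Lv z * ?i z + ?Lu z * ?Lu z * ?i z) D"
    unfolding D_def by (intro has_bochner_integral_add has_bochner_integral_diff Kvv(2) Kvu(2) Kuv(2) Kuu(2))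
  \<comment> \<open>Adding 2 Lv - Lu, where each likelihood has integral 1, turns the bound on (Lv -
    Lu)^2 / Lu into one on Lv^2 / Lu.\<close>
  have has4: "has_bochner_integral std_gauss_seq (\<lambda>z. (?Lv z * ?Lv z * ?i z - ?Lv z * ?Lu z * ?i z - ?Lu z * ?Lv z * ?i z + ?Lu z * ?Lu z * ?i z) + ?Lv z + ?Lv z - ?Lu z) (D + 1 + 1 - 1)"
    by (intro has_bochner_integral_add has_bochner_integral_diff has1 has2 has3)
  have hm: "(\<lambda>t. v t l - u t l) \<in> borel_measurable M" for l
    using u.meas[of l] v.meas[of l] by simp
  have hb: "\<bar>v t l - u t l\<bar> \<le> \<eta>" if "l \<in> S" for t l
  proof -
    have "(v t l - u t l)\<^sup>2 \<le> (\<Sum>l\<in>S. (v t l - u t l)\<^sup>2)" using that u.fin by (intro member_le_sum) auto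
    also have "\<dots> \<le> \<eta>\<^sup>2" by (rule h)
    finally show ?thesis using \<eta> by (simp add: abs_le_square_iff[symmetric])
  qed
  \<comment> \<open>Independence of the two shifts makes the mean of the product the square of the
    mean; here averaging over the shift enters the leading term.\<close>
  have tp: "has_bochner_integral ?T (\<lambda>(t1, t2, t3). (v t1 l - u t1 l) * (v t2 l - u t2 l)) ((\<integral>t. v t l - u t l \<partial>M)\<^sup>2)" if "l \<in> S" for l
    using integral_triple_prod[OF u.prob_space_axioms hm[of l] hm[of l] hb[OF that] hb[OF that]]
    by (simp add: has_bochner_integral_iff power2_eq_square)
  have hasd: "has_bochner_integral ?T (\<lambda>p. \<Sum>l\<in>S. (v (fst p) l - u (fst p) l) * (v (fst (snd p)) l - u (fst (snd p)) l)) (\<Sum>l\<in>S. (\<integral>t. v t l - u t l \<partial>M)\<^sup>2)"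
    using tp by (intro has_bochner_integral_sum) (simp add: split_def)
  have hasC: "has_bochner_integral ?T (\<lambda>p. (\<Sum>l\<in>S. (v (fst p) l - u (fst p) l) * (v (fst (snd p)) l - u (fst (snd p)) l)) + C) ((\<Sum>l\<in>S. (\<integral>t. v t l - u t l \<partial>M)\<^sup>2) + C)"
    using has_bochner_integral_add[OF hasd, of "\<lambda>_. C" C]
    by (simp add: has_bochner_integral_iff MMM.P.prob_space)
  have hasD: "has_bochner_integral ?T (\<lambda>p. ?K v v p - ?K v u p - ?K u v p + ?K u u p) D"
    unfolding D_def by (intro has_bochner_integral_add has_bochner_integral_diff has_bochner_integral_integrable Kvv(1) Kvu(1) Kuv(1) Kuu(1))
  have "integral\<^sup>L ?T (\<lambda>p. ?K v v p - ?K v u p - ?K u v p + ?K u u p) \<le>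
    integral\<^sup>L ?T (\<lambda>p. (\<Sum>l\<in>S. (v (fst p) l - u (fst p) l) * (v (fst (snd p)) l - u (fst (snd p)) l)) + C)"
  proof (rule integral_mono[OF integrable.intros[OF hasD] integrable.intros[OF hasC]])
    fix p assume "p \<in> space ?T"
    obtain t1 t2 t3 where p: "p = (t1, t2, t3)" by (metis prod.exhaust)
    define h where "h t l = v t l - u t l" for t l
    let ?ip = "\<lambda>a b. \<Sum>l\<in>S. a l * b l"
    have hsq: "(\<Sum>l\<in>S. (h t l)\<^sup>2) \<le> \<eta>\<^sup>2" for t using h by (simp add: h_def)
    \<comment> \<open>Decomposition of the exponent by order in \<open>h\<close>: \<open>q\<close>
      is free of it, \<open>a\<close> and \<open>b\<close> are linear in the perturbation at the
      first and second shift, and \<open>d\<close> is bilinear.\<close>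
    define q where "q = ?ip (u t1) (u t2) - ?ip (u t1) (u t3) - ?ip (u t2) (u t3) + ?ip (u t3) (u t3)"
    define a where "a = ?ip (h t1) (u t2) - ?ip (h t1) (u t3)"
    define b where "b = ?ip (h t2) (u t1) - ?ip (h t2) (u t3)"
    define d where "d = ?ip (h t1) (h t2)"
    have uu: "\<bar>?ip (u s) (u t)\<bar> \<le> U\<^sup>2" for s t
      using abs_sum_mult_le[OF u.bound u.bound u.U0 u.U0, of s t] by (simp add: power2_eq_square)
    have hu: "\<bar>?ip (h s) (u t)\<bar> \<le> U * \<eta>" for s t
      using abs_sum_mult_le[OF hsq u.bound \<eta>(1) u.U0, of s t] by (simp add: mult.commute)
    have hh: "\<bar>?ip (h s) (h t)\<bar> \<le> \<eta>\<^sup>2" for s t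
      using abs_sum_mult_le[OF hsq hsq \<eta>(1) \<eta>(1), of s t] by (simp add: power2_eq_square)
    have vh: "v t l = u t l + h t l" for t l by (simp add: h_def)
    have "\<bar>q\<bar> \<le> 4 * U\<^sup>2" using uu[of t1 t2] uu[of t1 t3] uu[of t2 t3] uu[of t3 t3] unfolding q_def by linarith
    moreover have "\<bar>a\<bar> \<le> 2 * U * \<eta>" using hu[of t1 t2] hu[of t1 t3] unfolding a_def by linarith
    moreover have "\<bar>b\<bar> \<le> 2 * U * \<eta>" using hu[of t2 t1] hu[of t2 t3] unfolding b_def by linarith
    moreover have "\<bar>d\<bar> \<le> \<eta>\<^sup>2" using hh unfolding d_def by simp
    ultimately have "exp (q + a + b + d) - exp (q + a) - exp (q + b) + exp q \<le> d + C"
      unfolding C_def by (intro exp_second_difference_le u.U0 U1 \<eta>)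
    moreover have "gauss_cross S (v t1) (v t2) (u t3) = q + a + b + d"
      unfolding gauss_cross_def q_def a_def b_def d_def vh by (simp add: sum.distrib algebra_simps)
    moreover have "gauss_cross S (v t1) (u t2) (u t3) = q + a"
      unfolding gauss_cross_def q_def a_def b_def d_def vh by (simp add: sum.distrib algebra_simps)
    moreover have "gauss_cross S (u t1) (v t2) (u t3) = q + b"
      unfolding gauss_cross_def q_def a_def b_def d_def vh by (simp add: sum.distrib algebra_simps)
    moreover have "gauss_cross S (u t1) (u t2) (u t3) = q"
      unfolding gauss_cross_def q_def by simp
    ultimately show "?K v v p - ?K v u p - ?K u v p + ?K u u p \<le>
      (\<Sum>l\<in>S. (v (fst p) l - u (fst p) l) * (v (fst (snd p)) l - u (fst (snd p)) l)) + C"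
      by (simp add: p d_def h_def)
  qed
  then have Dle: "D + 1 + 1 - 1 \<le> 1 + ((\<Sum>l\<in>S. (\<integral>t. v t l - u t l \<partial>M)\<^sup>2) + C)"
    unfolding has_bochner_integral_integral_eq[OF hasD] has_bochner_integral_integral_eq[OF hasC] by simp
  have pw: "(?Lv z)\<^sup>2 / ?Lu z \<le> (?Lv z * ?Lv z * ?i z - ?Lv z * ?Lu z * ?i z - ?Lu z * ?Lv z * ?i z + ?Lu z * ?Lu z * ?i z) + ?Lv z + ?Lv z - ?Lu z" for z
  proof -
    have p: "0 < ?Lu z" by (rule u.mix_lik_pos)
    have "(?Lv z)\<^sup>2 / ?Lu z = (?Lv z - ?Lu z)\<^sup>2 * (1 / ?Lu z) + ?Lv z + ?Lv z - ?Lu z"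
      using p by (simp add: field_simps power2_eq_square)
    also have "\<dots> \<le> (?Lv z - ?Lu z)\<^sup>2 * ?i z + ?Lv z + ?Lv z - ?Lu z"
      by (intro add_right_mono diff_right_mono mult_left_mono u.inverse_mix_lik_le) auto
    also have "\<dots> = (?Lv z * ?Lv z * ?i z - ?Lv z * ?Lu z * ?i z - ?Lu z * ?Lv z * ?i z + ?Lu z * ?Lu z * ?i z) + ?Lv z + ?Lv z - ?Lu z"
      by (simp add: power2_eq_square algebra_simps)
    finally show ?thesis .
  qed
  have nonneg: "0 \<le> (?Lv z)\<^sup>2 / ?Lu z" for z using u.mix_lik_pos[of z] by simp
  have "(\<integral>\<^sup>+ z. ennreal ((?Lv z)\<^sup>2 / ?Lu z) \<partial>std_gauss_seq) \<le> (\<integral>\<^sup>+ z. ennreal ((?Lv z * ?Lv z * ?i z - ?Lv z * ?Lu z * ?i z - ?Lu z * ?Lv z * ?i z + ?Lu z * ?Lu z * ?i z) + ?Lv z + ?Lv z - ?Lu z) \<partial>std_gauss_seq)"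
    by (intro nn_integral_mono ennreal_leI pw)
  also have "\<dots> = ennreal (D + 1 + 1 - 1)"
    using has4 order_trans[OF nonneg pw]
    by (subst nn_integral_eq_integral) (auto simp: has_bochner_integral_iff)
  also have "\<dots> \<le> ennreal (1 + ((\<Sum>l\<in>S. (\<integral>t. v t l - u t l \<partial>M)\<^sup>2) + C))"
    by (intro ennreal_leI Dle)
  finally show ?thesis unfolding C_def .
qed

section \<open>Chi-square distance of curve laws\<close>

text \<open>Inverse of \<^const>\<open>noise_coord\<close> on Hermitian sequences.\<close>

definition real_coord :: "(int \<Rightarrow> complex) \<Rightarrow> int \<Rightarrow> real" where
  "real_coord x l = (if l = 0 then Re (x 0) else if l > 0 then sqrt 2 * Re (x l) else - sqrt 2 * Im (x (- l)))"

definition hermitian_seq :: "(int \<Rightarrow> complex) \<Rightarrow> bool" where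
  "hermitian_seq x \<longleftrightarrow> (\<forall>l. x (- l) = cnj (x l))"

text \<open>Real coordinates of the shifted signal in units of the noise level, so that the noise is
  standard Gaussian.\<close>

definition shift_coord :: "real \<Rightarrow> (int \<Rightarrow> complex) \<Rightarrow> real \<Rightarrow> int \<Rightarrow> real" where
  "shift_coord \<epsilon> \<theta> t l = real_coord (\<lambda>l. \<theta> l * cis (- 2*pi * of_int l*t)) l / \<epsilon>"

lemma real_coord_noise_coord: "real_coord (\<lambda>l. complex_of_real e * noise_coord z l) l = e * z l"
  by (auto simp: real_coord_def noise_coord_def)

lemma noise_coord_real_coord:
  assumes "hermitian_seq x"
  shows "noise_coord (real_coord x) l = x l"
proof -
  have x: "x (- l) = cnj (x l)" for l using assms by (simp add: hermitian_seq_def)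
  have "Im (x 0) = 0" using x[of 0] by (simp add: complex_eq_iff)
  moreover have "x l = cnj (x (- l))" using x[of "-l"] by simp
  ultimately show ?thesis
    by (auto simp: real_coord_def noise_coord_def complex_eq_iff)
qed

lemma noise_coord_add_scaled:
  "e \<noteq> 0 \<Longrightarrow> complex_of_real e * noise_coord (\<lambda>l. z l + w l / e) l = noise_coord w l + complex_of_real e * noise_coord z l"
  by (auto simp: noise_coord_def field_simps)

lemma sum_symmetric_int:
  fixes f :: "int \<Rightarrow> real"
  shows "(\<Sum>l\<in>{-int m..int m}. f l) = f 0 + (\<Sum>l\<in>{1..int m}. f l + f (- l))"
proof -
  have "(\<Sum>l\<in>{-int m..int m}. f l) = (\<Sum>l\<in>{0} \<union> ({1..int m} \<union> uminus ` {1..int m}). f l)"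
    by (intro sum.cong refl) (auto simp: image_iff intro: bexI[of _ "- x" for x])
  also have "\<dots> = f 0 + ((\<Sum>l\<in>{1..int m}. f l) + (\<Sum>l\<in>uminus ` {1..int m}. f l))"
    by (subst sum.union_disjoint; (subst sum.union_disjoint)?) auto
  also have "(\<Sum>l\<in>uminus ` {1..int m}. f l) = (\<Sum>l\<in>{1..int m}. f (- l))"
    by (subst sum.reindex) auto
  finally show ?thesis by (simp add: sum.distrib)
qed

text \<open>The factor sqrt 2 makes the real coordinates isometric: the pair l, -l contributes twice
  the squared real part plus twice the squared imaginary part, which is the energy of both
  coefficients.\<close>

lemma sum_real_coord_sq:
  assumes "hermitian_seq x"
  shows "(\<Sum>l\<in>{-int m..int m}. (real_coord x l)\<^sup>2) = (\<Sum>l\<in>{-int m..int m}. (cmod (x l))\<^sup>2)"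
proof -
  have x: "x (- l) = cnj (x l)" for l using assms by (simp add: hermitian_seq_def)
  have "Im (x 0) = 0" using x[of 0] by (simp add: complex_eq_iff)
  then have 0: "(real_coord x 0)\<^sup>2 = (cmod (x 0))\<^sup>2" by (simp add: real_coord_def cmod_power2)
  have "(real_coord x l)\<^sup>2 + (real_coord x (- l))\<^sup>2 = (cmod (x l))\<^sup>2 + (cmod (x (- l)))\<^sup>2" if "l \<in> {1..int m}" for l
    using that by (simp add: x real_coord_def cmod_power2 power_mult_distrib)
  then have "(\<Sum>l\<in>{1..int m}. (real_coord x l)\<^sup>2 + (real_coord x (- l))\<^sup>2) =
    (\<Sum>l\<in>{1..int m}. (cmod (x l))\<^sup>2 + (cmod (x (- l)))\<^sup>2)"
    by (rule sum.cong[OF refl])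
  then show ?thesis unfolding sum_symmetric_int 0 by simp
qed

lemma hermitian_fourier_coef: "hermitian_seq (fourier_coef f)"
proof -
  have "fourier_coef f (- l) = cnj (fourier_coef f l)" for l
    unfolding fourier_coef_def set_lebesgue_integral_def
    by (subst Bochner_Integration.integral_cnj[symmetric]) (simp add: cis_cnj)
  then show ?thesis by (simp add: hermitian_seq_def)
qed

lemma hermitian_gamma_coef: "hermitian_seq (gamma_coef g)"
proof -
  have "gamma_coef g (- l) = cnj (gamma_coef g l)" for l
    unfolding gamma_coef_def
    by (subst Bochner_Integration.integral_cnj[symmetric]) (simp add: cis_cnj)
  then show ?thesis by (simp add: hermitian_seq_def)
qed

lemma hermitian_shift:
  "hermitian_seq \<theta> \<Longrightarrow> hermitian_seq (\<lambda>l. \<theta> l * cis (- 2*pi * of_int l*t))"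
  by (simp add: hermitian_seq_def cis_cnj)

text \<open>A shift multiplies coefficients by phases, so the energy is independent of
  \<open>t\<close>.\<close>

lemma shift_coord_sq:
  assumes "hermitian_seq \<theta>"
  shows "(\<Sum>l\<in>{-int m..int m}. (shift_coord \<epsilon> \<theta> t l)\<^sup>2) = (\<Sum>l\<in>{-int m..int m}. (cmod (\<theta> l))\<^sup>2) / \<epsilon>\<^sup>2"
proof -
  have "(\<Sum>l\<in>{-int m..int m}. (shift_coord \<epsilon> \<theta> t l)\<^sup>2) =
    (\<Sum>l\<in>{-int m..int m}. (real_coord (\<lambda>l. \<theta> l * cis (- 2*pi * of_int l*t)) l)\<^sup>2) / \<epsilon>\<^sup>2"
    by (simp add: shift_coord_def power_divide sum_divide_distrib)
  also have "\<dots> = (\<Sum>l\<in>{-int m..int m}. (cmod (\<theta> l))\<^sup>2) / \<epsilon>\<^sup>2"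
    by (subst sum_real_coord_sq[OF hermitian_shift[OF assms]]) (simp add: norm_mult)
  finally show ?thesis .
qed

lemma shift_coord_diff: "shift_coord \<epsilon> \<theta> t l - shift_coord \<epsilon> \<theta>' t l = shift_coord \<epsilon> (\<lambda>l. \<theta> l - \<theta>' l) t l"
  unfolding shift_coord_def diff_divide_distrib[symmetric]
  by (auto simp: real_coord_def algebra_simps simp del: times_complex.sel)

lemma shift_coord_measurable: "(\<lambda>t. shift_coord \<epsilon> \<theta> t l) \<in> borel_measurable borel"
proof -
  have [measurable]: "cis \<in> borel_measurable borel"
    by (intro borel_measurable_continuous_onI continuous_on_cis continuous_on_id)
  show ?thesis unfolding shift_coord_def real_coord_def by measurable
qed

abbreviation shift_law :: "(real \<Rightarrow> real) \<Rightarrow> real measure" where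
  "shift_law g \<equiv> density lborel (\<lambda>x. ennreal (g x))"

lemma prob_space_shift_law: "prob_density g \<Longrightarrow> prob_space (shift_law g)"
  by (intro prob_spaceI) (simp add: emeasure_density prob_density_def)

lemma integral_cis_shift_law:
  assumes "prob_density g"
  shows "integrable (shift_law g) (\<lambda>t. cis (- 2*pi * of_int l*t))"
    "(\<integral>t. cis (- 2*pi * of_int l*t) \<partial>shift_law g) = gamma_coef g l"
proof -
  interpret prob_space "shift_law g" by (rule prob_space_shift_law[OF assms])
  have [measurable]: "cis \<in> borel_measurable borel"
    by (intro borel_measurable_continuous_onI continuous_on_cis continuous_on_id)
  have [measurable]: "g \<in> borel_measurable borel" using assms by (simp add: prob_density_def)
  show "integrable (shift_law g) (\<lambda>t. cis (- 2*pi * of_int l*t))"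
    by (intro integrable_const_bound[where B=1]) auto
  show "(\<integral>t. cis (- 2*pi * of_int l*t) \<partial>shift_law g) = gamma_coef g l"
    unfolding gamma_coef_def using assms
    by (subst integral_density) (auto simp: prob_density_def scaleR_conv_of_real)
qed

text \<open>The mean over the shift damps each frequency by \<open>gamma_coef\<close>; this is where
  the difficulty of the deconvolution problem enters the lower bound.\<close>

lemma integral_shift_coord:
  assumes g: "prob_density g"
  shows "(\<integral>t. shift_coord \<epsilon> \<theta> t l \<partial>shift_law g) = real_coord (\<lambda>l. \<theta> l * gamma_coef g l) l / \<epsilon>"
proof -
  have i: "integrable (shift_law g) (\<lambda>t. \<theta> l * cis (- 2*pi * of_int l*t))" for l
    by (intro integrable_mult_right integral_cis_shift_law[OF g])
  have e: "(\<integral>t. \<theta> l * cis (- 2*pi * of_int l*t) \<partial>shift_law g) = \<theta> l * gamma_coef g l" for l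
    by (subst integral_mult_right_zero) (simp only: integral_cis_shift_law(2)[OF g])
  have R: "(\<integral>t. Re (\<theta> l * cis (- 2*pi * of_int l*t)) \<partial>shift_law g) = Re (\<theta> l * gamma_coef g l)" for l
    using integral_Re[OF i] e by metis
  have I: "(\<integral>t. Im (\<theta> l * cis (- 2*pi * of_int l*t)) \<partial>shift_law g) = Im (\<theta> l * gamma_coef g l)" for l
    using integral_Im[OF i] e by metis
  show ?thesis
    unfolding shift_coord_def real_coord_def
    using R[of 0] R[of l] I[of "-l"] by (auto simp del: mult_minus_left times_complex.sel)
qed

section \<open>Curve laws as images of Gaussian mixtures\<close>

definition curve_map :: "real \<Rightarrow> (int \<Rightarrow> real) \<Rightarrow> int \<Rightarrow> complex" where
  "curve_map \<epsilon> z = (\<lambda>l. complex_of_real \<epsilon> * noise_coord z l)"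

lemma curve_map_measurable: "curve_map \<epsilon> \<in> measurable (PiM UNIV (\<lambda>_. borel)) curve_space"
  unfolding curve_space_def curve_map_def
proof (rule measurable_PiM_single', goal_cases)
  case (1 l)
  show ?case unfolding noise_coord_def by measurable
qed auto

lemma gauss_mixture_shift:
  assumes g: "prob_density g" and \<theta>: "hermitian_seq \<theta>" and U: "0 \<le> U"
    and b: "(\<Sum>l\<in>{-int m..int m}. (cmod (\<theta> l))\<^sup>2) \<le> (\<epsilon> * U)\<^sup>2" and \<epsilon>: "\<epsilon> > 0"
  shows "gauss_mixture (shift_law g) {-int m..int m} (shift_coord \<epsilon> \<theta>) U"
proof -
  interpret prob_space "shift_law g" by (rule prob_space_shift_law[OF g])
  show ?thesis
  proof
    fix t show "(\<Sum>l\<in>{-int m..int m}. (shift_coord \<epsilon> \<theta> t l)\<^sup>2) \<le> U\<^sup>2"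
      unfolding shift_coord_sq[OF \<theta>] using b \<epsilon> by (simp add: power_mult_distrib field_simps)
  qed (use U in \<open>auto simp: shift_coord_measurable\<close>)
qed

text \<open>For a fixed shift the curve is \<open>curve_map\<close> of a translated noise sequence,
  so Cameron-Martin supplies its density; Tonelli then averages the densities over the
  shift.\<close>

lemma curve_law_eq_mix:
  assumes g: "prob_density g" and \<epsilon>: "\<epsilon> > 0" and U: "0 \<le> U"
    and supp: "\<And>l. l \<notin> {-int m..int m} \<Longrightarrow> fourier_coef f l = 0"
    and b: "(\<Sum>l\<in>{-int m..int m}. (cmod (fourier_coef f l))\<^sup>2) \<le> (\<epsilon> * U)\<^sup>2"
  shows "curve_law g \<epsilon> f = distr (density std_gauss_seq
    (\<lambda>z. ennreal (mix_lik (shift_law g) {-int m..int m} (shift_coord \<epsilon> (fourier_coef f)) z))) curve_space (curve_map \<epsilon>)"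
    (is "_ = ?R")
proof -
  let ?S = "{-int m..int m}" and ?u = "shift_coord \<epsilon> (fourier_coef f)" and ?M = "shift_law g"
  interpret gauss_mixture ?M ?S ?u U
    by (rule gauss_mixture_shift[OF g hermitian_fourier_coef U b \<epsilon>])
  interpret G: prob_space std_gauss_seq by (rule prob_space_std_gauss_seq)
  interpret pair_sigma_finite ?M std_gauss_seq ..
  \<comment> \<open>For negative \<open>l\<close> the real coordinate reads the coefficient at
    \<open>- l\<close>; the frequency range is symmetric, so both vanish outside it.\<close>
  have supp': "?u t l = 0" if "l \<notin> ?S" for t l
    using that supp[of l] supp[of "-l"] by (auto simp: shift_coord_def real_coord_def)
  have curve: "(\<lambda>l. fourier_coef f l * cis (- 2*pi * of_int l*t) + complex_of_real \<epsilon> * noise_coord z l) = curve_map \<epsilon> (\<lambda>l. z l + ?u t l)" for t z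
    using \<epsilon> noise_coord_add_scaled[of \<epsilon> z] noise_coord_real_coord[OF hermitian_shift[OF hermitian_fourier_coef]]
    unfolding curve_map_def shift_coord_def by auto
  have cm: "curve_map \<epsilon> \<in> measurable std_gauss_seq curve_space"
    unfolding measurable_std_gauss_seq_cong by (rule curve_map_measurable)
  have um [measurable]: "(\<lambda>p. ?u (fst p) l) \<in> borel_measurable (?M \<Otimes>\<^sub>M std_gauss_seq)" for l
    using meas by (intro measurable_compose[OF measurable_fst])
  have shm: "(\<lambda>p l. snd p l + ?u (fst p) l) \<in> measurable (?M \<Otimes>\<^sub>M std_gauss_seq) (PiM UNIV (\<lambda>_. borel))"
    by (intro measurable_PiM_single') (auto intro!: borel_measurable_add measurable_compose[OF measurable_snd])
  have law: "curve_law g \<epsilon> f = distr (?M \<Otimes>\<^sub>M std_gauss_seq) curve_space (\<lambda>p. curve_map \<epsilon> (\<lambda>l. snd p l + ?u (fst p) l))"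
    unfolding curve_law_def curve by (simp add: split_def)
  have m2: "(\<lambda>p. curve_map \<epsilon> (\<lambda>l. snd p l + ?u (fst p) l)) \<in> measurable (?M \<Otimes>\<^sub>M std_gauss_seq) curve_space"
    by (rule measurable_compose[OF shm curve_map_measurable])
  show ?thesis
  proof (rule measure_eqI)
    show "sets (curve_law g \<epsilon> f) = sets ?R" by (simp add: curve_law_def)
    fix A assume "A \<in> sets (curve_law g \<epsilon> f)"
    then have A: "A \<in> sets curve_space" by (simp add: curve_law_def)
    have iA: "(\<lambda>z. indicator A (curve_map \<epsilon> z) :: ennreal) \<in> borel_measurable (PiM UNIV (\<lambda>_. borel))"
      using A by (intro measurable_compose[OF curve_map_measurable]) auto
    then have iA2: "(\<lambda>z. indicator A (curve_map \<epsilon> z) :: ennreal) \<in> borel_measurable std_gauss_seq"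
      by (simp add: measurable_std_gauss_seq_cong)
    have "emeasure (curve_law g \<epsilon> f) A = (\<integral>\<^sup>+ y. indicator A y \<partial>curve_law g \<epsilon> f)"
      using A by (simp add: curve_law_def)
    also have "\<dots> = (\<integral>\<^sup>+ p. indicator A (curve_map \<epsilon> (\<lambda>l. snd p l + ?u (fst p) l)) \<partial>(?M \<Otimes>\<^sub>M std_gauss_seq))"
      unfolding law using m2 A by (intro nn_integral_distr) auto
    also have "\<dots> = (\<integral>\<^sup>+ t. (\<integral>\<^sup>+ z. indicator A (curve_map \<epsilon> (\<lambda>l. z l + ?u t l)) \<partial>std_gauss_seq) \<partial>?M)"
      using m2 A by (subst G.nn_integral_fst[symmetric]) auto
    also have "\<dots> = (\<integral>\<^sup>+ t. (\<integral>\<^sup>+ z. ennreal (gauss_lik ?S (?u t) z) * indicator A (curve_map \<epsilon> z) \<partial>std_gauss_seq) \<partial>?M)"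
      unfolding gauss_lik_def by (intro nn_integral_cong nn_integral_std_gauss_seq_shift iA supp') auto
    also have "\<dots> = (\<integral>\<^sup>+ z. (\<integral>\<^sup>+ t. ennreal (gauss_lik ?S (?u t) z) * indicator A (curve_map \<epsilon> z) \<partial>?M) \<partial>std_gauss_seq)"
    proof (rule Fubini'[symmetric])
      have "(\<lambda>p. gauss_lik ?S (?u (fst p)) (snd p)) \<in> borel_measurable (?M \<Otimes>\<^sub>M std_gauss_seq)"
        using pair_measurable by (simp add: split_def)
      moreover have "(\<lambda>p. indicator A (curve_map \<epsilon> (snd p)) :: ennreal) \<in> borel_measurable (?M \<Otimes>\<^sub>M std_gauss_seq)"
        by (rule measurable_compose[OF measurable_snd iA2])
      ultimately show "(\<lambda>(t, z). ennreal (gauss_lik ?S (?u t) z) * indicator A (curve_map \<epsilon> z)) \<in> borel_measurable (?M \<Otimes>\<^sub>M std_gauss_seq)"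
        unfolding split_def by measurable
    qed
    also have "\<dots> = (\<integral>\<^sup>+ z. ennreal (mix_lik ?M ?S ?u z) * indicator A (curve_map \<epsilon> z) \<partial>std_gauss_seq)"
      unfolding ennreal_mix_lik by (intro nn_integral_cong nn_integral_multc) auto
    also have "\<dots> = (\<integral>\<^sup>+ z. indicator A (curve_map \<epsilon> z) \<partial>density std_gauss_seq (\<lambda>z. ennreal (mix_lik ?M ?S ?u z)))"
      using iA2 by (subst nn_integral_density) auto
    also have "\<dots> = (\<integral>\<^sup>+ y. indicator A y \<partial>?R)"
      using cm A by (subst nn_integral_distr) auto
    also have "\<dots> = emeasure ?R A" using A by simp
    finally show "emeasure (curve_law g \<epsilon> f) A = emeasure ?R A" .
  qed
qed

lemma sets_curve_law: "sets (curve_law g \<epsilon> f) = sets curve_space"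
  by (simp add: curve_law_def)

text \<open>\<open>curve_map\<close> has a measurable left inverse, so the likelihood ratio of two
  noise mixtures is also one of the curve laws, with the same second moment. The bound
  \<open>\<Gamma>\<close> is required only where the two signals differ.\<close>

lemma curve_law_density:
  assumes g: "prob_density g" and \<epsilon>: "\<epsilon> > 0" and U: "0 \<le> U" "U \<le> 1" and V: "0 \<le> V" and \<eta>: "0 \<le> \<eta>" "\<eta> \<le> 1"
    and supp: "\<And>l. l \<notin> {-int m..int m} \<Longrightarrow> fourier_coef f l = 0"
       "\<And>l. l \<notin> {-int m..int m} \<Longrightarrow> fourier_coef f' l = 0"
    and b: "(\<Sum>l\<in>{-int m..int m}. (cmod (fourier_coef f l))\<^sup>2) \<le> (\<epsilon> * U)\<^sup>2"
       "(\<Sum>l\<in>{-int m..int m}. (cmod (fourier_coef f' l))\<^sup>2) \<le> (\<epsilon> * V)\<^sup>2"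
       "(\<Sum>l\<in>{-int m..int m}. (cmod (fourier_coef f' l - fourier_coef f l))\<^sup>2) \<le> (\<epsilon> * \<eta>)\<^sup>2"
    and \<Gamma>: "\<And>l. fourier_coef f' l \<noteq> fourier_coef f l \<Longrightarrow> cmod (gamma_coef g l) \<le> \<Gamma>"
  obtains r :: "(int \<Rightarrow> complex) \<Rightarrow> real" where "r \<in> borel_measurable (curve_law g \<epsilon> f)" "\<And>y. 0 \<le> r y"
    "curve_law g \<epsilon> f' = density (curve_law g \<epsilon> f) r"
    "(\<integral>\<^sup>+ y. ennreal ((r y)\<^sup>2) \<partial>curve_law g \<epsilon> f) \<le> ennreal (1 + \<eta>\<^sup>2 * (\<Gamma>\<^sup>2 + 10 * exp 9 * (U\<^sup>2 + \<eta>\<^sup>2)))"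
proof -
  let ?S = "{-int m..int m}" and ?M = "shift_law g"
  let ?u = "shift_coord \<epsilon> (fourier_coef f)" and ?v = "shift_coord \<epsilon> (fourier_coef f')"
  have mu: "gauss_mixture ?M ?S ?u U" by (rule gauss_mixture_shift[OF g hermitian_fourier_coef U(1) b(1) \<epsilon>])
  have mv: "gauss_mixture ?M ?S ?v V" by (rule gauss_mixture_shift[OF g hermitian_fourier_coef V b(2) \<epsilon>])
  interpret u: gauss_mixture ?M ?S ?u U by (rule mu)
  interpret v: gauss_mixture ?M ?S ?v V by (rule mv)
  let ?Lu = "mix_lik ?M ?S ?u" and ?Lv = "mix_lik ?M ?S ?v"
  define \<theta> where "\<theta> l = fourier_coef f' l - fourier_coef f l" for l
  have \<theta>: "hermitian_seq \<theta>"
    using hermitian_fourier_coef[of f] hermitian_fourier_coef[of f'] by (simp add: hermitian_seq_def \<theta>_def)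
  have d: "?v t l - ?u t l = shift_coord \<epsilon> \<theta> t l" for t l
    unfolding shift_coord_diff \<theta>_def ..
  have lawu: "curve_law g \<epsilon> f = distr (density std_gauss_seq (\<lambda>z. ennreal (?Lu z))) curve_space (curve_map \<epsilon>)"
    by (rule curve_law_eq_mix[OF g \<epsilon> U(1) supp(1) b(1)])
  have lawv: "curve_law g \<epsilon> f' = distr (density std_gauss_seq (\<lambda>z. ennreal (?Lv z))) curve_space (curve_map \<epsilon>)"
    by (rule curve_law_eq_mix[OF g \<epsilon> V supp(2) b(2)])
  \<comment> \<open>Recovers the real sequence from the curve, which makes the likelihood ratio a
    function of the observation.\<close>
  define Z where "Z y = (\<lambda>l. real_coord y l / \<epsilon>)" for y
  have Zc: "Z (curve_map \<epsilon> z) = z" for z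
    unfolding Z_def curve_map_def real_coord_noise_coord using \<epsilon> by auto
  have Zm: "Z \<in> measurable curve_space (PiM UNIV (\<lambda>_. borel))"
    unfolding Z_def curve_space_def real_coord_def
  proof (rule measurable_PiM_single', goal_cases)
    case (1 l)
    show ?case by measurable
  qed auto
  define r where "r y = ?Lv (Z y) / ?Lu (Z y)" for y
  have rm: "r \<in> borel_measurable curve_space"
    unfolding r_def using u.mix_lik_measurable v.mix_lik_measurable
    by (intro borel_measurable_divide measurable_compose[OF Zm]) (simp_all add: measurable_std_gauss_seq_cong)
  have r0: "0 \<le> r y" for y unfolding r_def using u.mix_lik_pos v.mix_lik_pos by (simp add: less_imp_le)
  have rc: "r (curve_map \<epsilon> z) = ?Lv z / ?Lu z" for z by (simp add: r_def Zc)
  have cm: "curve_map \<epsilon> \<in> measurable std_gauss_seq curve_space"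
    unfolding measurable_std_gauss_seq_cong by (rule curve_map_measurable)
  have "density (curve_law g \<epsilon> f) r = distr (density (density std_gauss_seq (\<lambda>z. ennreal (?Lu z))) (\<lambda>z. ennreal (r (curve_map \<epsilon> z)))) curve_space (curve_map \<epsilon>)"
    unfolding lawu using rm cm by (intro density_distr) auto
  also have "density (density std_gauss_seq (\<lambda>z. ennreal (?Lu z))) (\<lambda>z. ennreal (r (curve_map \<epsilon> z))) =
    density std_gauss_seq (\<lambda>z. ennreal (?Lu z) * ennreal (r (curve_map \<epsilon> z)))"
    using measurable_compose[OF cm rm] by (intro density_density_eq) auto
  also have "(\<lambda>z. ennreal (?Lu z) * ennreal (r (curve_map \<epsilon> z))) = (\<lambda>z. ennreal (?Lv z))"
  proof
    fix z
    have "?Lu z * (?Lv z / ?Lu z) = ?Lv z" using u.mix_lik_pos[of z] by simp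
    then show "ennreal (?Lu z) * ennreal (r (curve_map \<epsilon> z)) = ennreal (?Lv z)"
      unfolding rc using u.mix_lik_pos[of z] v.mix_lik_pos[of z] by (simp add: less_imp_le flip: ennreal_mult)
  qed
  finally have dens: "curve_law g \<epsilon> f' = density (curve_law g \<epsilon> f) r" using lawv by simp
  have rm2: "(\<lambda>z. r (curve_map \<epsilon> z)) \<in> borel_measurable std_gauss_seq" by (rule measurable_compose[OF cm rm])
  have "(\<integral>\<^sup>+ y. ennreal ((r y)\<^sup>2) \<partial>curve_law g \<epsilon> f) = (\<integral>\<^sup>+ z. ennreal (?Lu z) * ennreal ((r (curve_map \<epsilon> z))\<^sup>2) \<partial>std_gauss_seq)"
    unfolding lawu using cm rm rm2 by (subst nn_integral_distr, simp, simp, subst nn_integral_density) auto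
  also have "\<dots> = (\<integral>\<^sup>+ z. ennreal ((?Lv z)\<^sup>2 / ?Lu z) \<partial>std_gauss_seq)"
  proof (intro nn_integral_cong)
    fix z
    have "?Lu z * (?Lv z / ?Lu z)\<^sup>2 = (?Lv z)\<^sup>2 / ?Lu z" using u.mix_lik_pos[of z] by (simp add: power2_eq_square field_simps)
    then show "ennreal (?Lu z) * ennreal ((r (curve_map \<epsilon> z))\<^sup>2) = ennreal ((?Lv z)\<^sup>2 / ?Lu z)"
      unfolding rc using u.mix_lik_pos[of z] by (simp add: less_imp_le flip: ennreal_mult)
  qed
  also have "\<dots> \<le> ennreal (1 + ((\<Sum>l\<in>?S. (\<integral>t. ?v t l - ?u t l \<partial>?M)\<^sup>2) + 10 * exp 9 * \<eta>\<^sup>2 * (U\<^sup>2 + \<eta>\<^sup>2)))"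
  proof (rule mix_lik_chi_square_le[OF mu mv U(2) \<eta>])
    fix t
    show "(\<Sum>l\<in>?S. (?v t l - ?u t l)\<^sup>2) \<le> \<eta>\<^sup>2"
      unfolding d shift_coord_sq[OF \<theta>] using b(3) \<epsilon> by (simp add: \<theta>_def power_mult_distrib field_simps)
  qed
  also have "\<dots> \<le> ennreal (1 + \<eta>\<^sup>2 * (\<Gamma>\<^sup>2 + 10 * exp 9 * (U\<^sup>2 + \<eta>\<^sup>2)))"
  proof (rule ennreal_leI)
    have "(\<Sum>l\<in>?S. (\<integral>t. ?v t l - ?u t l \<partial>?M)\<^sup>2) = (\<Sum>l\<in>?S. (real_coord (\<lambda>l. \<theta> l * gamma_coef g l) l)\<^sup>2) / \<epsilon>\<^sup>2"
      unfolding d integral_shift_coord[OF g] by (simp add: power_divide sum_divide_distrib)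
    also have "(\<Sum>l\<in>?S. (real_coord (\<lambda>l. \<theta> l * gamma_coef g l) l)\<^sup>2) = (\<Sum>l\<in>?S. (cmod (\<theta> l * gamma_coef g l))\<^sup>2)"
      using \<theta> hermitian_gamma_coef[of g] by (intro sum_real_coord_sq) (simp add: hermitian_seq_def)
    also have "\<dots> \<le> (\<Sum>l\<in>?S. (cmod (\<theta> l))\<^sup>2 * \<Gamma>\<^sup>2)"
    proof (rule sum_mono)
      fix l
      \<comment> \<open>At frequencies where the signals agree both sides are 0, so no bound on the
        gamma coefficient is called for.\<close>
      show "(cmod (\<theta> l * gamma_coef g l))\<^sup>2 \<le> (cmod (\<theta> l))\<^sup>2 * \<Gamma>\<^sup>2"
        using \<Gamma>[of l] by (cases "\<theta> l = 0") (auto simp: \<theta>_def norm_mult power_mult_distrib intro!: mult_left_mono power_mono)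
    qed
    also have "\<dots> \<le> (\<epsilon> * \<eta>)\<^sup>2 * \<Gamma>\<^sup>2"
      unfolding sum_distrib_right[symmetric] using b(3) by (intro mult_right_mono) (auto simp: \<theta>_def)
    finally have "(\<Sum>l\<in>?S. (\<integral>t. ?v t l - ?u t l \<partial>?M)\<^sup>2) \<le> \<eta>\<^sup>2 * \<Gamma>\<^sup>2"
      using \<epsilon> by (simp add: power_mult_distrib field_simps)
    then show "1 + ((\<Sum>l\<in>?S. (\<integral>t. ?v t l - ?u t l \<partial>?M)\<^sup>2) + 10 * exp 9 * \<eta>\<^sup>2 * (U\<^sup>2 + \<eta>\<^sup>2)) \<le> 1 + \<eta>\<^sup>2 * (\<Gamma>\<^sup>2 + 10 * exp 9 * (U\<^sup>2 + \<eta>\<^sup>2))"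
      by (simp add: algebra_simps)
  qed
  finally have chi: "(\<integral>\<^sup>+ y. ennreal ((r y)\<^sup>2) \<partial>curve_law g \<epsilon> f) \<le> ennreal (1 + \<eta>\<^sup>2 * (\<Gamma>\<^sup>2 + 10 * exp 9 * (U\<^sup>2 + \<eta>\<^sup>2)))" .
  have "r \<in> borel_measurable (curve_law g \<epsilon> f)"
    using rm measurable_cong_sets[OF sets_curve_law refl] by blast
  then show ?thesis by (rule that[OF _ r0 dens chi])
qed

lemma prob_space_curve_law:
  assumes g: "prob_density g"
  shows "prob_space (curve_law g \<epsilon> f)"
proof -
  interpret M: prob_space "shift_law g" by (rule prob_space_shift_law[OF g])
  interpret G: prob_space std_gauss_seq by (rule prob_space_std_gauss_seq)
  interpret pair_prob_space "shift_law g" std_gauss_seq ..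
  have [measurable]: "cis \<in> borel_measurable borel"
    by (intro borel_measurable_continuous_onI continuous_on_cis continuous_on_id)
  have [measurable]: "(\<lambda>p. snd p l) \<in> borel_measurable (shift_law g \<Otimes>\<^sub>M std_gauss_seq)" for l
    by (intro measurable_compose[OF measurable_snd] coord_measurable_std_gauss_seq)
  have [measurable]: "(\<lambda>p. fst p) \<in> borel_measurable (shift_law g \<Otimes>\<^sub>M std_gauss_seq)"
    by (rule measurable_compose[OF measurable_fst]) simp
  show ?thesis
    unfolding curve_law_def
  proof (rule P.prob_space_distr, unfold curve_space_def split_def, rule measurable_PiM_single', goal_cases)
    case (1 l)
    show ?case unfolding noise_coord_def by measurable
  qed auto
qed

section \<open>Assouad's lemma\<close>

definition flip :: "nat \<Rightarrow> nat set \<Rightarrow> nat set" where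
  "flip k W = (if k \<in> W then W - {k} else insert k W)"

lemma flip_flip: "flip k (flip k W) = W"
  by (auto simp: flip_def)

text \<open>Only the k-th summand changes. The general codomain lets the identity serve both real
  function values and complex Fourier coefficients.\<close>

lemma sum_sign_flip:
  fixes b :: "nat \<Rightarrow> 'a :: real_algebra_1"
  assumes "k < N"
  shows "(\<Sum>i<N. of_real (a * (if i \<in> flip k W then 1 else -1)) * b i) - (\<Sum>i<N. of_real (a * (if i \<in> W then 1 else -1)) * b i)
    = of_real (2 * a * (if k \<in> W then -1 else 1)) * b k"
proof -
  have sgn: "a * (if i \<in> flip k W then 1 else -1) - a * (if i \<in> W then 1 else -1) =
    (if i = k then 2 * a * (if k \<in> W then -1 else 1) else 0)" for i
    by (cases "i = k"; cases "k \<in> W") (simp_all add: flip_def)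
  have "(\<Sum>i<N. of_real (a * (if i \<in> flip k W then 1 else -1)) * b i) - (\<Sum>i<N. of_real (a * (if i \<in> W then 1 else -1)) * b i)
    = (\<Sum>i<N. if i = k then of_real (2 * a * (if k \<in> W then -1 else 1)) * b k else 0)"
    unfolding sum_subtractf[symmetric] left_diff_distrib[symmetric] of_real_diff[symmetric] sgn
    by (intro sum.cong refl) simp
  also have "\<dots> = of_real (2 * a * (if k \<in> W then -1 else 1)) * b k" using assms by simp
  finally show ?thesis .
qed

lemma cube_fun_flip_diff:
  assumes "k < N"
  shows "\<bar>cube_fun a N (flip k W) x - cube_fun a N W x\<bar> = 2 * \<bar>a\<bar> * \<bar>bump N k x\<bar>"
  using sum_sign_flip[OF assms, of a W "\<lambda>i. bump N i x"]
  by (simp add: cube_fun_def sum_distrib_left mult.assoc abs_mult)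

lemma fourier_cube_fun_flip_diff:
  assumes "k < N"
  shows "cmod (fourier_coef (cube_fun a N (flip k W)) l - fourier_coef (cube_fun a N W) l) = 2 * \<bar>a\<bar> * cmod (fourier_coef (bump N k) l)"
  unfolding fourier_coef_cube_fun sum_sign_flip[OF assms, of a W "\<lambda>i. fourier_coef (bump N i) l"]
  by (simp add: norm_mult abs_mult)

section \<open>Splitting the risk over disjoint cells\<close>

definition cell :: "nat \<Rightarrow> nat \<Rightarrow> real set" where
  "cell N k = {real k / real N .. real k / real N + 1 / (16 * real N)}"

text \<open>The risk charged to one sign: the loss is restricted to the cell \<open>I\<close>, while
  the data still come from the whole sample.\<close>

definition local_risk :: "(real \<Rightarrow> real) \<Rightarrow> real \<Rightarrow> nat \<Rightarrow> ((nat \<Rightarrow> int \<Rightarrow> complex) \<Rightarrow> real \<Rightarrow> real)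
      \<Rightarrow> real set \<Rightarrow> (real \<Rightarrow> real) \<Rightarrow> ennreal" where
  "local_risk g \<epsilon> n fh I f = (\<integral>\<^sup>+ Y. (\<integral>\<^sup>+ x\<in>I. ennreal ((fh Y x - f x)^2) \<partial>lborel) \<partial>obs_law g \<epsilon> n f)"

lemma sets_obs_law: "sets (obs_law g \<epsilon> n f) = sets (obs_space n)"
  unfolding obs_law_def obs_space_def by (intro sets_PiM_cong refl sets_curve_law)

lemma loss_measurable:
  assumes fh: "fh \<in> estimators n" and f [measurable]: "f \<in> borel_measurable borel" and I [measurable]: "I \<in> sets borel"
  shows "(\<lambda>Y. \<integral>\<^sup>+ x\<in>I. ennreal ((fh Y x - f x)^2) \<partial>lborel) \<in> borel_measurable (obs_law g \<epsilon> n f')"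
proof -
  have [measurable]: "(\<lambda>p. fh (fst p) (snd p)) \<in> borel_measurable (obs_space n \<Otimes>\<^sub>M lborel)"
    using fh by (simp add: estimators_def split_def)
  have "(\<lambda>(Y, x). ennreal ((fh Y x - f x)^2) * indicator I x) \<in> borel_measurable (obs_space n \<Otimes>\<^sub>M lborel)"
    unfolding split_def by measurable
  then have "(\<lambda>Y. \<integral>\<^sup>+ x\<in>I. ennreal ((fh Y x - f x)^2) \<partial>lborel) \<in> borel_measurable (obs_space n)"
    by (rule lborel.borel_measurable_nn_integral)
  then show ?thesis using measurable_cong_sets[OF sets_obs_law refl] by blast
qed

lemma cell_bounds:
  assumes "x \<in> cell N i" "N > 0"
  shows "real i \<le> real N * x" "real N * x \<le> real i + 1/16"
proof -
  have "real N * (real i / real N) \<le> real N * x" "real N * x \<le> real N * (real i / real N + 1 / (16 * real N))"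
    using assms(1) unfolding cell_def by (intro mult_left_mono; simp)+
  then show "real i \<le> real N * x" "real N * x \<le> real i + 1/16"
    using assms(2) by (simp_all add: distrib_left)
qed

text \<open>Scaled by N, cell k lies in [k, k + 1/16], so cells with different indices are disjoint
  and the last one ends before N.\<close>

lemma sum_indicator_cells_le:
  assumes N: "N > 0"
  shows "(\<Sum>k<N. indicator (cell N k) x :: ennreal) \<le> indicator {0..1} x"
proof (cases "\<exists>k<N. x \<in> cell N k")
  case True
  then obtain k where k: "k < N" "x \<in> cell N k" by auto
  note kx = cell_bounds[OF k(2) N]
  have uniq: "i = k" if "i < N" "x \<in> cell N i" for i
    using cell_bounds[OF that(2) N] kx by linarith
  have "(\<Sum>i<N. indicator (cell N i) x :: ennreal) = (\<Sum>i<N. if i = k then 1 else 0)"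
  proof (intro sum.cong refl)
    fix i assume "i \<in> {..<N}"
    then show "(indicator (cell N i) x :: ennreal) = (if i = k then 1 else 0)"
      using uniq[of i] k(2) by (cases "i = k") (simp_all add: indicator_def, blast)
  qed
  also have "\<dots> = 1" using k by simp
  finally have 1: "(\<Sum>i<N. indicator (cell N i) x :: ennreal) = 1" .
  have "real (Suc k) \<le> real N" using k(1) by (simp only: of_nat_le_iff Suc_le_eq)
  then have "real k + 1 \<le> real N" by simp
  then have "real N * 0 \<le> real N * x" "real N * x \<le> real N * 1" using kx by linarith+
  then have "x \<in> {0..1}" using N by (simp only: mult_le_cancel_left_pos of_nat_0_less_iff atLeastAtMost_iff)
  then show ?thesis using 1 by simp
next
  case False
  then have "(\<Sum>i<N. indicator (cell N i) x :: ennreal) = 0" by (intro sum.neutral) (auto simp: indicator_def)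
  then show ?thesis by simp
qed

lemma cell_measurable [measurable]: "cell N k \<in> sets borel"
  by (simp add: cell_def)

lemma sum_local_risk_le:
  assumes N: "N > 0" and fh: "fh \<in> estimators n" and f [measurable]: "f \<in> borel_measurable borel"
  shows "(\<Sum>k<N. local_risk g \<epsilon> n fh (cell N k) f) \<le> risk g \<epsilon> n fh f"
proof -
  have "(\<Sum>k<N. local_risk g \<epsilon> n fh (cell N k) f) =
    (\<integral>\<^sup>+ Y. (\<Sum>k<N. \<integral>\<^sup>+ x\<in>cell N k. ennreal ((fh Y x - f x)^2) \<partial>lborel) \<partial>obs_law g \<epsilon> n f)"
    unfolding local_risk_def by (intro nn_integral_sum[symmetric] loss_measurable[OF fh]) auto
  also have "\<dots> \<le> risk g \<epsilon> n fh f"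
    unfolding risk_def
  proof (rule nn_integral_mono)
    fix Y assume "Y \<in> space (obs_law g \<epsilon> n f)"
    then have Y: "Y \<in> space (obs_space n)" using sets_eq_imp_space_eq[OF sets_obs_law] by blast
    have "(\<lambda>(Y, x). fh Y x) \<in> borel_measurable (obs_space n \<Otimes>\<^sub>M lborel)" using fh by (simp add: estimators_def)
    from measurable_Pair2[OF this Y] have [measurable]: "fh Y \<in> borel_measurable borel" by simp
    have "(\<Sum>k<N. \<integral>\<^sup>+ x\<in>cell N k. ennreal ((fh Y x - f x)^2) \<partial>lborel) =
      (\<integral>\<^sup>+ x. (\<Sum>k<N. ennreal ((fh Y x - f x)^2) * indicator (cell N k) x) \<partial>lborel)"
      by (intro nn_integral_sum[symmetric]) auto
    also have "\<dots> \<le> (\<integral>\<^sup>+ x\<in>{0..1}. ennreal ((fh Y x - f x)^2) \<partial>lborel)"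
      unfolding sum_distrib_left[symmetric] by (intro nn_integral_mono mult_left_mono sum_indicator_cells_le N) auto
    finally show "(\<Sum>k<N. \<integral>\<^sup>+ x\<in>cell N k. ennreal ((fh Y x - f x)^2) \<partial>lborel) \<le> (\<integral>\<^sup>+ x\<in>{0..1}. ennreal ((fh Y x - f x)^2) \<partial>lborel)" .
  qed
  finally show ?thesis .
qed

text \<open>Two vertices that differ in one sign are nearly indistinguishable from n curves by the
  chi-square bound, yet they are separated on the cell of that sign, so no estimator does well there
  for both.\<close>

lemma cube_pair_local_risk:
  assumes g: "prob_density g" and \<epsilon>: "\<epsilon> > 0" and N: "N > 0" and k: "k < N" and a: "0 \<le> a" and ae: "2 * a \<le> \<epsilon>"
    and fh: "fh \<in> estimators n"
    and \<Gamma>: "\<And>l. int N < \<bar>l\<bar> \<Longrightarrow> cmod (gamma_coef g l) \<le> \<Gamma>"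
    and n: "real n * (4 * (a / \<epsilon>)\<^sup>2 / real N * (\<Gamma>\<^sup>2 + 50 * exp 9 * (a / \<epsilon>)\<^sup>2)) \<le> 1/2"
  shows "ennreal (a\<^sup>2 / (256 * real N)) \<le> local_risk g \<epsilon> n fh (cell N k) (cube_fun a N W) + local_risk g \<epsilon> n fh (cell N k) (cube_fun a N (flip k W))"
proof -
  let ?f = "cube_fun a N W" and ?f' = "cube_fun a N (flip k W)" and ?S = "{-int (3 * N)..int (3 * N)}"
  \<comment> \<open>In noise units \<open>U\<close> bounds the norm of any cube function, by its sup
    norm \<open>a\<close>, and \<open>\<eta>\<close> bounds the norm of a flip, namely 2a times a
    bump of squared norm at most 1/N.\<close>
  define U where "U = a / \<epsilon>"
  define \<eta> where "\<eta> = 2 * a / (\<epsilon> * sqrt (real N))"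
  have sN: "1 \<le> sqrt (real N)" using N by simp
  have U: "0 \<le> U" "U \<le> 1" using a ae \<epsilon> by (auto simp: U_def field_simps)
  have \<eta>0: "0 \<le> \<eta>" using a \<epsilon> by (simp add: \<eta>_def)
  have "\<eta> \<le> 2 * a / (\<epsilon> * 1)" unfolding \<eta>_def using a \<epsilon> sN by (intro divide_left_mono mult_left_mono) auto
  also have "\<dots> \<le> 1" using ae \<epsilon> by simp
  finally have \<eta>1: "\<eta> \<le> 1" .
  have \<eta>2: "\<eta>\<^sup>2 = 4 * U\<^sup>2 / real N"
    unfolding \<eta>_def U_def power_divide power_mult_distrib by simp
  have cb: "continuous_on UNIV (bump N k)" "continuous_on UNIV (cube_fun a N W)" for W k
    by (rule continuous_on_bump continuous_on_cube_fun)+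
  have fm [measurable]: "cube_fun a N W \<in> borel_measurable borel" for W
    by (rule borel_measurable_continuous_onI[OF cb(2)])
  have supp: "fourier_coef (cube_fun a N W) l = 0" if "l \<notin> ?S" for l W
    using that by (intro fourier_coef_cube_fun_eq_0) auto
  have bU: "(\<Sum>l\<in>?S. (cmod (fourier_coef (cube_fun a N W) l))\<^sup>2) \<le> (\<epsilon> * U)\<^sup>2" for W
  proof -
    have "(\<Sum>l\<in>?S. (cmod (fourier_coef (cube_fun a N W) l))\<^sup>2) \<le> integral {0..1} (\<lambda>x. (cube_fun a N W x)\<^sup>2)"
      by (intro fourier_coef_bessel cb) auto
    also have "\<dots> \<le> integral {0..1} (\<lambda>x::real. a\<^sup>2)"
    proof (rule integral_le)
      show "(\<lambda>x. (cube_fun a N W x)\<^sup>2) integrable_on {0..1}"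
        by (intro integrable_continuous_interval continuous_intros continuous_on_cube_fun)
      fix x :: real
      show "(cube_fun a N W x)\<^sup>2 \<le> a\<^sup>2"
        using abs_cube_fun_le[OF N a, of W x] a by (simp add: abs_le_square_iff[symmetric])
    qed auto
    finally show ?thesis using \<epsilon> by (simp add: U_def)
  qed
  have bE: "(\<Sum>l\<in>?S. (cmod (fourier_coef ?f' l - fourier_coef ?f l))\<^sup>2) \<le> (\<epsilon> * \<eta>)\<^sup>2"
  proof -
    have "(\<Sum>l\<in>?S. (cmod (fourier_coef ?f' l - fourier_coef ?f l))\<^sup>2) = 4 * a\<^sup>2 * (\<Sum>l\<in>?S. (cmod (fourier_coef (bump N k) l))\<^sup>2)"
      unfolding fourier_cube_fun_flip_diff[OF k] by (simp add: power_mult_distrib sum_distrib_left)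
    also have "\<dots> \<le> 4 * a\<^sup>2 * (1 / real N)"
      by (intro mult_left_mono order_trans[OF fourier_coef_bessel[OF cb(1)] bump_sq_integral_le[OF N]]) auto
    also have "\<dots> = (\<epsilon> * \<eta>)\<^sup>2" unfolding power_mult_distrib \<eta>2 using \<epsilon> by (simp add: U_def power_divide)
    finally show ?thesis .
  qed
  have \<Gamma>': "cmod (gamma_coef g l) \<le> \<Gamma>" if "fourier_coef ?f' l \<noteq> fourier_coef ?f l" for l
  proof (rule \<Gamma>, rule ccontr)
    assume "\<not> int N < \<bar>l\<bar>"
    then show False using that fourier_coef_cube_fun_eq_0[of l N a] by simp
  qed
  obtain r :: "(int \<Rightarrow> complex) \<Rightarrow> real" where r: "r \<in> borel_measurable (curve_law g \<epsilon> ?f)" "\<And>y. 0 \<le> r y"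
    "curve_law g \<epsilon> ?f' = density (curve_law g \<epsilon> ?f) r"
    "(\<integral>\<^sup>+ y. ennreal ((r y)\<^sup>2) \<partial>curve_law g \<epsilon> ?f) \<le> ennreal (1 + \<eta>\<^sup>2 * (\<Gamma>\<^sup>2 + 10 * exp 9 * (U\<^sup>2 + \<eta>\<^sup>2)))"
    using curve_law_density[OF g \<epsilon> U U(1) \<eta>0 \<eta>1 supp supp bU bU bE \<Gamma>'] by blast
  define x where "x = \<eta>\<^sup>2 * (\<Gamma>\<^sup>2 + 10 * exp 9 * (U\<^sup>2 + \<eta>\<^sup>2))"
  have x0: "0 \<le> x" by (simp add: x_def)
  \<comment> \<open>As N >= 1, \<open>\<eta>\<close>^2 is at most 4 U^2; this turns the constant 10
    into 50.\<close>
  have "4 * U\<^sup>2 / real N \<le> 4 * U\<^sup>2 / 1" using N by (intro divide_left_mono) auto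
  then have "U\<^sup>2 + \<eta>\<^sup>2 \<le> 5 * U\<^sup>2" unfolding \<eta>2 by simp
  then have "10 * exp 9 * (U\<^sup>2 + \<eta>\<^sup>2) \<le> 10 * exp 9 * (5 * U\<^sup>2)" by (intro mult_left_mono) auto
  then have "x \<le> \<eta>\<^sup>2 * (\<Gamma>\<^sup>2 + 50 * exp 9 * U\<^sup>2)" unfolding x_def by (intro mult_left_mono) auto
  then have "real n * x \<le> real n * (\<eta>\<^sup>2 * (\<Gamma>\<^sup>2 + 50 * exp 9 * U\<^sup>2))" by (rule mult_left_mono) simp
  also have "\<dots> \<le> 1/2" using n unfolding \<eta>2 U_def .
  finally have nx: "real n * x \<le> 1/2" .
  let ?I = "cell N k"
  let ?A = "\<lambda>f Y. \<integral>\<^sup>+ x\<in>?I. ennreal ((fh Y x - f x)^2) \<partial>lborel"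
  have Am: "?A f \<in> borel_measurable (PiM {..<n} (\<lambda>_. curve_law g \<epsilon> ?f))" if "f \<in> borel_measurable borel" for f
    using loss_measurable[OF fh that cell_measurable, of N k g \<epsilon> ?f] by (simp add: obs_law_def)
  \<comment> \<open>On the cell the two functions differ by at least 2a/4. The squared losses then
    add up to at least a^2/8, and the cell has length 1/(16 N).\<close>
  have "ennreal (a\<^sup>2 / (128 * real N) / 2) \<le> (\<integral>\<^sup>+ Y. ?A ?f Y \<partial>PiM {..<n} (\<lambda>_. curve_law g \<epsilon> ?f)) + (\<integral>\<^sup>+ Y. ?A ?f' Y \<partial>PiM {..<n} (\<lambda>_. density (curve_law g \<epsilon> ?f) r))"
  proof (rule two_point_lower_bound[OF prob_space_curve_law[OF g] _ r(1,2) x0 nx _ Am Am])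
    show "prob_space (density (curve_law g \<epsilon> ?f) (\<lambda>x. ennreal (r x)))"
      unfolding r(3)[symmetric] by (rule prob_space_curve_law[OF g])
    show "(\<integral>\<^sup>+ y. ennreal ((r y)\<^sup>2) \<partial>curve_law g \<epsilon> ?f) \<le> ennreal (1 + x)" using r(4) unfolding x_def .
    show "0 \<le> a\<^sup>2 / (128 * real N)" by simp
    fix Y assume "Y \<in> space (PiM {..<n} (\<lambda>_. curve_law g \<epsilon> ?f))"
    then have Y: "Y \<in> space (obs_space n)" using sets_eq_imp_space_eq[OF sets_obs_law] unfolding obs_law_def by blast
    have "(\<lambda>(Y, x). fh Y x) \<in> borel_measurable (obs_space n \<Otimes>\<^sub>M lborel)" using fh by (simp add: estimators_def)
    from measurable_Pair2[OF this Y] have [measurable]: "fh Y \<in> borel_measurable borel" by simp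
    have "ennreal (a\<^sup>2 / (128 * real N)) = ennreal (a\<^sup>2 / 8) * emeasure lborel ?I"
      using N by (simp add: cell_def emeasure_lborel_Icc flip: ennreal_mult)
    also have "\<dots> = (\<integral>\<^sup>+ x\<in>?I. ennreal (a\<^sup>2 / 8) \<partial>lborel)"
      by (subst nn_integral_cmult_indicator) auto
    also have "\<dots> \<le> (\<integral>\<^sup>+ x. ennreal ((fh Y x - ?f x)^2) * indicator ?I x + ennreal ((fh Y x - ?f' x)^2) * indicator ?I x \<partial>lborel)"
    proof (rule nn_integral_mono)
      fix x
      show "ennreal (a\<^sup>2 / 8) * indicator ?I x \<le> ennreal ((fh Y x - ?f x)^2) * indicator ?I x + ennreal ((fh Y x - ?f' x)^2) * indicator ?I x"
      proof (cases "x \<in> ?I")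
        case True
        then have b: "1/4 \<le> bump N k x" by (intro bump_lower_bound N) (auto simp: cell_def)
        have "(a / 2)\<^sup>2 \<le> (2 * a * bump N k x)\<^sup>2"
          using b a mult_left_mono[OF b, of "2 * a"] by (intro power_mono) auto
        also have "\<dots> = (?f' x - ?f x)\<^sup>2"
        proof -
          have "(?f' x - ?f x)\<^sup>2 = (\<bar>?f' x - ?f x\<bar>)\<^sup>2" by simp
          then show ?thesis unfolding cube_fun_flip_diff[OF k] by (simp add: power_mult_distrib)
        qed
        also have "\<dots> \<le> 2 * ((fh Y x - ?f x)^2 + (fh Y x - ?f' x)^2)"
        proof -
          have "0 \<le> ((fh Y x - ?f x) + (fh Y x - ?f' x))\<^sup>2" by simp
          then show ?thesis by (simp add: power2_eq_square algebra_simps)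
        qed
        finally have "a\<^sup>2 / 8 \<le> (fh Y x - ?f x)^2 + (fh Y x - ?f' x)^2" by (simp add: power_divide)
        then have "ennreal (a\<^sup>2 / 8) \<le> ennreal ((fh Y x - ?f x)^2 + (fh Y x - ?f' x)^2)" by (rule ennreal_leI)
        then show ?thesis using True by simp
      qed simp
    qed
    also have "\<dots> = ?A ?f Y + ?A ?f' Y" by (rule nn_integral_add) auto
    finally show "ennreal (a\<^sup>2 / (128 * real N)) \<le> ?A ?f Y + ?A ?f' Y" .
  qed auto
  then show ?thesis unfolding local_risk_def obs_law_def r(3)[symmetric] by simp
qed

text \<open>The supremum dominates the average over all 2^N vertices. For fixed \<open>k\<close> the
  involution \<open>flip k\<close> permutes the vertices, so the pair bound is a bound on twice the
  average local risk; summing over the N cells gives N d/2.\<close>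

lemma sup_risk_ge:
  assumes cube: "\<And>W. cube_fun a N W \<in> F" and N: "N > 0" and fh: "fh \<in> estimators n" and d: "0 \<le> d"
    and pair: "\<And>k W. k < N \<Longrightarrow> ennreal d \<le> local_risk g \<epsilon> n fh (cell N k) (cube_fun a N W) + local_risk g \<epsilon> n fh (cell N k) (cube_fun a N (flip k W))"
  shows "ennreal (real N * d / 2) \<le> (SUP f\<in>F. risk g \<epsilon> n fh f)"
proof -
  let ?T = "SUP f\<in>F. risk g \<epsilon> n fh f" and ?P = "Pow {..<N}"
  let ?r = "\<lambda>k W. local_risk g \<epsilon> n fh (cell N k) (cube_fun a N W)"
  have fm: "cube_fun a N W \<in> borel_measurable borel" for W
    by (rule borel_measurable_continuous_onI[OF continuous_on_cube_fun])
  have flipsum: "(\<Sum>W\<in>?P. ?r k (flip k W)) = (\<Sum>W\<in>?P. ?r k W)" if "k < N" for k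
    by (rule sum.reindex_bij_witness[of _ "flip k" "flip k"]) (use that in \<open>auto simp: flip_flip, auto simp: flip_def split: if_splits\<close>)
  have card: "card ?P = 2^N" by (simp add: card_Pow)
  have "of_nat (2^N) * (of_nat N * ennreal d) = (\<Sum>k<N. \<Sum>W\<in>?P. ennreal d)"
    by (simp add: card mult_ac)
  also have "\<dots> \<le> (\<Sum>k<N. \<Sum>W\<in>?P. ?r k W + ?r k (flip k W))" by (intro sum_mono pair) auto
  also have "\<dots> = (\<Sum>k<N. 2 * (\<Sum>W\<in>?P. ?r k W))"
    by (intro sum.cong refl) (simp add: sum.distrib flipsum mult_2)
  also have "\<dots> = 2 * (\<Sum>W\<in>?P. \<Sum>k<N. ?r k W)"
    by (subst sum.swap) (simp add: sum_distrib_left)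
  also have "\<dots> \<le> 2 * (\<Sum>W\<in>?P. ?T)"
  proof (intro mult_left_mono sum_mono)
    fix W
    show "(\<Sum>k<N. ?r k W) \<le> ?T"
      by (rule order_trans[OF sum_local_risk_le[OF N fh fm]]) (rule SUP_upper[OF cube])
  qed simp
  also have "\<dots> = of_nat (2^N) * (2 * ?T)" by (simp add: card mult_ac)
  finally have main: "of_nat (2^N) * (of_nat N * ennreal d) \<le> of_nat (2^N) * (2 * ?T)" .
  show ?thesis
  proof (cases ?T)
    case (real t)
    have "ennreal (real (2^N) * (real N * d)) \<le> ennreal (real (2^N) * (2 * t))"
      using main d real unfolding real by (simp add: ennreal_mult ennreal_of_nat_eq_real_of_nat flip: ennreal_numeral)
    then have "real (2^N) * (real N * d) \<le> real (2^N) * (2 * t)" using real by (subst (asm) ennreal_le_iff) auto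
    then have "real N * d / 2 \<le> t" by simp
    then show ?thesis unfolding real by (rule ennreal_leI)
  next
    case top
    show ?thesis unfolding top by simp
  qed
qed

section \<open>Choice of the resolution level and the amplitude\<close>

theorem theorem3:
  fixes g vb :: "real \<Rightarrow> real" and \<epsilon> \<nu> s A :: real and p q :: ereal
  assumes "prob_density g" and "\<epsilon> > 0"
    and "meyer_aux vb"
    and "assumption1 g \<nu>" and "\<nu> > 1/2"
    and "1 \<le> p" and "1 \<le> q" and "A > 0"
    and "s \<ge> 1 / real_of_ereal (min 2 p)"
    and "s \<ge> (2*\<nu> + 1) * (inv_ex p - 1/2)"
    and "s > 2*\<nu> + 1"
  shows "\<exists>M1 > 0. \<forall>\<^sub>F n in sequentially.
     ennreal (M1 * real n powr (- (2 * s) / (2 * s + 2 * \<nu> + 1)))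
       \<le> (INF fh \<in> estimators n. SUP f \<in> besov_ball vb s p q A. risk g \<epsilon> n fh f)"
proof -
  note g = assms(1) and \<epsilon> = assms(2)
  have \<nu>: "\<nu> > 0" and s\<nu>: "s \<ge> \<nu>" and s: "s > 0" using assms(5,11) by linarith+
  obtain Cmin Cmax where gam: "0 < Cmin" "Cmin \<le> Cmax"
    "\<And>l. l \<noteq> 0 \<Longrightarrow> cmod (gamma_coef g l) \<le> Cmax * real_of_int \<bar>l\<bar> powr (- \<nu>)"
    using assms(4) unfolding assumption1_def by blast
  obtain c0 where c0: "c0 > 0" "\<And>c J W. 0 < c \<Longrightarrow> c \<le> c0 \<Longrightarrow>
    cube_fun (c * 2 powr (- (real J * s))) (2^J) W \<in> besov_ball vb s p q A"
    using cube_fun_in_besov_ball[OF assms(3,6,7,8) s] by blast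
  \<comment> \<open>Chosen so that the bracket in the chi-square bound is at most \<open>Q\<close>
    times N^(-2 nu).\<close>
  define Q where "Q = Cmax\<^sup>2 + 50 * exp 9"
  have Q: "Q \<ge> 50" unfolding Q_def using one_le_exp_iff[of "9::real"] zero_le_power2[of Cmax] by linarith
  \<comment> \<open>The amplitude in noise units. The first bound keeps the cube in the Besov ball;
    the second makes the sample chi-square bound 4 Q e^2 at most 1/2, as \<open>e\<close> is also at
    most 1.\<close>
  define e where "e = min (c0 / \<epsilon>) (1 / (8 * Q))"
  have e: "0 < e" "e \<le> c0 / \<epsilon>" "e \<le> 1 / (8 * Q)" using c0 \<epsilon> Q by (auto simp: e_def)
  have "1 / (8 * Q) \<le> 1/2" using Q by (simp add: field_simps)
  then have e2: "e \<le> 1/2" using e by linarith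
  define c where "c = e * \<epsilon>"
  have c: "0 < c" "c \<le> c0" using e \<epsilon> by (auto simp: c_def field_simps)
  define \<kappa> where "\<kappa> = 2 * s + 2 * \<nu> + 1"
  have \<kappa>: "\<kappa> > 0" using s \<nu> by (simp add: \<kappa>_def)
  \<comment> \<open>The factor 512 is 2 * 256 from the averaging and the pair bound;
    \<open>2 powr (- (2 * s))\<close> pays for rounding the resolution level up to an
    integer.\<close>
  define M1 where "M1 = c\<^sup>2 * 2 powr (- (2 * s)) / 512"
  have bound: "ennreal (M1 * real n powr (- (2 * s) / \<kappa>)) \<le> (SUP f \<in> besov_ball vb s p q A. risk g \<epsilon> n fh f)"
    if n: "n \<ge> 1" and fh: "fh \<in> estimators n" for n fh
  proof -
    \<comment> \<open>The real level at which 2^x equals n^(1/\<kappa>). Rounding up keeps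
      N^\<kappa> at least n, as indistinguishability demands.\<close>
    define x where "x = log 2 (real n) / \<kappa>"
    have x0: "x \<ge> 0" using n \<kappa> by (simp add: x_def)
    define J where "J = nat \<lceil>x\<rceil>"
    have J: "x \<le> real J" "real J \<le> x + 1" using x0 by (auto simp: J_def)
    define N :: nat where "N = 2^J"
    have N: "N > 0" by (simp add: N_def)
    have Np: "real N powr y = 2 powr (real J * y)" for y by (simp add: N_def powr_powr flip: powr_realpow)
    define \<tau> where "\<tau> = 2 powr (- (real J * s))"
    have \<tau>: "0 < \<tau>" "\<tau> \<le> 1" using s powr_mono[of "- (real J * s)" 0 2] by (auto simp: \<tau>_def)
    have \<tau>2: "\<tau>\<^sup>2 = 2 powr (- (2 * (real J * s)))"
      unfolding \<tau>_def power2_eq_square powr_add[symmetric] by (intro arg_cong[where f="\<lambda>y. 2 powr y"]) linarith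
    define a where "a = c * \<tau>"
    have a: "0 \<le> a" using c \<tau> by (simp add: a_def)
    have a\<epsilon>: "a / \<epsilon> = e * \<tau>" using \<epsilon> by (simp add: a_def c_def)
    have "e * \<tau> \<le> 1/2 * 1" using e e2 \<tau> by (intro mult_mono) auto
    then have ae: "2 * a \<le> \<epsilon>" using a\<epsilon> \<epsilon> by (simp add: field_simps)
    define \<Gamma> where "\<Gamma> = Cmax * 2 powr (- (real J * \<nu>))"
    have \<Gamma>: "cmod (gamma_coef g l) \<le> \<Gamma>" if l: "int N < \<bar>l\<bar>" for l
    proof -
      have l0: "l \<noteq> 0" using l by auto
      have "real_of_int (int N) \<le> real_of_int \<bar>l\<bar>" using l by (simp only: of_int_le_iff less_imp_le)
      then have Nl: "real N \<le> real_of_int \<bar>l\<bar>" by simp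
      have "cmod (gamma_coef g l) \<le> Cmax * real_of_int \<bar>l\<bar> powr (- \<nu>)" by (rule gam(3)[OF l0])
      also have "\<dots> \<le> Cmax * real N powr (- \<nu>)"
        using gam \<nu> N Nl by (intro mult_left_mono powr_mono2') auto
      also have "\<dots> = \<Gamma>" unfolding Np \<Gamma>_def by simp
      finally show ?thesis .
    qed
    have nn: "real n * (4 * (a / \<epsilon>)\<^sup>2 / real N * (\<Gamma>\<^sup>2 + 50 * exp 9 * (a / \<epsilon>)\<^sup>2)) \<le> 1/2"
    proof -
      define w where "w = 2 powr (- (2 * (real J * \<nu>)))"
      have "\<Gamma>\<^sup>2 = Cmax\<^sup>2 * w"
        unfolding \<Gamma>_def w_def power_mult_distrib power2_eq_square[of "2 powr _"] powr_add[symmetric]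
        by (intro arg_cong[where f="\<lambda>y. Cmax\<^sup>2 * 2 powr y"]) linarith
      \<comment> \<open>The remainder of the chi-square expansion is dominated by the leading term
        because N^(-2s) is at most N^(-2 nu).\<close>
      moreover have "(a / \<epsilon>)\<^sup>2 \<le> w"
      proof -
        have "(a / \<epsilon>)\<^sup>2 = e\<^sup>2 * \<tau>\<^sup>2" by (simp add: a\<epsilon> power_mult_distrib)
        also have "\<dots> \<le> 1 * \<tau>\<^sup>2" using e e2 by (intro mult_right_mono) (auto simp: power_le_one)
        also have "\<dots> \<le> w" unfolding \<tau>2 w_def mult_1 using s\<nu> by (intro powr_mono) (auto intro!: mult_left_mono)
        finally show ?thesis .
      qed
      then have "50 * exp 9 * (a / \<epsilon>)\<^sup>2 \<le> 50 * exp 9 * w" by (intro mult_left_mono) auto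
      ultimately have 1: "\<Gamma>\<^sup>2 + 50 * exp 9 * (a / \<epsilon>)\<^sup>2 \<le> Q * w" by (simp add: Q_def algebra_simps)
      have "real n = 2 powr (log 2 (real n))" using n by simp
      also have "log 2 (real n) = x * \<kappa>" using \<kappa> by (simp add: x_def)
      also have "2 powr (x * \<kappa>) \<le> 2 powr (real J * \<kappa>)" using J \<kappa> by (intro powr_mono mult_right_mono) auto
      finally have 2: "real n \<le> 2 powr (real J * \<kappa>)" .
      have 3: "4 * (a / \<epsilon>)\<^sup>2 / real N = 4 * e\<^sup>2 * (\<tau>\<^sup>2 * 2 powr (- real J))"
        unfolding a\<epsilon> power_mult_distrib by (simp add: N_def powr_minus powr_realpow divide_inverse)
      have "real n * (4 * (a / \<epsilon>)\<^sup>2 / real N * (\<Gamma>\<^sup>2 + 50 * exp 9 * (a / \<epsilon>)\<^sup>2)) \<le>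
        2 powr (real J * \<kappa>) * (4 * e\<^sup>2 * (\<tau>\<^sup>2 * 2 powr (- real J)) * (Q * w))"
        unfolding 3 by (intro mult_mono 2 1 order_refl) auto
      also have "\<dots> = 4 * e\<^sup>2 * Q * (2 powr (real J * \<kappa>) * (\<tau>\<^sup>2 * 2 powr (- real J) * w))" by (simp only: mult_ac)
      \<comment> \<open>The exponents cancel by the choice of \<open>\<kappa>\<close>: 2s from the
        amplitude, 1 from the localization of a bump, and 2 nu from the damping.\<close>
      also have "2 powr (real J * \<kappa>) * (\<tau>\<^sup>2 * 2 powr (- real J) * w) = 1"
        unfolding \<tau>2 w_def powr_add[symmetric] \<kappa>_def by (simp add: algebra_simps)
      also have "4 * e\<^sup>2 * Q * 1 = 4 * Q * e * e" by (simp add: power2_eq_square)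
      also have "\<dots> \<le> 4 * Q * (1 / (8 * Q)) * 1" using e e2 Q by (intro mult_mono) auto
      also have "\<dots> = 1/2" using Q by simp
      finally show ?thesis .
    qed
    have "ennreal (real N * (a\<^sup>2 / (256 * real N)) / 2) \<le> (SUP f \<in> besov_ball vb s p q A. risk g \<epsilon> n fh f)"
    proof (rule sup_risk_ge[OF _ N fh])
      show "cube_fun a N W \<in> besov_ball vb s p q A" for W
        unfolding a_def \<tau>_def N_def by (rule c0(2)[OF c])
      show "ennreal (a\<^sup>2 / (256 * real N)) \<le> local_risk g \<epsilon> n fh (cell N k) (cube_fun a N W) + local_risk g \<epsilon> n fh (cell N k) (cube_fun a N (flip k W))"
        if "k < N" for k W
        by (rule cube_pair_local_risk[OF g \<epsilon> N that a ae fh \<Gamma> nn])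
    qed simp
    moreover have "M1 * real n powr (- (2 * s) / \<kappa>) \<le> real N * (a\<^sup>2 / (256 * real N)) / 2"
    proof -
      \<comment> \<open>In terms of \<open>x\<close> the target rate is 2^(-2 s x), and J <= x + 1
        compares it with the squared amplitude.\<close>
      have "real n powr (- (2 * s) / \<kappa>) = (2 powr (log 2 (real n))) powr (- (2 * s) / \<kappa>)" using n by simp
      also have "\<dots> = 2 powr (- (2 * s) * x)" unfolding powr_powr by (simp add: x_def mult_ac)
      finally have "2 powr (- (2 * s)) * real n powr (- (2 * s) / \<kappa>) = 2 powr (- (2 * s * (x + 1)))"
        by (simp add: algebra_simps flip: powr_add)
      also have "\<dots> \<le> \<tau>\<^sup>2"
        unfolding \<tau>2 using J s by (intro powr_mono) (auto simp: mult.commute mult.assoc intro!: mult_left_mono)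
      finally have "c\<^sup>2 / 512 * (2 powr (- (2 * s)) * real n powr (- (2 * s) / \<kappa>)) \<le> c\<^sup>2 / 512 * \<tau>\<^sup>2"
        by (intro mult_left_mono) auto
      also have "\<dots> = real N * (a\<^sup>2 / (256 * real N)) / 2" using N by (simp add: a_def power_mult_distrib)
      finally show ?thesis by (simp add: M1_def mult_ac)
    qed
    ultimately show ?thesis by (meson ennreal_leI order_trans)
  qed
  show ?thesis
  proof (intro exI[of _ M1] conjI)
    show "M1 > 0" using c by (simp add: M1_def)
    show "\<forall>\<^sub>F n in sequentially. ennreal (M1 * real n powr (- (2 * s) / (2 * s + 2 * \<nu> + 1)))
       \<le> (INF fh \<in> estimators n. SUP f \<in> besov_ball vb s p q A. risk g \<epsilon> n fh f)"
      using eventually_ge_at_top[of 1]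
    proof eventually_elim
      case (elim n)
      show ?case unfolding \<kappa>_def[symmetric] by (intro INF_greatest bound elim)
    qed
  qed
qed

end
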